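(* Suppose $\beta\ge1+C_F^2$. Let $A\in\{a_\beta,b_\beta,c_\beta\}$ and let $F:U\to\mathbb{R}$ be a bounded linear functional. If $K\subseteq U$ is a non-empty convex and closed subset, then the variational inequality $$\text{find }\boldsymbol{u}\in K\text{ such that }A(\boldsymbol{u},\boldsymbol{v}-\boldsymbol{u})\ge F(\boldsymbol{v}-\boldsymbol{u})\quad\text{for all }\boldsymbol{v}\in K$$ admits a unique solution. In particular, for $f\in L^2(\Omega)$ and $g\in H_0^1(\Omega)$, each of the problems (VIa) find $\boldsymbol{u}\in K^s$ with $a_\beta(\boldsymbol{u},\boldsymbol{v}-\boldsymbol{u})\ge F_\beta(\boldsymbol{v}-\boldsymbol{u})$ for all $\boldsymbol{v}\in K^s$, (VIb) find $\boldsymbol{u}\in K^0$ with $b_\beta(\boldsymbol{u},\boldsymbol{v}-\boldsymbol{u})\ge G_\beta(\boldsymbol{v}-\boldsymbol{u})$ for all $\boldsymbol{v}\in K^0$, (VIc) find $\boldsymbol{u}\in K^1$ with $c_\beta(\boldsymbol{u},\boldsymbol{v}-\boldsymbol{u})\ge H_\beta(\boldsymbol{v}-\boldsymbol{u})$ for all $\boldsymbol{v}\in K^1$, has a unique solution, and the problems are equivalent to the first-order system (FO) (i.e., each has the same solution as (FO)).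
   Context: $\Omega\subset\mathbb{R}^n$, $n\in\{2,3\}$, is a polygonal (polyhedral) bounded Lipschitz domain with boundary $\Gamma$. $(\cdot,\cdot)$ and $\|\cdot\|$ are the $L^2(\Omega)$ (or $L^2(\Omega)^n$) inner product and norm. $H^{-1}(\Omega)$ is the dual of $H_0^1(\Omega)$, with duality $\langle\cdot,\cdot\rangle$ extending the $L^2(\Omega)$ inner product. The generalized divergence $\operatorname{div}:L^2(\Omega)^n\to H^{-1}(\Omega)$ is $\langle\operatorname{div}\boldsymbol{\sigma},v\rangle:=-(\boldsymbol{\sigma},\nabla v)$ for $v\in H_0^1(\Omega)$. $C_F=C_F(\Omega)$, $0<C_F\le\operatorname{diam}(\Omega)$, is the constant in Friedrichs' inequality $\|v\|\le C_F\|\nabla v\|$ for all $v\in H_0^1(\Omega)$. For $v\in H^1(\Omega)$, $v\ge0$ means $v\ge 0$ a.e. in $\Omega$; for $\lambda\in H^{-1}(\Omega)$, $\lambda\ge0$ means $\langle\lambda,v\rangle\ge0$ for all $v\in H_0^1(\Omega)$ with $v\ge0$. $U:=\{(u,\boldsymbol{\sigma},\lambda)\in H_0^1(\Omega)\times L^2(\Omega)^n\times H^{-1}(\Omega): \operatorname{div}\boldsymbol{\sigma}+\lambda\in L^2(\Omega)\}$ with norm $\|(u,\boldsymbol{\sigma},\lambda)\|_U^2:=\|\nabla u\|^2+\|\boldsymbol{\sigma}\|^2+\|\operatorname{div}\boldsymbol{\sigma}+\lambda\|^2$. $K^s:=\{(u,\boldsymbol{\sigma},\lambda)\in U: u-g\ge0,\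 \lambda\ge0\}$, $K^0:=\{(u,\boldsymbol{\sigma},\lambda)\in U: u-g\ge0\}$, $K^1:=\{(u,\boldsymbol{\sigma},\lambda)\in U:\lambda\ge0\}$. For $\boldsymbol{u}=(u,\boldsymbol{\sigma},\lambda)$, $\boldsymbol{v}=(v,\boldsymbol{\tau},\mu)\in U$: $a_\beta(\boldsymbol{u},\boldsymbol{v}):=\beta(\operatorname{div}\boldsymbol{\sigma}+\lambda,\operatorname{div}\boldsymbol{\tau}+\mu)+(\nabla u-\boldsymbol{\sigma},\nabla v-\boldsymbol{\tau})+\tfrac12(\langle\mu,u\rangle+\langle\lambda,v\rangle)$, $b_\beta(\boldsymbol{u},\boldsymbol{v}):=\beta(\operatorname{div}\boldsymbol{\sigma}+\lambda,\operatorname{div}\boldsymbol{\tau}+\mu)+(\nabla u-\boldsymbol{\sigma},\nabla v-\boldsymbol{\tau})+\langle\lambda,v\rangle$, $c_\beta(\boldsymbol{u},\boldsymbol{v}):=\beta(\operatorname{div}\boldsymbol{\sigma}+\lambda,\operatorname{div}\boldsymbol{\tau}+\mu)+(\nabla u-\boldsymbol{\sigma},\nabla v-\boldsymbol{\tau})+\langle\mu,u\rangle$, $F_\beta(\boldsymbol{v}):=-\beta(f,\operatorname{div}\boldsymbol{\tau}+\mu)+\tfrac12\langle\mu,g\rangle$, $G_\beta(\boldsymbol{v}):=-\beta(f,\operatorname{div}\boldsymbol{\tau}+\mu)$, $H_\beta(\boldsymbol{v}):=-\beta(f,\operatorname{div}\boldsymbol{\tau}+\mu)+\langle\mu,g\rangle$.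 The first-order system (FO), a reformulation of the classical obstacle problem, is: find $(u,\boldsymbol{\sigma},\lambda)\in U$ with $-\operatorname{div}\boldsymbol{\sigma}-\lambda=f$, $\boldsymbol{\sigma}-\nabla u=0$, $u\ge g$, $\lambda\ge0$, $(u-g)\lambda=0$ in $\Omega$, and $u=0$ on $\Gamma$; here, for $g\in H_0^1(\Omega)$, the condition $(u-g)\lambda=0$ is understood as $\langle\lambda,u-g\rangle=0$. *)

theory Defs
  imports "HOL-Analysis.Analysis" "HOL-Library.Function_Algebras"
begin

section \<open>The Hilbert space of square integrable functions\<close>

definition square_integrable :: "('a::euclidean_space \<Rightarrow> 'b::euclidean_space) \<Rightarrow> bool" where
  "square_integrable f \<longleftrightarrow>
     f \<in> borel_measurable lebesgue \<and> integrable lebesgue (\<lambda>x. (norm (f x))\<^sup>2)"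

definition l2_eq :: "('a::euclidean_space \<Rightarrow> 'b::euclidean_space) \<Rightarrow> ('a \<Rightarrow> 'b) \<Rightarrow> bool" where
  "l2_eq f g \<longleftrightarrow> square_integrable f \<and> square_integrable g \<and> (AE x in lebesgue. f x = g x)"

lemma square_integrable_zero: "square_integrable (\<lambda>x. 0)"
  by (simp add: square_integrable_def)

lemma square_integrable_inner:
  assumes f: "square_integrable f" and g: "square_integrable g"
  shows "integrable lebesgue (\<lambda>x. f x \<bullet> g x)"
proof (rule Bochner_Integration.integrable_bound)
  show "integrable lebesgue (\<lambda>x. (norm (f x))\<^sup>2 + (norm (g x))\<^sup>2)"
    using f g by (auto simp: square_integrable_def)
  show "(\<lambda>x. f x \<bullet> g x) \<in> borel_measurable lebesgue"
    using f g by (auto simp: square_integrable_def intro!: borel_measurable_inner)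
  have "norm (f x \<bullet> g x) \<le> norm ((norm (f x))\<^sup>2 + (norm (g x))\<^sup>2)" for x
  proof -
    have "\<bar>f x \<bullet> g x\<bar> \<le> norm (f x) * norm (g x)"
      by (rule Cauchy_Schwarz_ineq2)
    also have "\<dots> \<le> 2 * norm (f x) * norm (g x)"
      by (simp add: mult.assoc)
    also have "\<dots> \<le> (norm (f x))\<^sup>2 + (norm (g x))\<^sup>2"
      by (rule sum_squares_bound)
    finally show ?thesis by simp
  qed
  then show "AE x in lebesgue. norm (f x \<bullet> g x) \<le> norm ((norm (f x))\<^sup>2 + (norm (g x))\<^sup>2)"
    by simp
qed

lemma square_integrable_add:
  assumes f: "square_integrable f" and g: "square_integrable g"
  shows "square_integrable (\<lambda>x. f x + g x)"
proof -
  have "(\<lambda>x. (norm (f x + g x))\<^sup>2) = (\<lambda>x. (norm (f x))\<^sup>2 + 2 * (f x \<bullet> g x) + (norm (g x))\<^sup>2)"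
    by (auto simp: power2_norm_eq_inner algebra_simps inner_commute)
  then show ?thesis
    using f g square_integrable_inner[OF f g]
    by (auto simp: square_integrable_def)
qed

lemma square_integrable_scaleR:
  assumes f: "square_integrable f"
  shows "square_integrable (\<lambda>x. c *\<^sub>R f x)"
  using f by (auto simp: square_integrable_def power_mult_distrib)

lemma square_integrable_minus:
  assumes f: "square_integrable f"
  shows "square_integrable (\<lambda>x. - f x)"
  using square_integrable_scaleR[OF f, of "-1"] by simp

lemma square_integrable_diff:
  assumes f: "square_integrable f" and g: "square_integrable g"
  shows "square_integrable (\<lambda>x. f x - g x)"
  using square_integrable_add[OF f square_integrable_minus[OF g]] by simp

lemma part_equivp_l2_eq:
  "part_equivp (l2_eq :: ('a::euclidean_space \<Rightarrow> 'b::euclidean_space) \<Rightarrow> _)"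
proof (rule part_equivpI)
  show "\<exists>x :: 'a \<Rightarrow> 'b. l2_eq x x"
    using square_integrable_zero by (intro exI[of _ "\<lambda>x. 0"]) (simp add: l2_eq_def)
  show "symp (l2_eq :: ('a \<Rightarrow> 'b) \<Rightarrow> _)"
    by (auto simp: symp_def l2_eq_def eq_commute)
  show "transp (l2_eq :: ('a \<Rightarrow> 'b) \<Rightarrow> _)"
    unfolding transp_def l2_eq_def
  proof (intro allI impI)
    fix x y z :: "'a \<Rightarrow> 'b"
    assume "square_integrable x \<and> square_integrable y \<and> (AE t in lebesgue. x t = y t)"
      and "square_integrable y \<and> square_integrable z \<and> (AE t in lebesgue. y t = z t)"
    then have xz: "square_integrable x" "square_integrable z"
      and xy: "AE t in lebesgue. x t = y t" and yz: "AE t in lebesgue. y t = z t"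
      by auto
    from xy yz have "AE t in lebesgue. x t = z t" by eventually_elim simp
    with xz show "square_integrable x \<and> square_integrable z \<and> (AE t in lebesgue. x t = z t)"
      by simp
  qed
qed

quotient_type (overloaded) ('a, 'b) l2 =
  "'a::euclidean_space \<Rightarrow> 'b::euclidean_space" / partial: l2_eq
  by (rule part_equivp_l2_eq)

instantiation l2 :: (euclidean_space, euclidean_space) real_inner
begin

lift_definition zero_l2 :: "('a, 'b) l2" is "\<lambda>x. 0"
  by (simp add: l2_eq_def square_integrable_zero)

lift_definition plus_l2 :: "('a, 'b) l2 \<Rightarrow> ('a, 'b) l2 \<Rightarrow> ('a, 'b) l2" is "\<lambda>f g x. f x + g x"
  unfolding l2_eq_def by (auto intro: square_integrable_add elim: AE_mp)

lift_definition uminus_l2 :: "('a, 'b) l2 \<Rightarrow> ('a, 'b) l2" is "\<lambda>f x. - f x"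
  unfolding l2_eq_def by (auto intro: square_integrable_minus)

lift_definition minus_l2 :: "('a, 'b) l2 \<Rightarrow> ('a, 'b) l2 \<Rightarrow> ('a, 'b) l2" is "\<lambda>f g x. f x - g x"
  unfolding l2_eq_def by (auto intro: square_integrable_diff elim: AE_mp)

lift_definition scaleR_l2 :: "real \<Rightarrow> ('a, 'b) l2 \<Rightarrow> ('a, 'b) l2" is "\<lambda>c f x. c *\<^sub>R f x"
  unfolding l2_eq_def by (auto intro: square_integrable_scaleR elim: AE_mp)

lift_definition inner_l2 :: "('a, 'b) l2 \<Rightarrow> ('a, 'b) l2 \<Rightarrow> real"
  is "\<lambda>f g. \<integral>x. f x \<bullet> g x \<partial>lebesgue"
  unfolding l2_eq_def
  by (intro integral_cong_AE)
     (auto simp: square_integrable_def intro!: borel_measurable_inner elim: AE_mp)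

definition norm_l2 :: "('a, 'b) l2 \<Rightarrow> real" where
  "norm_l2 f = sqrt (f \<bullet> f)"

definition sgn_l2 :: "('a, 'b) l2 \<Rightarrow> ('a, 'b) l2" where
  "sgn_l2 f = inverse (norm f) *\<^sub>R f"

definition dist_l2 :: "('a, 'b) l2 \<Rightarrow> ('a, 'b) l2 \<Rightarrow> real" where
  "dist_l2 f g = norm (f - g)"

definition uniformity_l2 :: "(('a, 'b) l2 \<times> ('a, 'b) l2) filter" where
  "uniformity_l2 = (INF e\<in>{0<..}. principal {(f, g). dist f g < e})"

definition open_l2 :: "('a, 'b) l2 set \<Rightarrow> bool" where
  "open_l2 S \<longleftrightarrow> (\<forall>f\<in>S. \<forall>\<^sub>F (f', g) in uniformity. f' = f \<longrightarrow> g \<in> S)"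

instance
proof
  fix f g h :: "('a, 'b) l2" and a b c :: real
  show "f + g + h = f + (g + h)"
    by transfer (auto simp: l2_eq_def add.assoc intro!: square_integrable_add)
  show "f + g = g + f"
    by transfer (auto simp: l2_eq_def add.commute intro!: square_integrable_add)
  show "0 + f = f"
    by transfer (auto simp: l2_eq_def)
  show "- f + f = 0"
    by transfer (auto simp: l2_eq_def square_integrable_zero)
  show "f - g = f + - g"
    by transfer (auto simp: l2_eq_def intro: square_integrable_diff)
  show "a *\<^sub>R (f + g) = a *\<^sub>R f + a *\<^sub>R g"
    by transfer (auto simp: l2_eq_def scaleR_add_right
        intro!: square_integrable_add square_integrable_scaleR)
  show "(a + b) *\<^sub>R f = a *\<^sub>R f + b *\<^sub>R f"
    by transfer (auto simp: l2_eq_def scaleR_add_left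
        intro!: square_integrable_add square_integrable_scaleR)
  show "a *\<^sub>R b *\<^sub>R f = (a * b) *\<^sub>R f"
    by transfer (auto simp: l2_eq_def intro!: square_integrable_scaleR)
  show "1 *\<^sub>R f = f"
    by transfer (auto simp: l2_eq_def)
  show "sgn f = inverse (norm f) *\<^sub>R f" "dist f g = norm (f - g)" "norm f = sqrt (f \<bullet> f)"
    by (simp_all add: sgn_l2_def dist_l2_def norm_l2_def)
  show "uniformity = (INF e\<in>{0<..}. principal {(f, g :: ('a, 'b) l2). dist f g < e})"
    by (rule uniformity_l2_def)
  show "open S \<longleftrightarrow> (\<forall>f\<in>S. \<forall>\<^sub>F (f', g) in uniformity. f' = f \<longrightarrow> g \<in> S)"
    for S :: "('a, 'b) l2 set"
    by (rule open_l2_def)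
  show "f \<bullet> g = g \<bullet> f"
    by transfer (simp add: inner_commute)
  show "(f + g) \<bullet> h = f \<bullet> h + g \<bullet> h"
    by transfer (simp add: l2_eq_def inner_add_left square_integrable_inner)
  show "(a *\<^sub>R f) \<bullet> g = a * (f \<bullet> g)"
    by transfer simp
  show "0 \<le> f \<bullet> f"
    by transfer simp
  show "f \<bullet> f = 0 \<longleftrightarrow> f = 0"
  proof transfer
    fix f :: "'a \<Rightarrow> 'b"
    assume "l2_eq f f"
    then have f: "square_integrable f" by (simp add: l2_eq_def)
    have "(\<integral>x. f x \<bullet> f x \<partial>lebesgue) = 0 \<longleftrightarrow> (AE x in lebesgue. f x \<bullet> f x = 0)"
      by (rule integral_nonneg_eq_0_iff_AE[OF square_integrable_inner[OF f f]]) simp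
    also have "\<dots> \<longleftrightarrow> l2_eq f (\<lambda>x. 0)"
      using f by (simp add: l2_eq_def square_integrable_zero)
    finally show "(\<integral>x. f x \<bullet> f x \<partial>lebesgue) = 0 \<longleftrightarrow> l2_eq f (\<lambda>x. 0)" .
  qed
qed

end

text \<open>
  \<^term>\<open>L2 \<Omega>\<close> is the space of square integrable functions on \<open>\<Omega>\<close>, each of them extended by
  zero to the whole space.  The extension is an isometry, so inner product and norm of the
  type \<open>l2\<close> restrict to those of the space of square integrable functions on \<open>\<Omega>\<close>.
\<close>

lift_definition vanishes_off :: "'a::euclidean_space set \<Rightarrow> ('a, 'b::euclidean_space) l2 \<Rightarrow> bool"
  is "\<lambda>\<Omega> f. AE x in lebesgue. x \<notin> \<Omega> \<longrightarrow> f x = 0"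
  unfolding l2_eq_def by (auto elim: AE_mp)

lift_definition nonneg_on :: "'a::euclidean_space set \<Rightarrow> ('a, real) l2 \<Rightarrow> bool"
  is "\<lambda>\<Omega> f. AE x in lebesgue. x \<in> \<Omega> \<longrightarrow> 0 \<le> f x"
  unfolding l2_eq_def by (auto elim: AE_mp)

definition L2 :: "'a::euclidean_space set \<Rightarrow> ('a, 'b::euclidean_space) l2 set" where
  "L2 \<Omega> = {f. vanishes_off \<Omega> f}"


section \<open>Sobolev spaces\<close>

definition gradient :: "(real^'n \<Rightarrow> real) \<Rightarrow> real^'n \<Rightarrow> real^'n" where
  "gradient f x = (\<chi> j. frechet_derivative f (at x) (axis j 1))"

primrec continuously_differentiable :: "nat \<Rightarrow> (real^'n \<Rightarrow> real) \<Rightarrow> bool" where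
  "continuously_differentiable 0 f \<longleftrightarrow> continuous_on UNIV f"
| "continuously_differentiable (Suc k) f \<longleftrightarrow>
     f differentiable_on UNIV \<and> (\<forall>j. continuously_differentiable k (\<lambda>x. gradient f x $ j))"

definition test_functions :: "(real^'n) set \<Rightarrow> (real^'n \<Rightarrow> real) set" where
  "test_functions \<Omega> =
     {\<phi>. (\<forall>k. continuously_differentiable k \<phi>) \<and>
         compact (closure {x. \<phi> x \<noteq> 0}) \<and> closure {x. \<phi> x \<noteq> 0} \<subseteq> \<Omega>}"

definition weak_gradient :: "(real^'n) set \<Rightarrow> (real^'n, real) l2 \<Rightarrow> (real^'n, real^'n) l2 \<Rightarrow> bool"
  where
  "weak_gradient \<Omega> v w \<longleftrightarrow>
     (\<forall>\<phi>\<in>test_functions \<Omega>. \<forall>j.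
        v \<bullet> abs_l2 (\<lambda>x. gradient \<phi> x $ j) = - (w \<bullet> abs_l2 (\<lambda>x. \<phi> x *\<^sub>R axis j 1)))"

definition H1 :: "(real^'n) set \<Rightarrow> (real^'n, real) l2 set" where
  "H1 \<Omega> = {v \<in> L2 \<Omega>. \<exists>w\<in>L2 \<Omega>. weak_gradient \<Omega> v w}"

definition grad :: "(real^'n) set \<Rightarrow> (real^'n, real) l2 \<Rightarrow> (real^'n, real^'n) l2" where
  "grad \<Omega> v = (THE w. w \<in> L2 \<Omega> \<and> weak_gradient \<Omega> v w)"

text \<open>The norm of the pair \<open>(v, grad \<Omega> v)\<close> in the product space is the \<open>H1\<close> norm of \<open>v\<close>.\<close>

definition H1_norm :: "(real^'n) set \<Rightarrow> (real^'n, real) l2 \<Rightarrow> real" where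
  "H1_norm \<Omega> v = norm (v, grad \<Omega> v)"

definition H10 :: "(real^'n) set \<Rightarrow> (real^'n, real) l2 set" where
  "H10 \<Omega> = {v \<in> H1 \<Omega>.
     (v, grad \<Omega> v) \<in> closure ((\<lambda>\<phi>. (abs_l2 \<phi>, abs_l2 (gradient \<phi>))) ` test_functions \<Omega>)}"

definition friedrichs_constant :: "(real^'n) set \<Rightarrow> real \<Rightarrow> bool" where
  "friedrichs_constant \<Omega> C \<longleftrightarrow>
     0 < C \<and> C \<le> diameter \<Omega> \<and> (\<forall>v\<in>H10 \<Omega>. norm v \<le> C * norm (grad \<Omega> v))"

instantiation "fun" :: (type, real_vector) real_vector
begin

definition scaleR_fun :: "real \<Rightarrow> ('a \<Rightarrow> 'b) \<Rightarrow> 'a \<Rightarrow> 'b" where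
  "scaleR_fun c f = (\<lambda>x. c *\<^sub>R f x)"

instance
  by standard (simp_all add: scaleR_fun_def fun_eq_iff scaleR_add_right scaleR_add_left)

end

definition bounded_functional_on ::
  "'a::real_vector set \<Rightarrow> ('a \<Rightarrow> real) \<Rightarrow> ('a \<Rightarrow> real) \<Rightarrow> bool" where
  "bounded_functional_on S nrm F \<longleftrightarrow>
     (\<forall>x\<in>S. \<forall>y\<in>S. F (x + y) = F x + F y) \<and>
     (\<forall>c. \<forall>x\<in>S. F (c *\<^sub>R x) = c * F x) \<and>
     (\<exists>C. \<forall>x\<in>S. \<bar>F x\<bar> \<le> C * nrm x)"

text \<open>
  Functionals on \<^term>\<open>H10 \<Omega>\<close> are represented by total functions that are zero off \<^term>\<open>H10 \<Omega>\<close>.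
  Thus equal functionals are equal functions, and the pointwise vector space operations on
  functions are those of the dual space.  The duality pairing is function application.
\<close>

definition Hm1 :: "(real^'n) set \<Rightarrow> ((real^'n, real) l2 \<Rightarrow> real) set" where
  "Hm1 \<Omega> = {l. bounded_functional_on (H10 \<Omega>) (H1_norm \<Omega>) l \<and> (\<forall>v. v \<notin> H10 \<Omega> \<longrightarrow> l v = 0)}"

definition nonneg_functional :: "(real^'n) set \<Rightarrow> ((real^'n, real) l2 \<Rightarrow> real) \<Rightarrow> bool" where
  "nonneg_functional \<Omega> l \<longleftrightarrow> (\<forall>v\<in>H10 \<Omega>. nonneg_on \<Omega> v \<longrightarrow> 0 \<le> l v)"

text \<open>The inclusion of \<^term>\<open>L2 \<Omega>\<close> into \<^term>\<open>Hm1 \<Omega>\<close>.\<close>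

definition L2_functional :: "(real^'n) set \<Rightarrow> (real^'n, real) l2 \<Rightarrow> (real^'n, real) l2 \<Rightarrow> real" where
  "L2_functional \<Omega> h = (\<lambda>v. if v \<in> H10 \<Omega> then h \<bullet> v else 0)"

definition divergence :: "(real^'n) set \<Rightarrow> (real^'n, real^'n) l2 \<Rightarrow> (real^'n, real) l2 \<Rightarrow> real" where
  "divergence \<Omega> \<sigma> = (\<lambda>v. if v \<in> H10 \<Omega> then - (\<sigma> \<bullet> grad \<Omega> v) else 0)"


section \<open>Polyhedral Lipschitz domains\<close>

text \<open>
  Near each boundary point, \<open>\<Omega>\<close> is the strict epigraph, in some direction \<open>e\<close>, of a Lipschitz
  function \<open>\<gamma>\<close> on the hyperplane orthogonal to \<open>e\<close>.
\<close>

definition lipschitz_domain :: "'a::euclidean_space set \<Rightarrow> bool" where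
  "lipschitz_domain \<Omega> \<longleftrightarrow>
     open \<Omega> \<and> connected \<Omega> \<and> \<Omega> \<noteq> {} \<and>
     (\<forall>p\<in>frontier \<Omega>. \<exists>r>0. \<exists>e L \<gamma>.
        norm e = 1 \<and> L-lipschitz_on {y. y \<bullet> e = 0} \<gamma> \<and>
        \<Omega> \<inter> ball p r = {x \<in> ball p r. \<gamma> (x - (x \<bullet> e) *\<^sub>R e) < x \<bullet> e})"

definition polyhedral :: "'a::euclidean_space set \<Rightarrow> bool" where
  "polyhedral \<Omega> \<longleftrightarrow> (\<exists>\<P>. finite \<P> \<and> (\<forall>P\<in>\<P>. polytope P) \<and> closure \<Omega> = \<Union>\<P>)"


section \<open>The first-order formulation of the obstacle problem\<close>

type_synonym 'n triple =
  "(real^'n, real) l2 \<times> (real^'n, real^'n) l2 \<times> ((real^'n, real) l2 \<Rightarrow> real)"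

definition U :: "(real^'n) set \<Rightarrow> 'n triple set" where
  "U \<Omega> = {(u, \<sigma>, l). u \<in> H10 \<Omega> \<and> \<sigma> \<in> L2 \<Omega> \<and> l \<in> Hm1 \<Omega> \<and>
                      divergence \<Omega> \<sigma> + l \<in> L2_functional \<Omega> ` L2 \<Omega>}"

text \<open>The element of \<^term>\<open>L2 \<Omega>\<close> that represents \<open>divergence \<Omega> \<sigma> + l\<close>.\<close>

definition div_plus :: "(real^'n) set \<Rightarrow> (real^'n, real^'n) l2 \<Rightarrow> ((real^'n, real) l2 \<Rightarrow> real)
    \<Rightarrow> (real^'n, real) l2" where
  "div_plus \<Omega> \<sigma> l = (THE h. h \<in> L2 \<Omega> \<and> L2_functional \<Omega> h = divergence \<Omega> \<sigma> + l)"

definition U_norm :: "(real^'n) set \<Rightarrow> 'n triple \<Rightarrow> real" where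
  "U_norm \<Omega> = (\<lambda>(u, \<sigma>, l).
     sqrt ((norm (grad \<Omega> u))\<^sup>2 + (norm \<sigma>)\<^sup>2 + (norm (div_plus \<Omega> \<sigma> l))\<^sup>2))"

definition U_topology :: "(real^'n) set \<Rightarrow> 'n triple topology" where
  "U_topology \<Omega> = Metric_space.mtopology (U \<Omega>) (\<lambda>u v. U_norm \<Omega> (u - v))"

definition K_s :: "(real^'n) set \<Rightarrow> (real^'n, real) l2 \<Rightarrow> 'n triple set" where
  "K_s \<Omega> g = {(u, \<sigma>, l) \<in> U \<Omega>. nonneg_on \<Omega> (u - g) \<and> nonneg_functional \<Omega> l}"

definition K_0 :: "(real^'n) set \<Rightarrow> (real^'n, real) l2 \<Rightarrow> 'n triple set" where
  "K_0 \<Omega> g = {(u, \<sigma>, l) \<in> U \<Omega>. nonneg_on \<Omega> (u - g)}"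

definition K_1 :: "(real^'n) set \<Rightarrow> 'n triple set" where
  "K_1 \<Omega> = {(u, \<sigma>, l) \<in> U \<Omega>. nonneg_functional \<Omega> l}"

definition a_form :: "(real^'n) set \<Rightarrow> real \<Rightarrow> 'n triple \<Rightarrow> 'n triple \<Rightarrow> real" where
  "a_form \<Omega> \<beta> = (\<lambda>(u, \<sigma>, l) (v, \<tau>, m).
     \<beta> * (div_plus \<Omega> \<sigma> l \<bullet> div_plus \<Omega> \<tau> m) + (grad \<Omega> u - \<sigma>) \<bullet> (grad \<Omega> v - \<tau>) + (m u + l v) / 2)"

definition b_form :: "(real^'n) set \<Rightarrow> real \<Rightarrow> 'n triple \<Rightarrow> 'n triple \<Rightarrow> real" where
  "b_form \<Omega> \<beta> = (\<lambda>(u, \<sigma>, l) (v, \<tau>, m).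
     \<beta> * (div_plus \<Omega> \<sigma> l \<bullet> div_plus \<Omega> \<tau> m) + (grad \<Omega> u - \<sigma>) \<bullet> (grad \<Omega> v - \<tau>) + l v)"

definition c_form :: "(real^'n) set \<Rightarrow> real \<Rightarrow> 'n triple \<Rightarrow> 'n triple \<Rightarrow> real" where
  "c_form \<Omega> \<beta> = (\<lambda>(u, \<sigma>, l) (v, \<tau>, m).
     \<beta> * (div_plus \<Omega> \<sigma> l \<bullet> div_plus \<Omega> \<tau> m) + (grad \<Omega> u - \<sigma>) \<bullet> (grad \<Omega> v - \<tau>) + m u)"

definition F_rhs :: "(real^'n) set \<Rightarrow> real \<Rightarrow> (real^'n, real) l2 \<Rightarrow> (real^'n, real) l2
    \<Rightarrow> 'n triple \<Rightarrow> real" where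
  "F_rhs \<Omega> \<beta> f g = (\<lambda>(v, \<tau>, m). - \<beta> * (f \<bullet> div_plus \<Omega> \<tau> m) + m g / 2)"

definition G_rhs :: "(real^'n) set \<Rightarrow> real \<Rightarrow> (real^'n, real) l2 \<Rightarrow> 'n triple \<Rightarrow> real" where
  "G_rhs \<Omega> \<beta> f = (\<lambda>(v, \<tau>, m). - \<beta> * (f \<bullet> div_plus \<Omega> \<tau> m))"

definition H_rhs :: "(real^'n) set \<Rightarrow> real \<Rightarrow> (real^'n, real) l2 \<Rightarrow> (real^'n, real) l2
    \<Rightarrow> 'n triple \<Rightarrow> real" where
  "H_rhs \<Omega> \<beta> f g = (\<lambda>(v, \<tau>, m). - \<beta> * (f \<bullet> div_plus \<Omega> \<tau> m) + m g)"

definition solves_VI :: "('a::real_vector \<Rightarrow> 'a \<Rightarrow> real) \<Rightarrow> ('a \<Rightarrow> real) \<Rightarrow> 'a set \<Rightarrow> 'a \<Rightarrow> bool" where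
  "solves_VI A F K u \<longleftrightarrow> u \<in> K \<and> (\<forall>v\<in>K. A u (v - u) \<ge> F (v - u))"

text \<open>
  The equation \<open>- div \<sigma> - \<lambda> = f\<close> is an identity in \<^term>\<open>Hm1 \<Omega>\<close>.  The boundary condition
  \<open>u = 0\<close> is the membership of \<open>u\<close> in \<^term>\<open>H10 \<Omega>\<close>, which is part of \<^term>\<open>U \<Omega>\<close>.
\<close>

definition solves_FO :: "(real^'n) set \<Rightarrow> (real^'n, real) l2 \<Rightarrow> (real^'n, real) l2 \<Rightarrow> 'n triple \<Rightarrow> bool"
  where
  "solves_FO \<Omega> f g = (\<lambda>(u, \<sigma>, l).
     (u, \<sigma>, l) \<in> U \<Omega> \<and>
     - divergence \<Omega> \<sigma> - l = L2_functional \<Omega> f \<and>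
     \<sigma> - grad \<Omega> u = 0 \<and>
     nonneg_on \<Omega> (u - g) \<and> nonneg_functional \<Omega> l \<and> l (u - g) = 0)"

end

theory Submission
  imports Defs
begin

text \<open>
  Why the theorem holds. Two facts carry it: the space \<^term>\<open>U \<Omega>\<close> is a Hilbert space in disguise,
  and all three bilinear forms have the same diagonal, which is coercive.

  A functional \<open>\<lambda>\<close> with \<open>div \<sigma> + \<lambda> = h\<close> square integrable is determined by \<open>\<sigma>\<close> and \<open>h\<close>, because
  \<open>\<langle>\<lambda>, v\<rangle> = (h, v) + (\<sigma>, grad v)\<close>. Conversely every such pair defines an element of the dual space.
  Hence \<open>(u, \<sigma>, \<lambda>) \<mapsto> (grad u, \<sigma>, h)\<close> is a linear isometry of \<^term>\<open>U \<Omega>\<close> onto a product of closed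
  subspaces of spaces of square integrable functions. Friedrichs' inequality makes the set of
  gradients closed, and Riesz--Fischer makes the ambient product complete. The forms
  differ only in their duality term, which is a convex combination with weight \<open>\<theta>\<close> of the two ways
  to pair the functional of one argument with the function of the other; on the diagonal \<open>\<theta>\<close>
  disappears. What remains is
  \<open>\<beta> \<parallel>h\<parallel>\<^sup>2 + \<parallel>grad u - \<sigma>\<parallel>\<^sup>2 + (h, u) + (\<sigma>, grad u)\<close>. The last term compensates half of the mixed term of
  the square, and Friedrichs' and Young's inequalities absorb \<open>(h, u)\<close> as soon as \<open>\<beta> \<ge> 1 + C\<^sup>2\<close>
  (\<open>form_coercive\<close>). The Lions--Stampacchia theorem then gives the general solvability statement.

  For the obstacle problem, the classical variational inequality over \<open>{v. v \<ge> g}\<close> has a solution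
  \<open>u\<close>, and \<open>\<sigma> = grad u\<close>, \<open>\<lambda> = - div \<sigma> - f\<close> solves the first-order system (\<open>FO_solvable\<close>). For any
  solution of that system and any \<open>(v, \<tau>, \<mu>)\<close> in \<^term>\<open>U \<Omega>\<close> the defect of the variational
  inequality with weight \<open>\<theta>\<close> is exactly \<open>\<theta> \<langle>\<lambda>, v - g\<rangle> + (1 - \<theta>) \<langle>\<mu>, u - g\<rangle>\<close> (\<open>FO_residual\<close>).
  This is nonnegative when \<open>v \<ge> g\<close> is imposed for \<open>\<theta> > 0\<close> and \<open>\<mu> \<ge> 0\<close> is imposed for \<open>\<theta> < 1\<close>, which
  is how the three constraint sets are chosen. So a solution of the system solves all three
  variational inequalities, and since definiteness makes their solutions unique, nothing else does.

  Underneath lies some analysis: completeness of the space of square integrable functions,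
  uniqueness of weak gradients (the fundamental lemma of the calculus of variations, by smooth bumps
  that converge to indicators of boxes), and the fact that test functions belong to \<^term>\<open>H10 \<Omega>\<close>
  (integration by parts), without which \<^term>\<open>div_plus\<close> would not be well defined.
\<close>

section \<open>Variational inequalities in Hilbert spaces\<close>

lemma bounded_functional_on_add:
  "bounded_functional_on S N l \<Longrightarrow> x \<in> S \<Longrightarrow> y \<in> S \<Longrightarrow> l (x + y) = l x + l y"
  by (auto simp: bounded_functional_on_def)

lemma bounded_functional_on_scaleR:
  "bounded_functional_on S N l \<Longrightarrow> x \<in> S \<Longrightarrow> l (c *\<^sub>R x) = c * l x"
  by (auto simp: bounded_functional_on_def)

lemma bounded_functional_on_diff:
  assumes "bounded_functional_on S N l" "subspace S" "x \<in> S" "y \<in> S"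
  shows "l (x - y) = l x - l y"
proof -
  have "l (x + (- 1) *\<^sub>R y) = l x + l ((- 1) *\<^sub>R y)"
    by (rule bounded_functional_on_add[OF assms(1)]) (use assms subspace_scale in blast)+
  then show ?thesis
    using bounded_functional_on_scaleR[OF assms(1,4), of "-1"] by simp
qed

lemma bounded_functional_on_bound:
  assumes "bounded_functional_on S N l" "\<And>x. x \<in> S \<Longrightarrow> 0 \<le> N x"
  obtains C where "0 \<le> C" "\<And>x. x \<in> S \<Longrightarrow> \<bar>l x\<bar> \<le> C * N x"
proof -
  obtain C where C: "\<And>x. x \<in> S \<Longrightarrow> \<bar>l x\<bar> \<le> C * N x"
    using assms(1) unfolding bounded_functional_on_def by blast
  have "\<bar>l x\<bar> \<le> max C 0 * N x" if "x \<in> S" for x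
    using C[OF that] mult_right_mono[of C "max C 0" "N x"] assms(2)[OF that] by simp
  then show thesis using that[of "max C 0"] by simp
qed

text \<open>
  The solution minimizes \<open>J x = \<parallel>x\<parallel>\<^sup>2 / 2 - l x\<close> over \<open>K\<close>. By the parallelogram law a minimizing
  sequence is Cauchy, and moving from the minimizer a small step towards \<open>v\<close> cannot decrease \<open>J\<close>,
  which is the asserted inequality to first order.
\<close>

lemma symmetric_VI_solvable:
  fixes K :: "'a::real_inner set"
  assumes S: "subspace S" and KS: "K \<subseteq> S" and K: "K \<noteq> {}" "convex K" "complete K"
    and l: "bounded_functional_on S norm l"
  shows "\<exists>w. solves_VI (\<bullet>) l K w"
proof -
  note ladd = bounded_functional_on_add[OF l] and lsc = bounded_functional_on_scaleR[OF l]
  note ldiff = bounded_functional_on_diff[OF l S]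
  obtain C where C: "0 \<le> C" "\<And>x. x \<in> S \<Longrightarrow> \<bar>l x\<bar> \<le> C * norm x"
    using bounded_functional_on_bound[OF l] by auto
  define J where "J x = (norm x)\<^sup>2 / 2 - l x" for x
  have low: "- (C\<^sup>2 / 2) \<le> J x" if "x \<in> K" for x
    using C(2)[of x] KS that sum_squares_bound[of C "norm x"] by (auto simp: J_def)
  have bdd: "bdd_below (J ` K)" using low by (auto simp: bdd_below_def)
  define d where "d = Inf (J ` K)"
  have d: "d \<le> J x" if "x \<in> K" for x
    unfolding d_def using bdd that by (rule cINF_lower)
  have para: "(norm (x - y))\<^sup>2 \<le> 4 * (J x + J y - 2 * d)" if x: "x \<in> K" and y: "y \<in> K" for x y
  proof -
    let ?m = "(1/2) *\<^sub>R x + (1/2) *\<^sub>R y"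
    have m: "?m \<in> K" using convexD[OF K(2) x y, of "1/2" "1/2"] by simp
    have xS: "x \<in> S" "y \<in> S" using x y KS by auto
    have "l ?m = l x / 2 + l y / 2"
      using xS by (simp add: ladd lsc subspace_scale[OF S])
    moreover have "(norm ?m)\<^sup>2 = ((norm x)\<^sup>2 + 2 * (x \<bullet> y) + (norm y)\<^sup>2) / 4"
      by (simp add: power2_norm_eq_inner algebra_simps inner_commute)
    moreover have "(norm (x - y))\<^sup>2 = (norm x)\<^sup>2 - 2 * (x \<bullet> y) + (norm y)\<^sup>2"
      by (simp add: power2_norm_eq_inner algebra_simps inner_commute)
    ultimately have "(norm (x - y))\<^sup>2 = 4 * (J x + J y - 2 * J ?m)"
      by (simp add: J_def field_simps)
    then show ?thesis using d[OF m] by simp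
  qed
  have "\<exists>x\<in>K. J x < d + 1 / real (Suc n)" for n
    using cINF_less_iff[of K J "d + 1 / real (Suc n)"] K(1) bdd by (simp add: d_def)
  then obtain w where w: "\<And>n. w n \<in> K" "\<And>n. J (w n) < d + 1 / real (Suc n)"
    by metis
  have "Cauchy w"
  proof (rule metric_CauchyI)
    fix e :: real assume e: "0 < e"
    obtain N where N: "1 / real (Suc N) < e\<^sup>2 / 8"
      using reals_Archimedean[of "e\<^sup>2 / 8"] e by (auto simp: inverse_eq_divide)
    have "dist (w m) (w n) < e" if mn: "m \<ge> N" "n \<ge> N" for m n
    proof -
      have J: "J (w k) < d + e\<^sup>2 / 8" if "k \<ge> N" for k
      proof -
        have "1 / real (Suc k) \<le> 1 / real (Suc N)"
          using that by (auto intro!: divide_left_mono)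
        then have "1 / real (Suc k) < e\<^sup>2 / 8" using N by (rule le_less_trans)
        then show ?thesis using w(2)[of k] by linarith
      qed
      have "(norm (w m - w n))\<^sup>2 < e\<^sup>2"
        using para[OF w(1) w(1), of m n] J[OF mn(1)] J[OF mn(2)] by argo
      then show ?thesis using power2_less_imp_less e unfolding dist_norm by (meson less_imp_le)
    qed
    then show "\<exists>M. \<forall>m\<ge>M. \<forall>n\<ge>M. dist (w m) (w n) < e" by blast
  qed
  then obtain u where u: "u \<in> K" "w \<longlonglongrightarrow> u"
    using K(3) w(1) unfolding complete_def by blast
  have "(\<lambda>n. l (w n)) \<longlonglongrightarrow> l u"
  proof (rule LIM_zero_cancel, rule Lim_null_comparison)
    show "\<forall>\<^sub>F n in sequentially. norm (l (w n) - l u) \<le> C * norm (w n - u)"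
    proof (rule always_eventually, rule allI)
      fix n
      have wS: "w n \<in> S" "u \<in> S" using w(1) u(1) KS by auto
      then show "norm (l (w n) - l u) \<le> C * norm (w n - u)"
        using C(2)[OF subspace_diff[OF S wS]] ldiff[OF wS] by simp
    qed
    show "(\<lambda>n. C * norm (w n - u)) \<longlonglongrightarrow> 0"
      using u(2) by (intro tendsto_mult_right_zero tendsto_norm_zero LIM_zero)
  qed
  then have Jlim: "(\<lambda>n. J (w n)) \<longlonglongrightarrow> J u"
    unfolding J_def by (intro tendsto_intros u(2)) auto
  have "(\<lambda>n. d + 1 / real (Suc n)) \<longlonglongrightarrow> d + 0"
    by (intro tendsto_intros LIMSEQ_Suc[OF lim_1_over_n])
  then have "J u \<le> d"
    using LIMSEQ_le[OF Jlim] less_imp_le[OF w(2)] by auto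
  then have min: "J u \<le> J x" if "x \<in> K" for x using d[OF that] by simp
  have "u \<bullet> (v - u) \<ge> l (v - u)" if v: "v \<in> K" for v
  proof (rule ccontr)
    let ?e = "v - u"
    define q where "q = l ?e - u \<bullet> ?e"
    assume "\<not> ?thesis"
    then have q: "q > 0" by (simp add: q_def)
    \<comment> \<open>Along the segment, \<open>J\<close> changes by \<open>t (t \<parallel>v - u\<parallel>\<^sup>2 / 2 - q)\<close>; this step makes that negative.\<close>
    define t where "t = min 1 (q / ((norm ?e)\<^sup>2 + 1))"
    have pos: "0 < (norm ?e)\<^sup>2 + 1" by (simp add: add_nonneg_pos)
    have t: "0 < t" "t \<le> 1" using q pos by (auto simp: t_def)
    have te: "t * (norm ?e)\<^sup>2 \<le> q"
    proof -
      have "t * (norm ?e)\<^sup>2 \<le> (q / ((norm ?e)\<^sup>2 + 1)) * ((norm ?e)\<^sup>2 + 1)"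
        using t q pos by (intro mult_mono) (auto simp: t_def)
      then show ?thesis using pos by simp
    qed
    have inK: "u + t *\<^sub>R ?e \<in> K"
      using convexD_alt[OF K(2) u(1) v, of t] t by (simp add: algebra_simps)
    have S': "u \<in> S" "?e \<in> S" using u(1) v KS subspace_diff[OF S] by auto
    have "J (u + t *\<^sub>R ?e) = J u + t * (u \<bullet> ?e) + t * (t * (norm ?e)\<^sup>2) / 2 - t * l ?e"
    proof -
      have "(norm (u + t *\<^sub>R ?e))\<^sup>2 = (norm u)\<^sup>2 + 2 * t * (u \<bullet> ?e) + t * (t * (norm ?e)\<^sup>2)"
        unfolding power2_norm_eq_inner inner_add_left inner_add_right inner_scaleR_left
          inner_scaleR_right inner_commute[of "v - u" u] by (simp add: algebra_simps)
      moreover have "l (u + t *\<^sub>R ?e) = l u + t * l ?e"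
        using S' subspace_scale[OF S] by (simp add: ladd lsc)
      ultimately show ?thesis by (simp add: J_def field_simps)
    qed
    then have "0 \<le> t * (t * (norm ?e)\<^sup>2 / 2 - q)"
      using min[OF inK] by (simp add: q_def algebra_simps)
    then have "0 \<le> t * (norm ?e)\<^sup>2 / 2 - q" using t by (simp add: zero_le_mult_iff)
    then show False using te q by simp
  qed
  then show ?thesis using u(1) by (auto simp: solves_VI_def)
qed

text \<open>
  When \<open>K\<close> is the whole subspace, the differences \<open>v - w\<close> run through the subspace, which contains
  the negative of each of its vectors, so the inequality becomes an equation.
\<close>

corollary Riesz_representation:
  fixes S :: "'a::real_inner set"
  assumes S: "subspace S" "complete S" and l: "bounded_functional_on S norm l"
  shows "\<exists>r\<in>S. \<forall>x\<in>S. l x = r \<bullet> x"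
proof -
  have "S \<noteq> {}" using subspace_0[OF S(1)] by auto
  then obtain r where r: "r \<in> S" "\<And>v. v \<in> S \<Longrightarrow> r \<bullet> (v - r) \<ge> l (v - r)"
    using symmetric_VI_solvable[OF S(1) subset_refl _ subspace_imp_convex[OF S(1)] S(2) l]
    unfolding solves_VI_def by blast
  have le: "l x \<le> r \<bullet> x" if "x \<in> S" for x
    using r(2)[OF subspace_add[OF S(1) r(1) that]] by simp
  have "l x = r \<bullet> x" if x: "x \<in> S" for x
  proof -
    have "l (- x) = - l x"
      using bounded_functional_on_scaleR[OF l x, of "-1"] by simp
    then show ?thesis using le[OF x] le[OF subspace_neg[OF S(1) x]] by simp
  qed
  then show ?thesis using r(1) by blast
qed

text \<open>
  Write \<open>A x y = T x \<bullet> y\<close>. The solutions are the fixed points of the map that sends \<open>x\<close> to the solution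
  of the symmetric problem with data \<open>x - \<rho> (T x - f)\<close>, that is, to its projection onto \<open>K\<close>. The
  projection does not increase distances, and \<open>x \<mapsto> x - \<rho> T x\<close> is a contraction for small \<open>\<rho>\<close>
  by coercivity, so Banach's fixed point theorem applies.
\<close>

theorem Lions_Stampacchia:
  fixes S :: "'a::real_inner set"
  assumes S: "subspace S" "complete S"
    and K: "K \<subseteq> S" "K \<noteq> {}" "convex K" "closed K"
    and A1: "\<And>y. y \<in> S \<Longrightarrow> bounded_functional_on S norm (\<lambda>x. A x y)"
    and A2: "\<And>x. x \<in> S \<Longrightarrow> bounded_functional_on S norm (A x)"
    and bound: "\<And>x y. x \<in> S \<Longrightarrow> y \<in> S \<Longrightarrow> \<bar>A x y\<bar> \<le> M * norm x * norm y"
    and \<alpha>: "0 < \<alpha>" and coercive: "\<And>x. x \<in> S \<Longrightarrow> \<alpha> * (norm x)\<^sup>2 \<le> A x x"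
    and F: "bounded_functional_on S norm F"
  shows "\<exists>u. solves_VI A F K u"
proof -
  have K': "complete K" using complete_closed_subset[OF K(4,1) S(2)] .
  note sub = subspace_diff[OF S(1)]
  obtain T where T: "\<And>x. x \<in> S \<Longrightarrow> T x \<in> S" "\<And>x y. x \<in> S \<Longrightarrow> y \<in> S \<Longrightarrow> A x y = T x \<bullet> y"
    using Riesz_representation[OF S A2] by metis
  obtain f where f: "f \<in> S" "\<And>x. x \<in> S \<Longrightarrow> F x = f \<bullet> x"
    using Riesz_representation[OF S F] by metis
  have T_diff: "(T x - T x') \<bullet> y = T (x - x') \<bullet> y" if "x \<in> S" "x' \<in> S" "y \<in> S" for x x' y
    using bounded_functional_on_diff[OF A1[OF that(3)] S(1) that(1,2)] that T(2) sub
    by (simp add: inner_diff_left)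
  have T_norm: "norm (T x) \<le> M * norm x" if "x \<in> S" for x
  proof (cases "norm (T x) = 0")
    case True
    have "0 \<le> M * norm x"
    proof (cases "x = 0")
      case False
      have "0 \<le> (M * norm x) * norm x"
        using bound[OF that that] by (meson abs_ge_zero order_trans)
      then show ?thesis using False by (simp add: zero_le_mult_iff)
    qed simp
    then show ?thesis using True by simp
  next
    case False
    have "norm (T x) * norm (T x) \<le> M * norm x * norm (T x)"
      using bound[OF that T(1)[OF that]] T(2)[OF that T(1)[OF that]]
      by (simp add: power2_norm_eq_inner[symmetric] power2_eq_square)
    then show ?thesis using False by simp
  qed
  \<comment> \<open>\<open>M'\<close> is a bound as well, and moreover at least \<open>\<alpha>\<close>; \<open>\<rho>\<close> minimizes the contraction constant \<open>c\<close>.\<close>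
  define M' where "M' = \<bar>M\<bar> + \<alpha>"
  have M': "0 < M'" "\<alpha> \<le> M'" "M \<le> M'" using \<alpha> by (auto simp: M'_def)
  define \<rho> where "\<rho> = \<alpha> / M'\<^sup>2"
  define c where "c = sqrt (1 - \<alpha>\<^sup>2 / M'\<^sup>2)"
  have quot: "0 < \<alpha>\<^sup>2 / M'\<^sup>2" "\<alpha>\<^sup>2 / M'\<^sup>2 \<le> 1"
    using \<alpha> M' by (auto intro!: power_mono)
  have c: "0 \<le> c" "c < 1" using quot by (auto simp: c_def)
  have \<rho>: "0 < \<rho>" using \<alpha> M' by (simp add: \<rho>_def)
  have contract: "norm (e - \<rho> *\<^sub>R T e) \<le> c * norm e" if e: "e \<in> S" for e
  proof -
    have "norm (T e) \<le> M' * norm e"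
      using T_norm[OF e] mult_right_mono[OF M'(3), of "norm e"] by simp
    then have "(norm (T e))\<^sup>2 \<le> M'\<^sup>2 * (norm e)\<^sup>2"
      by (metis norm_ge_zero power_mono power_mult_distrib)
    then have 1: "\<rho>\<^sup>2 * (norm (T e))\<^sup>2 \<le> \<rho>\<^sup>2 * (M'\<^sup>2 * (norm e)\<^sup>2)"
      by (simp add: mult_left_mono)
    have 2: "\<rho> * (\<alpha> * (norm e)\<^sup>2) \<le> \<rho> * (T e \<bullet> e)"
      using coercive[OF e] T(2)[OF e e] \<rho> by simp
    have "(norm (e - \<rho> *\<^sub>R T e))\<^sup>2 = (norm e)\<^sup>2 - 2 * (\<rho> * (T e \<bullet> e)) + \<rho>\<^sup>2 * (norm (T e))\<^sup>2"
      unfolding power2_norm_eq_inner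
      by (simp add: inner_diff_left inner_diff_right inner_commute power2_eq_square)
    also have "\<dots> \<le> (norm e)\<^sup>2 - 2 * (\<rho> * (\<alpha> * (norm e)\<^sup>2)) + \<rho>\<^sup>2 * (M'\<^sup>2 * (norm e)\<^sup>2)"
      using 1 2 by linarith
    also have "\<dots> = (1 - \<alpha>\<^sup>2 / M'\<^sup>2) * (norm e)\<^sup>2"
      using M'(1) by (simp add: \<rho>_def field_simps power2_eq_square)
    also have "\<dots> = (c * norm e)\<^sup>2"
      using quot by (simp add: c_def power_mult_distrib)
    finally show ?thesis by (rule power2_le_imp_le) (use c(1) in simp)
  qed
  define L where "L x y = (x - \<rho> *\<^sub>R (T x - f)) \<bullet> y" for x y
  have L: "bounded_functional_on S norm (L x)" for x
    unfolding bounded_functional_on_def L_def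
  proof (intro conjI ballI allI exI)
    fix y
    show "\<bar>(x - \<rho> *\<^sub>R (T x - f)) \<bullet> y\<bar> \<le> norm (x - \<rho> *\<^sub>R (T x - f)) * norm y"
      by (rule Cauchy_Schwarz_ineq2)
  qed (simp_all only: inner_add_right inner_scaleR_right)
  have "\<exists>P. \<forall>x. solves_VI (\<bullet>) (L x) K (P x)"
    by (rule choice) (blast intro: symmetric_VI_solvable[OF S(1) K(1-3) K' L])
  then obtain P where P: "\<And>x. solves_VI (\<bullet>) (L x) K (P x)"
    by blast
  have PK: "P x \<in> K" for x using P[of x] by (simp add: solves_VI_def)
  have lip: "dist (P x) (P y) \<le> c * dist x y" if xy: "x \<in> K" "y \<in> K" for x y
  proof -
    let ?d = "P x - P y"
    have xS: "x \<in> S" "y \<in> S" "?d \<in> S" using xy K(1) PK sub by blast+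
    have "P x \<bullet> (P y - P x) \<ge> L x (P y - P x)" "P y \<bullet> (P x - P y) \<ge> L y (P x - P y)"
      using P[of x] P[of y] PK by (auto simp: solves_VI_def)
    then have "?d \<bullet> ?d \<le> (x - y) \<bullet> ?d - \<rho> * ((T x - T y) \<bullet> ?d)"
      unfolding L_def inner_diff_left inner_diff_right inner_scaleR_left
      by (simp add: algebra_simps inner_commute)
    also have "\<dots> = ((x - y) - \<rho> *\<^sub>R T (x - y)) \<bullet> ?d"
      using T_diff[OF xS] by (simp add: inner_diff_left)
    also have "\<dots> \<le> norm ((x - y) - \<rho> *\<^sub>R T (x - y)) * norm ?d"
      by (rule norm_cauchy_schwarz)
    also have "\<dots> \<le> c * norm (x - y) * norm ?d"
      using contract[OF sub[OF xS(1,2)]] by (simp add: mult_right_mono)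
    finally have "norm ?d * norm ?d \<le> c * norm (x - y) * norm ?d"
      by (simp add: power2_norm_eq_inner[symmetric] power2_eq_square)
    then show ?thesis
      using c(1) by (cases "norm ?d = 0") (auto simp: dist_norm)
  qed
  obtain u where u: "u \<in> K" "P u = u"
    using Banach_fix[OF K' K(2) c, of P] PK lip by blast
  have "solves_VI A F K u"
    unfolding solves_VI_def
  proof (intro conjI ballI)
    fix v assume v: "v \<in> K"
    have e: "u \<in> S" "v - u \<in> S" using u v K(1) sub by blast+
    have "u \<bullet> (v - u) \<ge> L u (v - u)" using P[of u] v u by (simp add: solves_VI_def)
    then have "\<rho> * (T u \<bullet> (v - u)) \<ge> \<rho> * (f \<bullet> (v - u))"
      by (simp add: L_def inner_diff_left right_diff_distrib)
    then show "F (v - u) \<le> A u (v - u)" using \<rho> T(2)[OF e] f(2)[OF e(2)] by simp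
  qed (rule u)
  then show ?thesis by blast
qed

text \<open>
  Testing each of two solutions with the other and adding up leaves \<open>A (u - v) (u - v) \<le> 0\<close>.
\<close>

lemma VI_solution_unique:
  fixes A :: "'a::real_vector \<Rightarrow> 'a \<Rightarrow> real"
  assumes V: "subspace V" and K: "K \<subseteq> V"
    and A1: "\<And>y. y \<in> V \<Longrightarrow> bounded_functional_on V N (\<lambda>x. A x y)"
    and A2: "\<And>x. x \<in> V \<Longrightarrow> bounded_functional_on V N (A x)"
    and F: "bounded_functional_on V N F"
    and definite: "\<And>x. x \<in> V \<Longrightarrow> A x x \<le> 0 \<Longrightarrow> x = 0"
    and sol: "solves_VI A F K u" "solves_VI A F K v"
  shows "u = v"
proof -
  have uv: "u \<in> K" "v \<in> K" using sol by (auto simp: solves_VI_def)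
  then have V': "u \<in> V" "v \<in> V" "u - v \<in> V" using K subspace_diff[OF V] by auto
  note minus = bounded_functional_on_scaleR[OF _ V'(3), where c = "-1"]
  have "A u (v - u) \<ge> F (v - u)" "A v (u - v) \<ge> F (u - v)"
    using sol uv by (auto simp: solves_VI_def)
  moreover have "A u (v - u) = - A u (u - v)" "F (v - u) = - F (u - v)"
    using minus[OF A2[OF V'(1)]] minus[OF F] by simp_all
  moreover have "A (u - v) (u - v) = A u (u - v) - A v (u - v)"
    by (rule bounded_functional_on_diff[OF A1[OF V'(3)] V V'(1,2)])
  ultimately have "A (u - v) (u - v) \<le> 0" by simp
  then show ?thesis using definite[OF V'(3)] by simp
qed

text \<open>
  The space \<^term>\<open>U \<Omega>\<close> consists of triples whose last component is a bare function, and it carries no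
  norm as a type. A linear injection \<open>T\<close> into an inner product space provides the Hilbert space structure,
  with the norm \<open>\<parallel>T x\<parallel>\<close>, and the problem is solved on the image.
\<close>

theorem Lions_Stampacchia_isometric:
  fixes T :: "'b::real_vector \<Rightarrow> 'a::real_inner"
  assumes V: "subspace V"
    and add: "\<And>x y. x \<in> V \<Longrightarrow> y \<in> V \<Longrightarrow> T (x + y) = T x + T y"
    and scale: "\<And>c x. x \<in> V \<Longrightarrow> T (c *\<^sub>R x) = c *\<^sub>R T x"
    and inj: "inj_on T V" and complete: "complete (T ` V)"
    and K: "K \<subseteq> V" "K \<noteq> {}" "convex K" "closed (T ` K)"
    and A1: "\<And>y. y \<in> V \<Longrightarrow> bounded_functional_on V (\<lambda>x. norm (T x)) (\<lambda>x. A x y)"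
    and A2: "\<And>x. x \<in> V \<Longrightarrow> bounded_functional_on V (\<lambda>x. norm (T x)) (A x)"
    and bound: "\<And>x y. x \<in> V \<Longrightarrow> y \<in> V \<Longrightarrow> \<bar>A x y\<bar> \<le> M * norm (T x) * norm (T y)"
    and \<alpha>: "0 < \<alpha>" and coercive: "\<And>x. x \<in> V \<Longrightarrow> \<alpha> * (norm (T x))\<^sup>2 \<le> A x x"
    and F: "bounded_functional_on V (\<lambda>x. norm (T x)) F"
  shows "\<exists>!u. solves_VI A F K u"
proof -
  define G where "G = the_inv_into V T"
  have GT: "G (T x) = x" if "x \<in> V" for x
    unfolding G_def by (rule the_inv_into_f_f[OF inj that])
  have GV: "G x \<in> V" "T (G x) = x" if "x \<in> T ` V" for x using that GT by auto
  have VS: "T x \<in> T ` V" if "x \<in> V" for x using that by simp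
  have G_add: "G (x + y) = G x + G y" if xy: "x \<in> T ` V" "y \<in> T ` V" for x y
  proof -
    have "T (G x + G y) = x + y" using GV xy by (simp add: add)
    then show ?thesis using GT[OF subspace_add[OF V GV(1) GV(1)], OF xy] by simp
  qed
  have G_scale: "G (c *\<^sub>R x) = c *\<^sub>R G x" if x: "x \<in> T ` V" for c x
  proof -
    have "T (c *\<^sub>R G x) = c *\<^sub>R x" using GV x by (simp add: scale)
    then show ?thesis using GT[OF subspace_scale[OF V GV(1)], OF x] by metis
  qed
  have S: "subspace (T ` V)"
  proof (rule subspaceI)
    have "T 0 = 0" using scale[OF subspace_0[OF V], of 0] by simp
    then show "0 \<in> T ` V" using subspace_0[OF V] by force
  next
    fix x y assume "x \<in> T ` V" "y \<in> T ` V"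
    then obtain x' y' where "x' \<in> V" "x = T x'" "y' \<in> V" "y = T y'" by blast
    then show "x + y \<in> T ` V" using add[of x' y'] VS[OF subspace_add[OF V], of x' y'] by simp
  next
    fix x and c :: real assume "x \<in> T ` V"
    then obtain x' where "x' \<in> V" "x = T x'" by blast
    then show "c *\<^sub>R x \<in> T ` V" using scale[of x' c] VS[OF subspace_scale[OF V], of x' c] by simp
  qed
  have transport: "bounded_functional_on (T ` V) norm (\<lambda>x. l (G x))"
    if l: "bounded_functional_on V (\<lambda>x. norm (T x)) l" for l
  proof -
    obtain C where "\<And>x. x \<in> V \<Longrightarrow> \<bar>l x\<bar> \<le> C * norm (T x)"
      using l unfolding bounded_functional_on_def by blast
    then have "\<bar>l (G x)\<bar> \<le> C * norm x" if "x \<in> T ` V" for x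
      using GV[OF that] by fastforce
    moreover have "l (G (x + y)) = l (G x) + l (G y)" if "x \<in> T ` V" "y \<in> T ` V" for x y
      using G_add[OF that] bounded_functional_on_add[OF l] GV that by simp
    moreover have "l (G (c *\<^sub>R x)) = c * l (G x)" if "x \<in> T ` V" for c x
      using G_scale[OF that] bounded_functional_on_scaleR[OF l] GV that by simp
    ultimately show ?thesis unfolding bounded_functional_on_def by blast
  qed
  have TK: "T ` K \<subseteq> T ` V" using K(1) by blast
  have convex: "convex (T ` K)"
  proof (rule convexI)
    fix x y :: 'a and s t :: real
    assume "x \<in> T ` K" "y \<in> T ` K" and st: "0 \<le> s" "0 \<le> t" "s + t = 1"
    then obtain x' y' where x': "x' \<in> K" "x = T x'" and y': "y' \<in> K" "y = T y'" by blast
    have "s *\<^sub>R x' \<in> V" "t *\<^sub>R y' \<in> V" using x' y' K(1) subspace_scale[OF V] by blast+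
    then have "s *\<^sub>R x + t *\<^sub>R y = T (s *\<^sub>R x' + t *\<^sub>R y')"
      using x' y' K(1) add scale by (simp add: subset_iff)
    then show "s *\<^sub>R x + t *\<^sub>R y \<in> T ` K" using convexD[OF K(3) x'(1) y'(1) st] by simp
  qed
  have "\<exists>w. solves_VI (\<lambda>x y. A (G x) (G y)) (\<lambda>x. F (G x)) (T ` K) w"
  proof (rule Lions_Stampacchia[OF S complete TK _ convex K(4), where M = M and \<alpha> = \<alpha>])
    show "T ` K \<noteq> {}" using K(2) by simp
    show "bounded_functional_on (T ` V) norm (\<lambda>x. A (G x) (G y))" if "y \<in> T ` V" for y
      by (rule transport) (rule A1[OF GV(1)[OF that]])
    show "bounded_functional_on (T ` V) norm (\<lambda>y. A (G x) (G y))" if "x \<in> T ` V" for x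
      by (rule transport) (rule A2[OF GV(1)[OF that]])
    show "bounded_functional_on (T ` V) norm (\<lambda>x. F (G x))" by (rule transport) (rule F)
    show "\<bar>A (G x) (G y)\<bar> \<le> M * norm x * norm y" if "x \<in> T ` V" "y \<in> T ` V" for x y
      using bound[OF GV(1)[OF that(1)] GV(1)[OF that(2)]] GV(2) that by simp
    show "\<alpha> * (norm x)\<^sup>2 \<le> A (G x) (G x)" if "x \<in> T ` V" for x
      using coercive[OF GV(1)[OF that]] GV(2)[OF that] by simp
  qed (rule \<alpha>)
  then obtain w where w: "solves_VI (\<lambda>x y. A (G x) (G y)) (\<lambda>x. F (G x)) (T ` K) w" ..
  then obtain u where u: "u \<in> K" "w = T u" by (auto simp: solves_VI_def)
  have "solves_VI A F K u"
    unfolding solves_VI_def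
  proof (intro conjI ballI)
    fix v assume v: "v \<in> K"
    have uv: "u \<in> V" "v \<in> V" using u v K(1) by auto
    have "T v - T u \<in> T ` V" using subspace_diff[OF S] uv by blast
    moreover have "G (T v - T u) = v - u"
      using G_add[of "T v" "(-1) *\<^sub>R T u"] G_scale[of "T u" "-1"] subspace_scale[OF S, of "T u" "-1"]
        GT uv by simp
    moreover have "F (G (T v - T u)) \<le> A (G (T u)) (G (T v - T u))"
      using w u v by (auto simp: solves_VI_def)
    ultimately show "F (v - u) \<le> A u (v - u)" using GT uv by simp
  qed (rule u)
  moreover have "x = u" if "solves_VI A F K x" for x
  proof (rule VI_solution_unique[OF V K(1) A1 A2 F _ that \<open>solves_VI A F K u\<close>])
    fix x assume x: "x \<in> V" "A x x \<le> 0"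
    then have "\<alpha> * (norm (T x))\<^sup>2 \<le> 0" using coercive[OF x(1)] by simp
    then have "T x = T (0 *\<^sub>R x)" using \<alpha> scale[OF x(1), of 0] by (simp add: mult_le_0_iff)
    then show "x = 0" using inj x subspace_0[OF V] by (simp add: inj_on_eq_iff)
  qed
  ultimately show ?thesis by blast
qed

text \<open>
  Translates closedness in the metric topology of \<^term>\<open>U_topology\<close> into the form that
  \<open>Lions_Stampacchia_isometric\<close> expects.
\<close>

lemma closed_image_if_closedin_isometric:
  fixes T :: "'b \<Rightarrow> 'a::real_normed_vector"
  assumes d: "Metric_space V d" "\<And>x y. x \<in> V \<Longrightarrow> y \<in> V \<Longrightarrow> d x y = norm (T x - T y)"
    and closed: "closed (T ` V)" and K: "closedin (Metric_space.mtopology V d) K"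
  shows "closed (T ` K)"
  unfolding closed_sequential_limits
proof (intro allI impI, elim conjE)
  fix X l assume X: "\<forall>n. X n \<in> T ` K" "X \<longlonglongrightarrow> l"
  note seq = K[unfolded Metric_space.metric_closedin_iff_sequentially_closed[OF d(1)]]
  have KV: "K \<subseteq> V" using seq by blast
  have "\<exists>x. \<forall>n. x n \<in> K \<and> X n = T (x n)"
    by (rule choice) (use X(1) in blast)
  then obtain x where x: "\<And>n. x n \<in> K" "\<And>n. X n = T (x n)" by blast
  have "l \<in> T ` V"
    by (rule closed_sequentially[OF closed _ X(2)]) (use x KV in auto)
  then obtain y where y: "y \<in> V" "l = T y" by blast
  have "(\<lambda>n. norm (X n - l)) \<longlonglongrightarrow> 0" using X(2) by (intro tendsto_norm_zero LIM_zero)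
  moreover have xV: "x n \<in> V" for n using x(1) KV by blast
  moreover have "norm (X n - l) = d (x n) y" for n using d(2)[OF xV y(1)] x(2) y(2) by simp
  ultimately have "limitin (Metric_space.mtopology V d) x y sequentially"
    unfolding Metric_space.limitin_metric_dist_null[OF d(1)] using y(1) by simp
  moreover have "range x \<subseteq> K" using x(1) by blast
  ultimately have "y \<in> K" using seq by blast
  then show "l \<in> T ` K" using y by blast
qed

section \<open>The space of square integrable functions is complete\<close>

lemma l2_eq_refl [simp]: "l2_eq f f \<longleftrightarrow> square_integrable f"
  by (auto simp: l2_eq_def)

lemma l2_cases:
  obtains f where "square_integrable f" "u = abs_l2 f"
proof -
  have "\<exists>f. square_integrable f \<and> u = abs_l2 f"
    by (rule l2.abs_induct[of _ u]) (unfold l2_eq_refl, blast)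
  then show thesis using that by blast
qed

lemma abs_l2_eq_iff:
  "square_integrable f \<Longrightarrow> square_integrable g \<Longrightarrow>
     abs_l2 f = abs_l2 g \<longleftrightarrow> (AE x in lebesgue. f x = g x)"
  using Quotient3_rel[OF Quotient3_l2, of f g] by (auto simp: l2_eq_def)

lemma inner_abs_l2:
  "square_integrable f \<Longrightarrow> square_integrable g \<Longrightarrow> abs_l2 f \<bullet> abs_l2 g = (\<integral>x. f x \<bullet> g x \<partial>lebesgue)"
  by (simp add: inner_l2.abs_eq)

lemma norm_abs_l2:
  "square_integrable f \<Longrightarrow> (norm (abs_l2 f))\<^sup>2 = (\<integral>x. (norm (f x))\<^sup>2 \<partial>lebesgue)"
  by (simp add: power2_norm_eq_inner inner_abs_l2)

lemma diff_abs_l2: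
  "square_integrable f \<Longrightarrow> square_integrable g \<Longrightarrow> abs_l2 f - abs_l2 g = abs_l2 (\<lambda>x. f x - g x)"
  by (simp add: minus_l2.abs_eq)

lemma nn_integral_norm_abs_l2:
  assumes "square_integrable f"
  shows "(\<integral>\<^sup>+x. ennreal ((norm (f x))\<^sup>2) \<partial>lebesgue) = ennreal ((norm (abs_l2 f))\<^sup>2)"
  using assms by (subst nn_integral_eq_integral) (auto simp: norm_abs_l2 square_integrable_def)

lemma square_integrable_bound:
  assumes "square_integrable f" and g: "g \<in> borel_measurable lebesgue"
    and le: "\<And>x. norm (g x) \<le> norm (f x)"
  shows "square_integrable g"
  unfolding square_integrable_def
proof
  show "integrable lebesgue (\<lambda>x. (norm (g x))\<^sup>2)"
  proof (rule Bochner_Integration.integrable_bound)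
    show "integrable lebesgue (\<lambda>x. (norm (f x))\<^sup>2)"
      using assms by (simp add: square_integrable_def)
    show "AE x in lebesgue. norm ((norm (g x))\<^sup>2) \<le> norm ((norm (f x))\<^sup>2)"
      using le by (simp add: power_mono)
  qed (use g in measurable)
qed (rule g)

text \<open>
  The weighted sum \<open>\<Sum>n. 4\<^sup>n |f\<^sub>n\<^sub>+\<^sub>1 - f\<^sub>n|\<^sup>2\<close> has a finite integral, hence is finite almost everywhere.
  By the inequality of arithmetic and geometric means,
  \<open>2 |f\<^sub>n\<^sub>+\<^sub>1 - f\<^sub>n| \<le> 4\<^sup>-\<^sup>n + 4\<^sup>n |f\<^sub>n\<^sub>+\<^sub>1 - f\<^sub>n|\<^sup>2\<close>, so at such points the differences are summable.
\<close>

lemma AE_convergent_if_summable_differences: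
  fixes f :: "nat \<Rightarrow> 'a::euclidean_space \<Rightarrow> 'b::euclidean_space"
  assumes f: "\<And>n. square_integrable (f n)"
    and fast: "\<And>n. norm (abs_l2 (f (Suc n)) - abs_l2 (f n)) \<le> (1/4)^n"
  shows "AE x in lebesgue. convergent (\<lambda>n. f n x)"
proof -
  define d where "d n x = 4^n * (norm (f (Suc n) x - f n x))\<^sup>2" for n x
  have dmeas: "(\<lambda>x. ennreal (d n x)) \<in> borel_measurable lebesgue" for n
  proof -
    have [measurable]: "f n \<in> borel_measurable lebesgue" for n
      using f[of n] by (simp add: square_integrable_def)
    show ?thesis unfolding d_def by measurable
  qed
  have int_d: "(\<integral>\<^sup>+x. ennreal (d n x) \<partial>lebesgue) \<le> ennreal ((1/4)^n)" for n
  proof -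
    have si: "square_integrable (\<lambda>x. f (Suc n) x - f n x)" by (intro square_integrable_diff f)
    then have m: "(\<lambda>x. (norm (f (Suc n) x - f n x))\<^sup>2) \<in> borel_measurable lebesgue"
      by (auto simp: square_integrable_def)
    have "(\<integral>\<^sup>+x. ennreal (d n x) \<partial>lebesgue)
        = ennreal (4^n) * (\<integral>\<^sup>+x. ennreal ((norm (f (Suc n) x - f n x))\<^sup>2) \<partial>lebesgue)"
      unfolding d_def using m by (subst nn_integral_cmult[symmetric]) (auto simp: ennreal_mult)
    also have "\<dots> = ennreal (4^n * (norm (abs_l2 (f (Suc n)) - abs_l2 (f n)))\<^sup>2)"
      using nn_integral_norm_abs_l2[OF si] f by (simp add: diff_abs_l2 ennreal_mult)
    also have "\<dots> \<le> ennreal (4^n * ((1/4)^n)\<^sup>2)"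
      by (intro ennreal_leI mult_left_mono power_mono fast) auto
    also have "4^n * ((1/4)^n)\<^sup>2 = ((1/4)^n :: real)"
      by (simp add: power2_eq_square power_mult_distrib[symmetric] mult.assoc[symmetric])
    finally show ?thesis .
  qed
  have "(\<integral>\<^sup>+x. (\<Sum>n. ennreal (d n x)) \<partial>lebesgue) = (\<Sum>n. \<integral>\<^sup>+x. ennreal (d n x) \<partial>lebesgue)"
    by (rule nn_integral_suminf[OF dmeas])
  also have "\<dots> \<le> (\<Sum>n. ennreal ((1/4)^n))"
    by (intro suminf_le int_d) auto
  also have "\<dots> = ennreal (\<Sum>n. (1/4)^n)"
    by (intro suminf_ennreal2 summable_geometric) auto
  finally have "(\<integral>\<^sup>+x. (\<Sum>n. ennreal (d n x)) \<partial>lebesgue) \<noteq> \<infinity>"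
    by (auto simp: top_unique)
  then have "AE x in lebesgue. (\<Sum>n. ennreal (d n x)) \<noteq> \<infinity>"
    using dmeas by (intro nn_integral_PInf_AE borel_measurable_suminf) auto
  then show ?thesis
  proof eventually_elim
    case (elim x)
    have "summable (\<lambda>n. d n x)"
      using elim by (intro summable_suminf_not_top) (auto simp: d_def)
    then have "summable (\<lambda>n. ((1/4)^n + d n x) / 2)"
      by (intro summable_divide summable_add summable_geometric) auto
    moreover have "norm (f (Suc n) x - f n x) \<le> ((1/4)^n + d n x) / 2" for n
    proof -
      let ?e = "norm (f (Suc n) x - f n x)"
      have "2 * ((1/2)^n * (2^n * ?e)) \<le> ((1/2)^n)\<^sup>2 + (2^n * ?e)\<^sup>2"
        using sum_squares_bound[of "(1/2)^n" "2^n * ?e"] by (simp add: mult.assoc)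
      moreover have "(1/2)^n * (2^n * ?e) = ?e"
        by (simp add: mult.assoc[symmetric] power_mult_distrib[symmetric])
      moreover have "((1/2)^n)\<^sup>2 = ((1/4)^n :: real)" "(2^n)\<^sup>2 = (4^n :: real)"
        by (simp_all add: power2_eq_square power_mult_distrib[symmetric])
      ultimately show ?thesis by (simp add: d_def power_mult_distrib)
    qed
    ultimately have "summable (\<lambda>n. f (Suc n) x - f n x)"
      by (rule summable_comparison_test'[where N = 0])
    then have "convergent (\<lambda>n. \<Sum>i<n. f (Suc i) x - f i x)"
      by (simp add: summable_iff_convergent)
    then have "convergent (\<lambda>n. f n x - f 0 x)"
      by (simp only: sum_lessThan_telescope[of "\<lambda>n. f n x"])
    then obtain l where "(\<lambda>n. f n x - f 0 x) \<longlonglongrightarrow> l" by (auto simp: convergent_def)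
    then have "(\<lambda>n. f n x - f 0 x + f 0 x) \<longlonglongrightarrow> l + f 0 x" by (intro tendsto_intros)
    then show ?case by (auto simp: convergent_def)
  qed
qed

text \<open>
  Riesz--Fischer: a sufficiently fast subsequence converges almost everywhere, and Fatou's lemma
  shows that its pointwise limit is also the limit in norm.
\<close>

instance l2 :: (euclidean_space, euclidean_space) complete_space
proof
  fix X :: "nat \<Rightarrow> ('a, 'b) l2"
  assume X: "Cauchy X"
  have "\<forall>n. \<exists>N. \<forall>m\<ge>N. \<forall>k\<ge>N. norm (X m - X k) < (1/4)^n"
    using X by (auto simp: Cauchy_iff)
  then obtain N where N: "\<And>n m k. m \<ge> N n \<Longrightarrow> k \<ge> N n \<Longrightarrow> norm (X m - X k) < (1/4)^n"
    by metis
  define r where "r n = (\<Sum>i\<le>n. Suc (N i))" for n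
  have r: "strict_mono r" by (auto simp: strict_mono_Suc_iff r_def)
  have rN: "N n \<le> r n" for n by (cases n) (auto simp: r_def)
  have "\<forall>n. \<exists>f. square_integrable f \<and> X (r n) = abs_l2 f" by (metis l2_cases)
  then obtain f where f: "\<And>n. square_integrable (f n)" "\<And>n. X (r n) = abs_l2 (f n)" by metis
  have fm[measurable]: "f n \<in> borel_measurable lebesgue" for n
    using f(1)[of n] by (simp add: square_integrable_def)
  have "norm (abs_l2 (f (Suc n)) - abs_l2 (f n)) \<le> (1/4)^n" for n
  proof -
    have "N n \<le> r (Suc n)" using rN[of n] strict_mono_less[OF r, of n "Suc n"] by simp
    then show ?thesis using N[OF _ rN[of n]] f(2) by (metis less_imp_le)
  qed
  from AE_convergent_if_summable_differences[OF f(1) this]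
  have conv: "AE x in lebesgue. convergent (\<lambda>n. f n x)" .
  define g where "g x = lim (\<lambda>n. f n x)" for x
  have gm[measurable]: "g \<in> borel_measurable lebesgue"
    unfolding g_def by (rule borel_measurable_lim_metric) simp
  have lim: "AE x in lebesgue. (\<lambda>n. f n x) \<longlonglongrightarrow> g x"
    using conv by eventually_elim (simp add: g_def convergent_LIMSEQ_iff)
  have fatou: "(\<integral>\<^sup>+x. ennreal ((norm (g x - f n x))\<^sup>2) \<partial>lebesgue) \<le> ennreal (e\<^sup>2)"
    if e: "\<And>m. m \<ge> M \<Longrightarrow> norm (X (r m) - X (r n)) \<le> e" for n M e
  proof -
    have "(\<integral>\<^sup>+x. ennreal ((norm (g x - f n x))\<^sup>2) \<partial>lebesgue)
        = (\<integral>\<^sup>+x. liminf (\<lambda>m. ennreal ((norm (f m x - f n x))\<^sup>2)) \<partial>lebesgue)"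
    proof (rule nn_integral_cong_AE)
      show "AE x in lebesgue. ennreal ((norm (g x - f n x))\<^sup>2)
          = liminf (\<lambda>m. ennreal ((norm (f m x - f n x))\<^sup>2))"
        using lim
      proof eventually_elim
        case (elim x)
        then have "(\<lambda>m. ennreal ((norm (f m x - f n x))\<^sup>2)) \<longlonglongrightarrow> ennreal ((norm (g x - f n x))\<^sup>2)"
          by (intro tendsto_intros tendsto_ennrealI)
        then show ?case by (intro lim_imp_Liminf[symmetric]) auto
      qed
    qed
    also have "\<dots> \<le> liminf (\<lambda>m. \<integral>\<^sup>+x. ennreal ((norm (f m x - f n x))\<^sup>2) \<partial>lebesgue)"
      by (rule nn_integral_liminf) measurable
    also have "\<dots> = liminf (\<lambda>m. ennreal ((norm (X (r m) - X (r n)))\<^sup>2))"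
      using nn_integral_norm_abs_l2[OF square_integrable_diff[OF f(1) f(1)]]
      by (simp add: f diff_abs_l2)
    also have "\<dots> \<le> liminf (\<lambda>m. ennreal (e\<^sup>2))"
    proof (rule Liminf_mono)
      show "\<forall>\<^sub>F m in sequentially. ennreal ((norm (X (r m) - X (r n)))\<^sup>2) \<le> ennreal (e\<^sup>2)"
        using e by (auto simp: eventually_sequentially intro!: exI[of _ M] ennreal_leI power_mono)
    qed
    also have "\<dots> = ennreal (e\<^sup>2)" by (simp add: Liminf_const)
    finally show ?thesis .
  qed
  have cauchy: "\<exists>M. \<forall>m\<ge>M. \<forall>n\<ge>M. norm (X (r m) - X (r n)) \<le> e" if pos: "e > 0" for e
  proof -
    obtain M where M: "\<forall>m\<ge>M. \<forall>n\<ge>M. norm (X m - X n) < e"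
      using X pos unfolding Cauchy_iff by blast
    have "r k \<ge> M" if "k \<ge> M" for k using seq_suble[OF r, of k] that by simp
    then show ?thesis using M by (meson less_imp_le)
  qed
  have si: "square_integrable (\<lambda>x. g x - f n x)" and le: "norm (abs_l2 g - X (r n)) \<le> e"
    if e: "\<And>m. m \<ge> M \<Longrightarrow> norm (X (r m) - X (r n)) \<le> e" and "e \<ge> 0" for n M e
  proof -
    have "integrable lebesgue (\<lambda>x. (norm (g x - f n x))\<^sup>2)"
      using le_less_trans[OF fatou[OF e] ennreal_less_top] by (intro integrableI_bounded) auto
    then show si: "square_integrable (\<lambda>x. g x - f n x)" by (simp add: square_integrable_def)
    have sg: "square_integrable g" using square_integrable_add[OF si f(1)[of n]] by simp
    have "ennreal ((norm (abs_l2 g - X (r n)))\<^sup>2) \<le> ennreal (e\<^sup>2)"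
      using fatou[OF e] nn_integral_norm_abs_l2[OF si] sg f by (simp add: diff_abs_l2)
    then have "(norm (abs_l2 g - X (r n)))\<^sup>2 \<le> e\<^sup>2" by simp
    then show "norm (abs_l2 g - X (r n)) \<le> e" using \<open>e \<ge> 0\<close> by (rule power2_le_imp_le)
  qed
  have "(\<lambda>n. X (r n)) \<longlonglongrightarrow> abs_l2 g"
  proof (rule LIMSEQ_I)
    fix e :: real assume "0 < e"
    then obtain M where "\<forall>m\<ge>M. \<forall>n\<ge>M. norm (X (r m) - X (r n)) \<le> e/2" using cauchy[of "e/2"] by auto
    then have "norm (abs_l2 g - X (r n)) \<le> e/2" if "n \<ge> M" for n
      using le[of M n "e/2"] \<open>0 < e\<close> that by auto
    then have "\<forall>n\<ge>M. norm (X (r n) - abs_l2 g) < e"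
      using \<open>0 < e\<close> by (force simp: norm_minus_commute)
    then show "\<exists>M. \<forall>n\<ge>M. norm (X (r n) - abs_l2 g) < e" by blast
  qed
  then have "(X \<circ> r) \<longlonglongrightarrow> abs_l2 g" by (simp add: o_def)
  then show "convergent X"
    using Cauchy_converges_subseq[OF X r] by (auto simp: convergent_def)
qed

section \<open>Support and sign as closed conditions\<close>

lemma subspace_L2: "subspace (L2 \<Omega> :: ('a::euclidean_space, 'b::euclidean_space) l2 set)"
proof (rule subspaceI; unfold L2_def mem_Collect_eq)
  show "vanishes_off \<Omega> (0 :: ('a, 'b) l2)" by transfer simp
next
  fix f g :: "('a, 'b) l2" assume "vanishes_off \<Omega> f" "vanishes_off \<Omega> g"
  then show "vanishes_off \<Omega> (f + g)"
    by (transfer fixing: \<Omega>) (erule eventually_elim2, assumption, simp)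
next
  fix f :: "('a, 'b) l2" and c assume "vanishes_off \<Omega> f"
  then show "vanishes_off \<Omega> (c *\<^sub>R f)"
    by (transfer fixing: \<Omega> c) (erule eventually_mono, simp)
qed

lemma nonneg_on_add: "nonneg_on \<Omega> f \<Longrightarrow> nonneg_on \<Omega> g \<Longrightarrow> nonneg_on \<Omega> (f + g)"
  by (transfer fixing: \<Omega>) (erule eventually_elim2, assumption, simp)

lemma nonneg_on_scaleR: "0 \<le> c \<Longrightarrow> nonneg_on \<Omega> f \<Longrightarrow> nonneg_on \<Omega> (c *\<^sub>R f)"
  by (transfer fixing: \<Omega> c) (erule eventually_mono, simp)

lemma nonneg_on_0: "nonneg_on \<Omega> 0"
  by transfer simp

text \<open>
  Convergence in norm does not imply convergence almost everywhere, so conditions that hold almost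
  everywhere are described by inner products, which makes their closedness evident. The witness for the converse
  inclusion is the part of \<open>f\<close> that violates the condition: its restriction to the complement of
  \<open>\<Omega>\<close> here, and its negative part on \<open>\<Omega>\<close> in \<open>nonneg_on_eq_polar_cone\<close>.
\<close>

lemma L2_eq_orthogonal_complement:
  fixes \<Omega> :: "'a::euclidean_space set"
  assumes \<Omega>: "\<Omega> \<in> sets lebesgue"
  shows "(L2 \<Omega> :: ('a, 'b::euclidean_space) l2 set) = (\<Inter>h\<in>L2 (- \<Omega>). {f. f \<bullet> h = 0})"
proof (intro equalityI subsetI)
  fix f :: "('a, 'b) l2" assume "f \<in> L2 \<Omega>"
  moreover have "f \<bullet> h = 0" if "vanishes_off \<Omega> f" "vanishes_off (- \<Omega>) h" for h :: "('a, 'b) l2"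
    using that
  proof (transfer fixing: \<Omega>)
    fix f h :: "'a \<Rightarrow> 'b"
    assume "AE x in lebesgue. x \<notin> \<Omega> \<longrightarrow> f x = 0" "AE x in lebesgue. x \<notin> - \<Omega> \<longrightarrow> h x = 0"
    then have "AE x in lebesgue. f x \<bullet> h x = 0" by eventually_elim auto
    then show "(\<integral>x. f x \<bullet> h x \<partial>lebesgue) = 0" by (rule integral_eq_zero_AE)
  qed
  ultimately show "f \<in> (\<Inter>h\<in>L2 (- \<Omega>). {f. f \<bullet> h = 0})" by (auto simp: L2_def)
next
  fix u :: "('a, 'b) l2" assume u: "u \<in> (\<Inter>h\<in>L2 (- \<Omega>). {f. f \<bullet> h = 0})"
  obtain f where f: "square_integrable f" "u = abs_l2 f" by (rule l2_cases)
  define h where "h x = indicator (- \<Omega>) x *\<^sub>R f x" for x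
  have h: "square_integrable h"
    by (rule square_integrable_bound[OF f(1)])
      (use f \<Omega> in \<open>auto simp: h_def[abs_def] square_integrable_def indicator_def\<close>)
  have "abs_l2 h \<in> L2 (- \<Omega>)" using h by (simp add: L2_def vanishes_off.abs_eq h_def)
  then have "u \<bullet> abs_l2 h = 0" using u by auto
  moreover have "u \<bullet> abs_l2 h = (norm (abs_l2 h))\<^sup>2"
    unfolding f(2) inner_abs_l2[OF f(1) h] norm_abs_l2[OF h]
    by (intro Bochner_Integration.integral_cong) (auto simp: h_def indicator_def power2_norm_eq_inner)
  ultimately have "abs_l2 h = abs_l2 (\<lambda>x. 0)" by (simp add: zero_l2_def)
  then have "AE x in lebesgue. h x = 0" using abs_l2_eq_iff[OF h square_integrable_zero] by simp
  then show "u \<in> L2 \<Omega>"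
    unfolding L2_def mem_Collect_eq f(2) vanishes_off.abs_eq[OF l2_eq_refl[THEN iffD2, OF f(1)]]
    by eventually_elim (auto simp: h_def)
qed

lemma closed_L2:
  assumes "\<Omega> \<in> sets lebesgue"
  shows "closed (L2 \<Omega> :: ('a::euclidean_space, 'b::euclidean_space) l2 set)"
  unfolding L2_eq_orthogonal_complement[OF assms]
proof (rule closed_INT, rule ballI)
  show "closed {f. f \<bullet> h = 0}" for h :: "('a, 'b) l2"
    using closed_hyperplane[of h 0] by (simp add: inner_commute[of _ h])
qed

lemma nonneg_on_eq_polar_cone:
  fixes \<Omega> :: "'a::euclidean_space set"
  assumes \<Omega>: "\<Omega> \<in> sets lebesgue"
  shows "{f. nonneg_on \<Omega> f} = (\<Inter>h\<in>L2 \<Omega> \<inter> {h. nonneg_on \<Omega> h}. {f. 0 \<le> f \<bullet> h})"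
proof (intro equalityI subsetI)
  fix f :: "('a, real) l2" assume "f \<in> {f. nonneg_on \<Omega> f}"
  moreover have "0 \<le> f \<bullet> h" if "nonneg_on \<Omega> f" "vanishes_off \<Omega> h" "nonneg_on \<Omega> h"
    for h :: "('a, real) l2"
    using that
  proof (transfer fixing: \<Omega>)
    fix f h :: "'a \<Rightarrow> real"
    assume "AE x in lebesgue. x \<in> \<Omega> \<longrightarrow> 0 \<le> f x" "AE x in lebesgue. x \<notin> \<Omega> \<longrightarrow> h x = 0"
      "AE x in lebesgue. x \<in> \<Omega> \<longrightarrow> 0 \<le> h x"
    then have "AE x in lebesgue. 0 \<le> f x \<bullet> h x"
    proof eventually_elim
      case (elim x)
      then show ?case by (cases "x \<in> \<Omega>") simp_all
    qed
    then show "0 \<le> (\<integral>x. f x \<bullet> h x \<partial>lebesgue)" by (rule integral_nonneg_AE)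
  qed
  ultimately show "f \<in> (\<Inter>h\<in>L2 \<Omega> \<inter> {h. nonneg_on \<Omega> h}. {f. 0 \<le> f \<bullet> h})"
    by (auto simp: L2_def)
next
  fix u :: "('a, real) l2"
  assume u: "u \<in> (\<Inter>h\<in>L2 \<Omega> \<inter> {h. nonneg_on \<Omega> h}. {f. 0 \<le> f \<bullet> h})"
  obtain f where f: "square_integrable f" "u = abs_l2 f" by (rule l2_cases)
  define h where "h x = indicator \<Omega> x * max 0 (- f x)" for x
  have h: "square_integrable h"
    by (rule square_integrable_bound[OF f(1)])
      (use f \<Omega> in \<open>auto simp: h_def[abs_def] square_integrable_def indicator_def\<close>)
  have "abs_l2 h \<in> L2 \<Omega> \<inter> {h. nonneg_on \<Omega> h}"
    using h by (simp add: L2_def vanishes_off.abs_eq nonneg_on.abs_eq h_def)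
  then have "0 \<le> u \<bullet> abs_l2 h" using u by auto
  moreover have "u \<bullet> abs_l2 h = (\<integral>x. - (norm (h x))\<^sup>2 \<partial>lebesgue)"
    unfolding f(2) inner_abs_l2[OF f(1) h]
    by (intro Bochner_Integration.integral_cong)
      (auto simp: h_def indicator_def power2_eq_square max_def)
  ultimately have "(norm (abs_l2 h))\<^sup>2 \<le> 0" by (simp add: norm_abs_l2[OF h])
  then have "abs_l2 h = abs_l2 (\<lambda>x. 0)" by (simp add: zero_l2_def)
  then have "AE x in lebesgue. h x = 0" using abs_l2_eq_iff[OF h square_integrable_zero] by simp
  then show "u \<in> {f. nonneg_on \<Omega> f}"
    unfolding mem_Collect_eq f(2) nonneg_on.abs_eq[OF l2_eq_refl[THEN iffD2, OF f(1)]]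
    by eventually_elim (auto simp: h_def)
qed

lemma closed_nonneg_on:
  assumes "\<Omega> \<in> sets lebesgue"
  shows "closed {f :: ('a::euclidean_space, real) l2. nonneg_on \<Omega> f}"
proof (subst nonneg_on_eq_polar_cone[OF assms], rule closed_INT, rule ballI)
  show "closed {f. 0 \<le> f \<bullet> h}" for h :: "('a, real) l2"
    using closed_halfspace_ge[of 0 h] by (simp add: inner_commute[of _ h])
qed

section \<open>Calculus of test functions\<close>

lemma vec_eq_sum_axis: "x = (\<Sum>j\<in>UNIV. x $ j *\<^sub>R axis j (1::real))"
  using basis_expansion[of x] by (simp add: scalar_mult_eq_scaleR)

lemma has_derivative_gradient:
  fixes f :: "real^'n \<Rightarrow> real"
  assumes "f differentiable at x"
  shows "(f has_derivative (\<lambda>h. gradient f x \<bullet> h)) (at x)"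
proof -
  let ?D = "frechet_derivative f (at x)"
  have D: "(f has_derivative ?D) (at x)" using assms by (simp add: frechet_derivative_works)
  then have lin: "linear ?D" by (rule has_derivative_linear)
  have "?D h = gradient f x \<bullet> h" for h
  proof -
    have "?D h = ?D (\<Sum>j\<in>UNIV. h $ j *\<^sub>R axis j 1)"
      by (subst vec_eq_sum_axis[of h]) (rule refl)
    also have "\<dots> = (\<Sum>j\<in>UNIV. h $ j * ?D (axis j 1))"
      using lin by (simp add: linear_sum linear_cmul)
    finally show ?thesis by (simp add: gradient_def inner_vec_def mult.commute)
  qed
  then have "?D = (\<lambda>h. gradient f x \<bullet> h)" by (rule ext)
  then show ?thesis using D by simp
qed

lemma gradient_eqI:
  fixes f :: "real^'n \<Rightarrow> real"
  assumes "(f has_derivative (\<lambda>h. w \<bullet> h)) (at x)"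
  shows "gradient f x = w"
  using frechet_derivative_at[OF assms, symmetric]
  by (simp add: gradient_def inner_axis vec_eq_iff)

lemma gradient_const: "gradient (\<lambda>x::real^'n. c) x = 0"
  by (rule gradient_eqI) simp

lemma gradient_add:
  fixes f g :: "real^'n \<Rightarrow> real"
  assumes "f differentiable at x" "g differentiable at x"
  shows "gradient (\<lambda>x. f x + g x) x = gradient f x + gradient g x"
  using has_derivative_add[OF assms[THEN has_derivative_gradient]]
  by (intro gradient_eqI) (simp add: inner_add_left)

lemma gradient_mult:
  fixes f g :: "real^'n \<Rightarrow> real"
  assumes "f differentiable at x" "g differentiable at x"
  shows "gradient (\<lambda>x. f x * g x) x = f x *\<^sub>R gradient g x + g x *\<^sub>R gradient f x"
  using has_derivative_mult[OF assms[THEN has_derivative_gradient]]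
  by (intro gradient_eqI) (simp add: inner_add_left mult.commute)

lemma continuously_differentiable_differentiable:
  "continuously_differentiable (Suc k) f \<Longrightarrow> f differentiable at x"
  by (simp add: differentiable_on_def)

lemma continuously_differentiable_SucD:
  "continuously_differentiable (Suc k) f \<Longrightarrow> continuously_differentiable k f"
  by (induction k arbitrary: f) (auto intro: differentiable_imp_continuous_on)

lemma continuously_differentiable_const: "continuously_differentiable k (\<lambda>x::real^'n. c)"
  by (induction k arbitrary: c) (auto simp: gradient_const)

lemma continuously_differentiable_add:
  assumes "continuously_differentiable k f" "continuously_differentiable k g"
  shows "continuously_differentiable k (\<lambda>x. f x + g x)"
  using assms
proof (induction k arbitrary: f g)
  case (Suc k)
  note d = Suc.prems[THEN continuously_differentiable_differentiable]
  show ?case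
    using Suc d by (auto simp: gradient_add intro!: differentiable_on_add)
qed (auto intro: continuous_on_add)

lemma continuously_differentiable_mult:
  assumes "continuously_differentiable k f" "continuously_differentiable k g"
  shows "continuously_differentiable k (\<lambda>x. f x * g x)"
  using assms
proof (induction k arbitrary: f g)
  case (Suc k)
  note d = Suc.prems[THEN continuously_differentiable_differentiable]
  note l = Suc.prems[THEN continuously_differentiable_SucD]
  have "continuously_differentiable k (\<lambda>x. f x * gradient g x $ j + g x * gradient f x $ j)" for j
    using Suc l by (intro continuously_differentiable_add Suc.IH) auto
  then show ?case
    using Suc.prems d by (auto simp: gradient_mult intro!: differentiable_on_mult)
qed (auto intro: continuous_on_mult)

lemma continuously_differentiable_prod:
  assumes "finite I" "\<And>i. i \<in> I \<Longrightarrow> continuously_differentiable k (f i)"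
  shows "continuously_differentiable k (\<lambda>x. \<Prod>i\<in>I. f i x)"
  using assms
  by (induction rule: finite_induct)
    (auto intro!: continuously_differentiable_const continuously_differentiable_mult)

lemma test_functionD:
  assumes "\<phi> \<in> test_functions \<Omega>"
  shows "continuously_differentiable k \<phi>" "\<phi> differentiable at x" "continuous_on UNIV \<phi>"
    and "compact (closure {x. \<phi> x \<noteq> 0})" "closure {x. \<phi> x \<noteq> 0} \<subseteq> \<Omega>"
proof -
  have cd: "continuously_differentiable k \<phi>" for k using assms by (simp add: test_functions_def)
  show "continuously_differentiable k \<phi>" by (rule cd)
  show "\<phi> differentiable at x" by (rule continuously_differentiable_differentiable[OF cd])
  show "continuous_on UNIV \<phi>" using cd[of 0] by simp
qed (use assms in \<open>auto simp: test_functions_def\<close>)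

lemma test_function_eq_0:
  "\<phi> \<in> test_functions \<Omega> \<Longrightarrow> x \<notin> closure {x. \<phi> x \<noteq> 0} \<Longrightarrow> \<phi> x = 0"
  using closure_subset[of "{x. \<phi> x \<noteq> 0}"] by auto

lemma gradient_test_function_eq_0:
  assumes "\<phi> \<in> test_functions \<Omega>" and x: "x \<notin> closure {x. \<phi> x \<noteq> 0}"
  shows "gradient \<phi> x = 0"
proof (rule gradient_eqI)
  have "((\<lambda>x. 0) has_derivative (\<lambda>h. 0)) (at x)" by simp
  then have "(\<phi> has_derivative (\<lambda>h. 0)) (at x)"
  proof (rule has_derivative_transform_within_open)
    show "open (- closure {x. \<phi> x \<noteq> 0})" by (rule open_Compl) (rule closed_closure)
    show "x \<in> - closure {x. \<phi> x \<noteq> 0}" using x by simp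
    show "0 = \<phi> y" if "y \<in> - closure {x. \<phi> x \<noteq> 0}" for y
      by (rule test_function_eq_0[OF assms(1), symmetric]) (use that in simp)
  qed
  then show "(\<phi> has_derivative (\<lambda>h. 0 \<bullet> h)) (at x)" by simp
qed

text \<open>
  Any compact set outside of which \<open>\<phi>\<close> vanishes may serve in place of the closed support.
\<close>

lemma test_functionI:
  assumes "\<And>k. continuously_differentiable k \<phi>" and S: "compact S" "S \<subseteq> \<Omega>"
    and 0: "\<And>x. x \<notin> S \<Longrightarrow> \<phi> x = 0"
  shows "\<phi> \<in> test_functions \<Omega>"
proof -
  have "closure {x. \<phi> x \<noteq> 0} \<subseteq> S"
    using 0 compact_imp_closed[OF S(1)] by (intro closure_minimal) auto
  moreover from this have "compact (closure {x. \<phi> x \<noteq> 0})"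
    using S(1) by (metis closed_closure closed_Int_compact inf.absorb_iff1)
  ultimately show ?thesis using assms by (auto simp: test_functions_def)
qed

lemma test_function_add:
  assumes \<phi>: "\<phi> \<in> test_functions \<Omega>" and \<psi>: "\<psi> \<in> test_functions \<Omega>"
  shows "(\<lambda>x. \<phi> x + \<psi> x) \<in> test_functions \<Omega>"
proof (rule test_functionI)
  let ?S = "closure {x. \<phi> x \<noteq> 0} \<union> closure {x. \<psi> x \<noteq> 0}"
  show "continuously_differentiable k (\<lambda>x. \<phi> x + \<psi> x)" for k
    by (intro continuously_differentiable_add test_functionD(1)[OF \<phi>] test_functionD(1)[OF \<psi>])
  show "compact ?S"
    by (intro compact_Un test_functionD(4)[OF \<phi>] test_functionD(4)[OF \<psi>])
  show "?S \<subseteq> \<Omega>"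
    by (intro Un_least test_functionD(5)[OF \<phi>] test_functionD(5)[OF \<psi>])
  show "\<phi> x + \<psi> x = 0" if "x \<notin> ?S" for x
  proof -
    have "\<phi> x = 0" "\<psi> x = 0"
      using that test_function_eq_0[OF \<phi>, of x] test_function_eq_0[OF \<psi>, of x] by blast+
    then show ?thesis by simp
  qed
qed

lemma test_function_mult:
  assumes \<phi>: "\<phi> \<in> test_functions \<Omega>" and \<psi>: "\<And>k. continuously_differentiable k \<psi>"
  shows "(\<lambda>x. \<psi> x * \<phi> x) \<in> test_functions \<Omega>"
proof (rule test_functionI[OF _ \<phi>[THEN test_functionD(4)] \<phi>[THEN test_functionD(5)]])
  show "continuously_differentiable k (\<lambda>x. \<psi> x * \<phi> x)" for k
    by (intro continuously_differentiable_mult test_functionD(1)[OF \<phi>] \<psi>)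
  show "\<psi> x * \<phi> x = 0" if "x \<notin> closure {x. \<phi> x \<noteq> 0}" for x
    using test_function_eq_0[OF \<phi> that] by simp
qed

lemma test_function_gradient:
  assumes \<phi>: "\<phi> \<in> test_functions \<Omega>"
  shows "(\<lambda>x. gradient \<phi> x $ j) \<in> test_functions \<Omega>"
proof (rule test_functionI[OF _ \<phi>[THEN test_functionD(4)] \<phi>[THEN test_functionD(5)]])
  show "continuously_differentiable k (\<lambda>x. gradient \<phi> x $ j)" for k
    using test_functionD(1)[OF \<phi>, of "Suc k"] by simp
qed (simp add: gradient_test_function_eq_0[OF \<phi>])

lemma continuous_compact_support_integrable:
  fixes f :: "'a::euclidean_space \<Rightarrow> real"
  assumes f: "continuous_on UNIV f" and S: "compact S" and 0: "\<And>x. x \<notin> S \<Longrightarrow> f x = 0"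
  shows "integrable lborel f"
proof -
  have "integrable lborel (\<lambda>x. indicator S x *\<^sub>R f x)"
    using borel_integrable_compact[OF S continuous_on_subset[OF f]] by simp
  also have "(\<lambda>x. indicator S x *\<^sub>R f x) = f" using 0 by (auto simp: indicator_def fun_eq_iff)
  finally show ?thesis .
qed

lemma test_function_integrable:
  assumes "\<phi> \<in> test_functions \<Omega>" shows "integrable lborel \<phi>"
  by (rule continuous_compact_support_integrable[OF test_functionD(3,4)[OF assms]
        test_function_eq_0[OF assms]])

lemma test_function_square_integrable:
  assumes \<phi>: "\<phi> \<in> test_functions \<Omega>" shows "square_integrable \<phi>"
proof -
  have b: "\<phi> \<in> borel_measurable borel" "(\<lambda>x. (norm (\<phi> x))\<^sup>2) \<in> borel_measurable borel"
    using test_functionD(3)[OF \<phi>] by (auto intro!: borel_measurable_continuous_onI continuous_intros)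
  have "integrable lborel (\<lambda>x. (norm (\<phi> x))\<^sup>2)"
    using test_function_integrable[OF test_function_mult[OF \<phi> test_functionD(1)[OF \<phi>]]]
    by (simp add: power2_eq_square)
  then show ?thesis
    using b by (simp add: square_integrable_def integrable_completion measurable_completion)
qed

lemma square_integrable_vec_iff:
  "square_integrable (F :: 'a::euclidean_space \<Rightarrow> real^'n) \<longleftrightarrow> (\<forall>j. square_integrable (\<lambda>x. F x $ j))"
proof
  assume F: "square_integrable F"
  show "\<forall>j. square_integrable (\<lambda>x. F x $ j)"
  proof
    fix j
    have m: "F \<in> borel_measurable lebesgue" using F by (simp add: square_integrable_def)
    have "(\<lambda>x. F x \<bullet> axis j 1) \<in> borel_measurable lebesgue" using m by measurable
    then have "(\<lambda>x. F x $ j) \<in> borel_measurable lebesgue" by (simp add: inner_axis)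
    then show "square_integrable (\<lambda>x. F x $ j)"
      by (rule square_integrable_bound[OF F]) (simp add: component_le_norm_cart)
  qed
next
  assume F: "\<forall>j. square_integrable (\<lambda>x. F x $ j)"
  have "F = (\<lambda>x. \<Sum>j\<in>UNIV. F x $ j *\<^sub>R axis j 1)"
    by (rule ext, rule vec_eq_sum_axis)
  moreover have "(\<lambda>x. \<Sum>j\<in>UNIV. F x $ j *\<^sub>R axis j (1::real)) \<in> borel_measurable lebesgue"
    using F by (auto simp: square_integrable_def intro!: borel_measurable_sum borel_measurable_scaleR)
  ultimately have "F \<in> borel_measurable lebesgue" by simp
  moreover have "integrable lebesgue (\<lambda>x. \<Sum>j\<in>UNIV. (norm (F x $ j))\<^sup>2)"
    using F by (auto simp: square_integrable_def)
  moreover have "(\<lambda>x. \<Sum>j\<in>UNIV. (norm (F x $ j))\<^sup>2) = (\<lambda>x. (norm (F x))\<^sup>2)"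
    unfolding power2_norm_eq_inner inner_vec_def ..
  ultimately show "square_integrable F" unfolding square_integrable_def by argo
qed

lemma test_function_gradient_square_integrable:
  "\<phi> \<in> test_functions \<Omega> \<Longrightarrow> square_integrable (gradient \<phi>)"
  using test_function_square_integrable[OF test_function_gradient]
  by (auto simp: square_integrable_vec_iff)

lemma test_function_axis_square_integrable:
  fixes \<phi> :: "real^'n \<Rightarrow> real" and j :: 'n
  shows "\<phi> \<in> test_functions \<Omega> \<Longrightarrow> square_integrable (\<lambda>x. \<phi> x *\<^sub>R axis j (1::real))"
  using test_function_square_integrable[of \<phi> \<Omega>]
  by (auto simp: square_integrable_vec_iff axis_def square_integrable_zero)

lemma test_function_Lipschitz:
  assumes \<phi>: "\<phi> \<in> test_functions \<Omega>"
  obtains B where "\<And>x y. \<bar>\<phi> x - \<phi> y\<bar> \<le> B * norm (x - y)"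
proof -
  let ?S = "closure {x. \<phi> x \<noteq> 0}"
  have comp: "\<exists>B. \<forall>x. \<bar>gradient \<phi> x $ j\<bar> \<le> B" for j
  proof -
    have "continuous_on UNIV (\<lambda>x. gradient \<phi> x $ j)"
      using test_functionD(3)[OF test_function_gradient[OF \<phi>]] .
    then have "compact ((\<lambda>x. gradient \<phi> x $ j) ` ?S)"
      using test_functionD(4)[OF \<phi>] by (meson compact_continuous_image continuous_on_subset subset_UNIV)
    then have "bounded ((\<lambda>x. gradient \<phi> x $ j) ` ?S)" by (rule compact_imp_bounded)
    then obtain B where "\<forall>y\<in>(\<lambda>x. gradient \<phi> x $ j) ` ?S. norm y \<le> B"
      unfolding bounded_iff by blast
    then have B: "\<bar>gradient \<phi> x $ j\<bar> \<le> B" if "x \<in> ?S" for x using that by simp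
    have "\<bar>gradient \<phi> x $ j\<bar> \<le> max B 0" for x
      using B[of x] gradient_test_function_eq_0[OF \<phi>, of x] by (cases "x \<in> ?S") auto
    then show ?thesis by blast
  qed
  then obtain b where b: "\<And>j x. \<bar>gradient \<phi> x $ j\<bar> \<le> b j" by metis
  let ?B = "\<Sum>j\<in>UNIV. b j"
  have "norm (gradient \<phi> x) \<le> ?B" for x
    using norm_le_l1_cart[of "gradient \<phi> x"] sum_mono[of UNIV "\<lambda>j. \<bar>gradient \<phi> x $ j\<bar>" b] b
    by (auto intro: order_trans)
  then have on: "onorm (\<lambda>h. gradient \<phi> x \<bullet> h) \<le> ?B" for x
    by (intro onorm_bound order_trans[OF Cauchy_Schwarz_ineq2[of "gradient \<phi> x", folded real_norm_def]]
        mult_right_mono order_trans[OF norm_ge_zero]) auto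
  have "norm (\<phi> x - \<phi> y) \<le> ?B * norm (x - y)" for x y
    by (rule differentiable_bound[OF convex_UNIV _ on])
      (use has_derivative_gradient[OF test_functionD(2)[OF \<phi>]] in auto)
  then show thesis using that[of ?B] by simp
qed

text \<open>
  The integrals of the difference quotients vanish because Lebesgue measure is translation
  invariant, and they converge to the integral of the derivative: \<open>\<phi>\<close> is Lipschitz, so the quotients with
  step at most \<open>1\<close> are bounded and live on a common ball.
\<close>

lemma integral_partial_derivative_eq_0:
  assumes \<phi>: "\<phi> \<in> test_functions \<Omega>"
  shows "(LINT x|lborel. gradient \<phi> x $ j) = 0"
proof -
  obtain B where B: "\<And>x y. \<bar>\<phi> x - \<phi> y\<bar> \<le> B * norm (x - y)"
    by (rule test_function_Lipschitz[OF \<phi>]) blast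
  let ?e = "axis j 1 :: real^'a"
  obtain R where R: "\<And>x. x \<in> closure {x. \<phi> x \<noteq> 0} \<Longrightarrow> norm x \<le> R"
    using compact_imp_bounded[OF test_functionD(4)[OF \<phi>]] by (auto simp: bounded_iff)
  have outside: "\<phi> y = 0" if "R < norm y" for y
    using R[of y] that by (intro test_function_eq_0[OF \<phi>]) linarith
  define h where "h n = 1 / real (Suc n)" for n
  have h: "0 < h n" "h n \<le> 1" for n by (auto simp: h_def)
  define q where "q n x = (\<phi> (x + h n *\<^sub>R ?e) - \<phi> x) / h n" for n x
  have meas: "\<phi> \<in> borel_measurable borel"
    using test_functionD(3)[OF \<phi>] by (rule borel_measurable_continuous_onI)
  have shift: "integrable lborel (\<lambda>x. \<phi> (x + a))" "(LINT x|lborel. \<phi> (x + a)) = integral\<^sup>L lborel \<phi>"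
    for a
    using integrable_distr_eq[of "(+) a" lborel borel \<phi>] integral_distr[of "(+) a" lborel borel \<phi>]
      test_function_integrable[OF \<phi>] meas
    by (simp_all add: lborel_distr_plus add.commute)
  have q0: "integral\<^sup>L lborel (q n) = 0" for n
    unfolding q_def using shift test_function_integrable[OF \<phi>] by simp
  have "(\<lambda>n. integral\<^sup>L lborel (q n)) \<longlonglongrightarrow> (LINT x|lborel. gradient \<phi> x $ j)"
  proof (rule integral_dominated_convergence)
    show "(\<lambda>x. gradient \<phi> x $ j) \<in> borel_measurable lborel"
      using test_functionD(3)[OF test_function_gradient[OF \<phi>, of j]]
      by (simp add: borel_measurable_continuous_onI)
    show "q n \<in> borel_measurable lborel" for n
      unfolding q_def using meas by measurable
    have "integrable lborel (\<lambda>x::real^'a. indicator (cball 0 (R + 1)) x *\<^sub>R B)"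
      by (rule borel_integrable_compact) auto
    then show "integrable lborel (\<lambda>x::real^'a. indicator (cball 0 (R + 1)) x * B)" by simp
    show "AE x in lborel. norm (q n x) \<le> indicator (cball 0 (R + 1)) x * B" for n
    proof (rule AE_I2)
      fix x
      have "norm (h n *\<^sub>R ?e) \<le> 1" using h[of n] by (simp add: norm_axis_1)
      then have far: "norm (x + h n *\<^sub>R ?e) > R" if "x \<notin> cball 0 (R + 1)"
        using that norm_triangle_ineq2[of x "- (h n *\<^sub>R ?e)"] by (simp)
      show "norm (q n x) \<le> indicator (cball 0 (R + 1)) x * B"
      proof (cases "x \<in> cball 0 (R + 1)")
        case True
        have "\<bar>\<phi> (x + h n *\<^sub>R ?e) - \<phi> x\<bar> \<le> B * h n"
          using B[of "x + h n *\<^sub>R ?e" x] h[of n] by (simp add: norm_axis_1)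
        then show ?thesis using True h[of n] by (simp add: q_def field_simps)
      next
        case False
        then have "R < norm x" by simp
        then have "\<phi> (x + h n *\<^sub>R ?e) = 0" "\<phi> x = 0"
          using outside far[OF False] by blast+
        then show ?thesis using False by (simp add: q_def)
      qed
    qed
    show "AE x in lborel. (\<lambda>n. q n x) \<longlonglongrightarrow> gradient \<phi> x $ j"
    proof (rule AE_I2)
      fix x
      have "((\<lambda>t. \<phi> (x + t *\<^sub>R ?e)) has_derivative (\<lambda>t. gradient \<phi> x \<bullet> (t *\<^sub>R ?e))) (at 0)"
      proof (rule has_derivative_compose[where g = \<phi> and f = "\<lambda>t. x + t *\<^sub>R ?e"
            and f' = "\<lambda>t. t *\<^sub>R ?e" and g' = "\<lambda>h. gradient \<phi> x \<bullet> h"])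
        show "((\<lambda>t. x + t *\<^sub>R ?e) has_derivative (\<lambda>t. t *\<^sub>R ?e)) (at 0)"
          using has_derivative_add[OF has_derivative_const
              has_derivative_scaleR_left[OF has_derivative_ident]] by simp
        show "(\<phi> has_derivative (\<lambda>h. gradient \<phi> x \<bullet> h)) (at (x + 0 *\<^sub>R ?e))"
          using has_derivative_gradient[OF test_functionD(2)[OF \<phi>]] by simp
      qed
      then have "((\<lambda>t. \<phi> (x + t *\<^sub>R ?e)) has_field_derivative gradient \<phi> x $ j) (at 0)"
        unfolding has_field_derivative_def by (simp add: inner_axis mult.commute[of _ "gradient \<phi> x $ j"])
      then have lim: "(\<lambda>t. (\<phi> (x + t *\<^sub>R ?e) - \<phi> x) / t) \<midarrow>0\<rightarrow> gradient \<phi> x $ j"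
        by (simp add: DERIV_def)
      have "filterlim h (at 0) sequentially"
        unfolding filterlim_at h_def using LIMSEQ_Suc[OF lim_1_over_n] by auto
      from filterlim_compose[OF lim this] show "(\<lambda>n. q n x) \<longlonglongrightarrow> gradient \<phi> x $ j"
        by (simp add: q_def)
    qed
  qed
  then show ?thesis by (simp add: q0 LIMSEQ_const_iff)
qed

lemma integration_by_parts_test_functions:
  assumes \<phi>: "\<phi> \<in> test_functions \<Omega>" and \<psi>: "\<psi> \<in> test_functions \<Omega>'"
  shows "(LINT x|lborel. \<phi> x * gradient \<psi> x $ j) = - (LINT x|lborel. gradient \<phi> x $ j * \<psi> x)"
proof -
  note d = \<phi>[THEN test_functionD(1)] and d' = \<psi>[THEN test_functionD(1)]
  have "0 = (LINT x|lborel. gradient (\<lambda>x. \<psi> x * \<phi> x) x $ j)"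
    using integral_partial_derivative_eq_0[OF test_function_mult[OF \<phi> d']] by simp
  also have "\<dots> = (LINT x|lborel. \<phi> x * gradient \<psi> x $ j + gradient \<phi> x $ j * \<psi> x)"
    using \<phi>[THEN test_functionD(2)] \<psi>[THEN test_functionD(2)]
    by (simp add: gradient_mult mult.commute add.commute)
  also have "\<dots> = (LINT x|lborel. \<phi> x * gradient \<psi> x $ j) + (LINT x|lborel. gradient \<phi> x $ j * \<psi> x)"
  proof (rule Bochner_Integration.integral_add)
    show "integrable lborel (\<lambda>x. \<phi> x * gradient \<psi> x $ j)"
      by (rule test_function_integrable[OF test_function_mult[OF test_function_gradient[OF \<psi>] d]])
    show "integrable lborel (\<lambda>x. gradient \<phi> x $ j * \<psi> x)"
      by (rule test_function_integrable[OF test_function_mult[OF \<psi>]])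
        (rule test_functionD(1)[OF test_function_gradient[OF \<phi>]])
  qed
  finally show ?thesis by simp
qed

section \<open>The fundamental lemma of the calculus of variations\<close>

lemma flat_tendsto_0:
  assumes c: "0 < c"
  shows "((\<lambda>t::real. exp (- c / t) / t ^ k) \<longlongrightarrow> 0) (at_right 0)"
proof -
  have "filterlim (\<lambda>t. c * inverse t) at_top (at_right 0)"
    using c filterlim_inverse_at_top_right by (intro filterlim_tendsto_pos_mult_at_top[OF tendsto_const])
  from filterlim_compose[OF tendsto_power_div_exp_0[of k] this]
  have "((\<lambda>t. (c * inverse t) ^ k / exp (c * inverse t) / c ^ k) \<longlongrightarrow> 0 / c ^ k) (at_right 0)"
    using c by (intro tendsto_divide tendsto_const) auto
  moreover have "(\<lambda>t. (c * inverse t) ^ k / exp (c * inverse t) / c ^ k) = (\<lambda>t. exp (- c / t) / t ^ k)"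
    using c by (auto simp: fun_eq_iff exp_minus field_simps power_mult_distrib)
  ultimately show ?thesis by simp
qed

text \<open>
  The classical smooth function that is flat at \<open>0\<close>, divided by powers of its argument. The powers
  are there because the family is then closed under differentiation up to linear
  combinations, which makes smoothness a plain induction. The parameter \<open>c\<close> will tend to \<open>0\<close>, and
  then \<open>flat c 0\<close> tends to the indicator of the positive half-line.
\<close>

definition flat :: "real \<Rightarrow> nat \<Rightarrow> real \<Rightarrow> real" where
  "flat c k t = (if t \<le> 0 then 0 else exp (- c / t) / t ^ k)"

lemma flat_has_derivative:
  assumes c: "0 < c"
  shows "(flat c k has_field_derivative c * flat c (k + 2) t - real k * flat c (k + 1) t) (at t)"
proof -
  consider "t < 0" | "t = 0" | "0 < t" by linarith
  then show ?thesis
  proof cases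
    case 1
    have "((\<lambda>t. 0) has_field_derivative 0) (at t)" by simp
    then have "(flat c k has_field_derivative 0) (at t)"
      by (rule has_field_derivative_transform_within_open[of _ _ _ "{..<0}"])
        (use 1 in \<open>auto simp: flat_def\<close>)
    then show ?thesis using 1 by (simp add: flat_def)
  next
    case 2
    \<comment> \<open>The difference quotient of \<open>flat c k\<close> at \<open>0\<close> is \<open>flat c (k + 1)\<close>.\<close>
    have "((\<lambda>t. flat c (k + 1) t) \<longlongrightarrow> 0) (at 0)"
    proof (rule filterlim_split_at)
      show "(flat c (k + 1) \<longlongrightarrow> 0) (at_left 0)"
        by (rule tendsto_eventually) (auto simp: flat_def eventually_at_filter)
      show "(flat c (k + 1) \<longlongrightarrow> 0) (at_right 0)"
        using flat_tendsto_0[OF c, of "k + 1"]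
        by (rule Lim_transform_eventually) (auto simp: flat_def eventually_at_filter)
    qed
    then have "((\<lambda>h. (flat c k (0 + h) - flat c k 0) / h) \<longlongrightarrow> 0) (at 0)"
      by (rule Lim_transform_eventually) (auto simp: flat_def eventually_at_filter)
    then show ?thesis using 2 by (simp add: DERIV_def flat_def)
  next
    case 3
    have "((\<lambda>t. exp (- c / t) / t ^ k) has_field_derivative
        c * (exp (- c / t) / t ^ (k + 2)) - real k * (exp (- c / t) / t ^ (k + 1))) (at t)"
      using 3 by (cases k) (auto intro!: derivative_eq_intros simp: field_simps power2_eq_square,
          metis One_nat_def power_eq_if)
    then have "(flat c k has_field_derivative
        c * (exp (- c / t) / t ^ (k + 2)) - real k * (exp (- c / t) / t ^ (k + 1))) (at t)"
      by (rule has_field_derivative_transform_within_open[of _ _ _ "{0<..}"])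
        (use 3 in \<open>auto simp: flat_def\<close>)
    then show ?thesis using 3 by (simp add: flat_def)
  qed
qed

lemma flat_bounds: "0 < c \<Longrightarrow> 0 \<le> flat c 0 t" "0 < c \<Longrightarrow> flat c 0 t \<le> 1"
  by (auto simp: flat_def)

lemma flat_tendsto_indicator:
  "(\<lambda>m. flat (1 / real (Suc m)) 0 t) \<longlonglongrightarrow> (if 0 < t then 1 else 0)"
proof (cases "0 < t")
  case True
  have "(\<lambda>m. exp (- (1 / real (Suc m)) / t)) \<longlonglongrightarrow> exp (- 0 / t)"
    using True by (intro tendsto_intros LIMSEQ_Suc[OF lim_1_over_n]) auto
  then show ?thesis using True by (simp add: flat_def)
qed (simp add: flat_def)

lemma continuously_differentiable_flat:
  assumes c: "0 < c"
  shows "continuously_differentiable m (\<lambda>x::real^'n. flat c k (a * (x $ i) + b))"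
proof (induction m arbitrary: k)
  case 0
  have "continuous_on UNIV (flat c k)"
    by (rule DERIV_continuous_on) (rule flat_has_derivative[OF c, THEN has_field_derivative_at_within])
  then show ?case
    by (auto intro!: continuous_intros continuous_on_compose2[of UNIV "flat c k"])
next
  case (Suc m)
  let ?f = "\<lambda>x::real^'n. flat c k (a * (x $ i) + b)"
  let ?d = "\<lambda>x::real^'n. a * (c * flat c (k + 2) (a * (x $ i) + b) + - real k * flat c (k + 1) (a * (x $ i) + b))"
  have der: "(?f has_derivative (\<lambda>h. axis i (?d x) \<bullet> h)) (at x)" for x
  proof -
    have "((\<lambda>x. a * (x $ i) + b) has_derivative (\<lambda>h. a * (h $ i))) (at x)"
      by (auto intro!: derivative_eq_intros bounded_linear.has_derivative[OF bounded_linear_vec_nth])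
    from has_derivative_compose[OF this flat_has_derivative[OF c, unfolded has_field_derivative_def]]
    show ?thesis by (simp add: inner_axis' algebra_simps)
  qed
  have grad: "gradient ?f x = axis i (?d x)" for x by (rule gradient_eqI[OF der])
  have "?f differentiable_on UNIV"
    using der by (auto simp: differentiable_on_def differentiable_def)
  moreover have "continuously_differentiable m (\<lambda>x. gradient ?f x $ j)" for j
  proof (cases "j = i")
    case True
    have "continuously_differentiable m ?d"
      by (intro continuously_differentiable_mult continuously_differentiable_add
          continuously_differentiable_const Suc.IH)
    then show ?thesis using True unfolding grad by (simp add: axis_def)
  next
    case False
    then show ?thesis
      unfolding grad using continuously_differentiable_const[of m 0] by (simp add: axis_def)
  qed
  ultimately show ?case by simp
qed

definition bump :: "real \<Rightarrow> real^'n \<Rightarrow> real^'n \<Rightarrow> real^'n \<Rightarrow> real" where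
  "bump c a b x = (\<Prod>i\<in>UNIV. flat c 0 (x $ i - a $ i) * flat c 0 (b $ i - x $ i))"

lemma bump_eq_0: "x \<notin> box a b \<Longrightarrow> bump c a b x = 0"
  by (auto simp: bump_def mem_box_cart flat_def not_less)

lemma bump_bounds:
  assumes "0 < c" shows "0 \<le> bump c a b x" "bump c a b x \<le> 1"
  unfolding bump_def using flat_bounds[OF assms]
  by (auto intro!: prod_nonneg prod_le_1 mult_le_one mult_nonneg_nonneg)

lemma bump_tendsto_indicator:
  "(\<lambda>m. bump (1 / real (Suc m)) a b x) \<longlonglongrightarrow> indicator (box a b) x"
proof -
  have "(\<lambda>m. bump (1 / real (Suc m)) a b x) \<longlonglongrightarrow>
      (\<Prod>i\<in>UNIV. (if 0 < x $ i - a $ i then 1 else 0) * (if 0 < b $ i - x $ i then 1 else 0))"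
    unfolding bump_def by (intro tendsto_prod tendsto_mult flat_tendsto_indicator)
  also have "(\<Prod>i\<in>UNIV. (if 0 < x $ i - a $ i then 1 else 0) * (if 0 < b $ i - x $ i then 1 else 0))
      = (indicator (box a b) x :: real)"
    by (auto simp: indicator_def mem_box_cart)
  finally show ?thesis .
qed

lemma bump_test_function:
  assumes c: "0 < c" and sub: "cbox a b \<subseteq> \<Omega>"
  shows "bump c a b \<in> test_functions \<Omega>"
proof (rule test_functionI)
  show "compact (cbox a b)" by (rule compact_cbox)
  show "bump c a b x = 0" if "x \<notin> cbox a b" for x
    using that box_subset_cbox[of a b] by (intro bump_eq_0) auto
  show "continuously_differentiable k (bump c a b)" for k
    unfolding bump_def[abs_def]
    using continuously_differentiable_flat[OF c, of k 0 1 _ "- a $ _"]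
      continuously_differentiable_flat[OF c, of k 0 "-1"]
    by (intro continuously_differentiable_prod continuously_differentiable_mult)
      (auto simp: algebra_simps)
qed (rule sub)

lemma square_integrable_integrable_on_cbox:
  fixes f :: "'a::euclidean_space \<Rightarrow> real"
  assumes f: "square_integrable f"
  shows "set_integrable lebesgue (cbox a b) f"
  unfolding set_integrable_def
proof (rule Bochner_Integration.integrable_bound)
  have "integrable lborel (\<lambda>x. indicator (cbox a b) x *\<^sub>R (1::real))"
    by (rule borel_integrable_compact) auto
  then have "integrable lebesgue (\<lambda>x. indicator (cbox a b) x :: real)"
    by (simp add: integrable_completion)
  then show "integrable lebesgue (\<lambda>x. (norm (f x))\<^sup>2 + indicator (cbox a b) x)"
    using f by (auto simp: square_integrable_def)
  have "f \<in> borel_measurable lebesgue" using f by (simp add: square_integrable_def)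
  then show "(\<lambda>x. indicator (cbox a b) x *\<^sub>R f x) \<in> borel_measurable lebesgue"
    by (intro borel_measurable_scaleR borel_measurable_indicator fmeasurableD lmeasurable_cbox)
  have "\<bar>f x\<bar> \<le> (f x)\<^sup>2 + 1" for x
    using zero_le_power2[of "\<bar>f x\<bar> - 1/2"] by (simp add: power2_eq_square algebra_simps)
  then show "AE x in lebesgue. norm (indicator (cbox a b) x *\<^sub>R f x)
      \<le> norm ((norm (f x))\<^sup>2 + indicator (cbox a b) x)"
    by (auto simp: indicator_def)
qed

text \<open>
  Lebesgue differentiation: at almost every \<open>x\<close> the averages of \<open>f\<close> over the cubes with lower corner
  \<open>x\<close> converge to \<open>f x\<close>, and the small cubes lie in \<open>\<Omega>\<close>.
\<close>

lemma AE_eq_0_if_integral_cboxes_eq_0: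
  fixes f :: "'a::euclidean_space \<Rightarrow> real"
  assumes \<Omega>: "open \<Omega>" and f: "\<And>a b. f integrable_on cbox a b"
    and 0: "\<And>a b. cbox a b \<subseteq> \<Omega> \<Longrightarrow> integral (cbox a b) f = 0"
  shows "AE x in lebesgue. x \<in> \<Omega> \<longrightarrow> f x = 0"
proof -
  obtain N where N: "negligible N"
    and lim: "\<And>x e. x \<notin> N \<Longrightarrow> 0 < e \<Longrightarrow> \<exists>d>0. \<forall>h. 0 < h \<and> h < d \<longrightarrow>
      norm (integral (cbox x (x + h *\<^sub>R One)) f /\<^sub>R h ^ DIM('a) - f x) < e"
    using integrable_ccontinuous_explicit[OF f] by blast
  have "f x = 0" if x: "x \<in> \<Omega>" "x \<notin> N" for x
  proof (rule ccontr)
    assume "f x \<noteq> 0"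
    then obtain d where d: "d > 0" "\<And>h. 0 < h \<Longrightarrow> h < d \<Longrightarrow>
        norm (integral (cbox x (x + h *\<^sub>R One)) f /\<^sub>R h ^ DIM('a) - f x) < \<bar>f x\<bar>"
      using lim[OF x(2), of "\<bar>f x\<bar>"] by auto
    obtain r where r: "r > 0" "ball x r \<subseteq> \<Omega>" using \<Omega> x(1) open_contains_ball by blast
    define h where "h = min (d / 2) (r / (2 * DIM('a)))"
    have h: "0 < h" "h < d" "DIM('a) * h < r"
    proof -
      show "0 < h" "h < d" using d r by (auto simp: h_def)
      have "DIM('a) * h \<le> DIM('a) * (r / (2 * DIM('a)))"
        by (intro mult_left_mono) (auto simp: h_def)
      also have "\<dots> < r" using r by simp
      finally show "DIM('a) * h < r" .
    qed
    have "cbox x (x + h *\<^sub>R One) \<subseteq> ball x r"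
    proof
      fix y assume y: "y \<in> cbox x (x + h *\<^sub>R One)"
      have "norm (y - x) \<le> (\<Sum>b\<in>Basis. \<bar>(y - x) \<bullet> b\<bar>)" by (rule norm_le_l1)
      also have "\<dots> \<le> (\<Sum>b\<in>(Basis::'a set). h)"
        using y by (intro sum_mono) (auto simp: mem_box inner_diff_left inner_add_left)
      finally show "y \<in> ball x r" using h(3) by (simp add: dist_norm norm_minus_commute)
    qed
    then have "integral (cbox x (x + h *\<^sub>R One)) f = 0" using r by (intro 0) auto
    then show False using d(2)[OF h(1,2)] by simp
  qed
  moreover have "AE x in lebesgue. x \<notin> N"
    using N by (intro AE_not_in) (simp add: negligible_iff_null_sets)
  ultimately show ?thesis by (auto elim: eventually_mono)
qed

text \<open>
  Bumps that increase to the indicator of a box turn orthogonality to test functions into the vanishing of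
  all integrals over boxes inside \<open>\<Omega>\<close>.
\<close>

theorem fundamental_lemma_of_variations:
  fixes f :: "real^'n \<Rightarrow> real"
  assumes \<Omega>: "open \<Omega>" and f: "square_integrable f"
    and 0: "\<And>\<phi>. \<phi> \<in> test_functions \<Omega> \<Longrightarrow> (\<integral>x. f x * \<phi> x \<partial>lebesgue) = 0"
  shows "AE x in lebesgue. x \<in> \<Omega> \<longrightarrow> f x = 0"
proof (rule AE_eq_0_if_integral_cboxes_eq_0[OF \<Omega>])
  note int = square_integrable_integrable_on_cbox[OF f]
  show "f integrable_on cbox a b" for a b
    by (rule set_lebesgue_integral_eq_integral(1)[OF int])
  show "integral (cbox a b) f = 0" if sub: "cbox a b \<subseteq> \<Omega>" for a b
  proof -
    have m: "f \<in> borel_measurable lebesgue" using f by (simp add: square_integrable_def)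
    let ?b = "\<lambda>m. bump (1 / real (Suc m)) a b"
    have test: "?b m \<in> test_functions \<Omega>" for m by (rule bump_test_function[OF _ sub]) simp
    have "(\<lambda>m. \<integral>x. f x * ?b m x \<partial>lebesgue) \<longlonglongrightarrow> (\<integral>x. f x * indicator (box a b) x \<partial>lebesgue)"
    proof (rule integral_dominated_convergence)
      show "integrable lebesgue (\<lambda>x. norm (indicator (cbox a b) x *\<^sub>R f x))"
        using int[of a b] unfolding set_integrable_def by (rule integrable_norm)
      show "(\<lambda>x. f x * indicator (box a b) x) \<in> borel_measurable lebesgue"
        by (intro borel_measurable_times borel_measurable_indicator m fmeasurableD lmeasurable_box)
      show "(\<lambda>x. f x * ?b m x) \<in> borel_measurable lebesgue" for m
        using m test_function_square_integrable[OF test[of m]]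
        by (auto simp: square_integrable_def)
      show "AE x in lebesgue. (\<lambda>m. f x * ?b m x) \<longlonglongrightarrow> f x * indicator (box a b) x"
        by (intro AE_I2 tendsto_mult tendsto_const bump_tendsto_indicator)
      show "AE x in lebesgue. norm (f x * ?b m x) \<le> norm (indicator (cbox a b) x *\<^sub>R f x)" for m
      proof (rule AE_I2)
        fix x
        show "norm (f x * ?b m x) \<le> norm (indicator (cbox a b) x *\<^sub>R f x)"
        proof (cases "x \<in> box a b")
          case True
          then have "x \<in> cbox a b" using box_subset_cbox by blast
          moreover have "\<bar>f x\<bar> * \<bar>?b m x\<bar> \<le> \<bar>f x\<bar> * 1"
            using bump_bounds[of "1 / real (Suc m)" a b x] by (intro mult_left_mono) auto
          ultimately show ?thesis by (simp add: abs_mult)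
        qed (simp add: bump_eq_0)
      qed
    qed
    then have "(\<integral>x. f x * indicator (box a b) x \<partial>lebesgue) = 0"
      by (simp add: 0[OF test] LIMSEQ_const_iff del: of_nat_Suc)
    moreover have "set_integrable lebesgue (box a b) f"
      by (rule set_integrable_subset[OF int[of a b]]) (auto simp: box_subset_cbox)
    then have "(LINT x:box a b|lebesgue. f x) = integral (box a b) f"
      by (rule set_lebesgue_integral_eq_integral(2))
    ultimately have "integral (box a b) f = 0"
      by (simp add: set_lebesgue_integral_def mult.commute)
    then show ?thesis by (simp add: integral_open_interval)
  qed
qed

section \<open>Weak gradients and the space H10\<close>

lemma integral_lebesgue_eq_lborel:
  fixes f :: "'a::euclidean_space \<Rightarrow> real"
  assumes "continuous_on UNIV f"
  shows "integral\<^sup>L lebesgue f = integral\<^sup>L lborel f"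
  by (rule integral_completion) (simp add: borel_measurable_continuous_onI assms)

lemma L2_eq_0_if_orthogonal_to_test_functions:
  fixes h :: "(real^'n, real) l2"
  assumes \<Omega>: "open \<Omega>" and h: "h \<in> L2 \<Omega>"
    and 0: "\<And>\<phi>. \<phi> \<in> test_functions \<Omega> \<Longrightarrow> h \<bullet> abs_l2 \<phi> = 0"
  shows "h = 0"
proof -
  obtain f where f: "square_integrable f" "h = abs_l2 f" by (rule l2_cases)
  have "AE x in lebesgue. x \<in> \<Omega> \<longrightarrow> f x = 0"
  proof (rule fundamental_lemma_of_variations[OF \<Omega> f(1)])
    fix \<phi> assume \<phi>: "\<phi> \<in> test_functions \<Omega>"
    show "(\<integral>x. f x * \<phi> x \<partial>lebesgue) = 0"
      using 0[OF \<phi>] test_function_square_integrable[OF \<phi>] f by (simp add: inner_abs_l2)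
  qed
  moreover have "AE x in lebesgue. x \<notin> \<Omega> \<longrightarrow> f x = 0"
    using h f by (simp add: L2_def vanishes_off.abs_eq)
  ultimately have "AE x in lebesgue. f x = 0" by eventually_elim auto
  then show ?thesis
    unfolding f(2) zero_l2_def using f(1) by (simp add: abs_l2_eq_iff square_integrable_zero)
qed

lemma L2_vec_eq_0_if_orthogonal_to_test_functions:
  fixes h :: "(real^'n, real^'n) l2"
  assumes \<Omega>: "open \<Omega>" and h: "h \<in> L2 \<Omega>"
    and 0: "\<And>\<phi> j. \<phi> \<in> test_functions \<Omega> \<Longrightarrow> h \<bullet> abs_l2 (\<lambda>x. \<phi> x *\<^sub>R axis j 1) = 0"
  shows "h = 0"
proof -
  obtain f where f: "square_integrable f" "h = abs_l2 f" by (rule l2_cases)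
  have "\<forall>j. AE x in lebesgue. x \<in> \<Omega> \<longrightarrow> f x $ j = 0"
  proof (rule allI, rule fundamental_lemma_of_variations[OF \<Omega>])
    fix j
    show "square_integrable (\<lambda>x. f x $ j)" using f(1) by (simp add: square_integrable_vec_iff)
    fix \<phi> assume \<phi>: "\<phi> \<in> test_functions \<Omega>"
    have "0 = (\<integral>x. f x \<bullet> (\<phi> x *\<^sub>R axis j 1) \<partial>lebesgue)"
      using 0[OF \<phi>, of j] inner_abs_l2[OF f(1) test_function_axis_square_integrable[OF \<phi>]] f(2)
      by simp
    then show "(\<integral>x. f x $ j * \<phi> x \<partial>lebesgue) = 0"
      by (simp add: inner_axis mult.commute)
  qed
  then have "AE x in lebesgue. \<forall>j\<in>UNIV. x \<in> \<Omega> \<longrightarrow> f x $ j = 0"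
    by (intro AE_finite_allI) auto
  moreover have "AE x in lebesgue. x \<notin> \<Omega> \<longrightarrow> f x = 0"
    using h f by (simp add: L2_def vanishes_off.abs_eq)
  ultimately have "AE x in lebesgue. f x = 0"
    by eventually_elim (auto simp: vec_eq_iff)
  then show ?thesis
    unfolding f(2) zero_l2_def using f(1) by (simp add: abs_l2_eq_iff square_integrable_zero)
qed

text \<open>
  Working with graphs turns statements about the partial operation \<^term>\<open>grad \<Omega>\<close> into statements about
  closed subspaces of a product space.
\<close>

definition weak_gradient_graph ::
  "(real^'n) set \<Rightarrow> ((real^'n, real) l2 \<times> (real^'n, real^'n) l2) set" where
  "weak_gradient_graph \<Omega> = {(v, w). v \<in> L2 \<Omega> \<and> w \<in> L2 \<Omega> \<and> weak_gradient \<Omega> v w}"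

lemma closed_weak_gradient_graph:
  fixes \<Omega> :: "(real^'n) set"
  assumes "open \<Omega>"
  shows "closed (weak_gradient_graph \<Omega>)"
proof -
  have \<Omega>: "\<Omega> \<in> sets lebesgue" using assms by (simp add: borel_open)
  have iff: "v \<bullet> a = - (w \<bullet> b) \<longleftrightarrow> (a, b) \<bullet> (v, w) = 0"
    for v a :: "(real^'n, real) l2" and w b :: "(real^'n, real^'n) l2"
    by (simp add: inner_commute[of v a] inner_commute[of w b] eq_neg_iff_add_eq_0)
  have "weak_gradient_graph \<Omega> = (L2 \<Omega> \<times> L2 \<Omega>) \<inter> (\<Inter>\<phi>\<in>test_functions \<Omega>. \<Inter>j.
      {z. (abs_l2 (\<lambda>x. gradient \<phi> x $ j), abs_l2 (\<lambda>x. \<phi> x *\<^sub>R axis j 1)) \<bullet> z = 0})"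
    unfolding weak_gradient_graph_def weak_gradient_def iff by auto
  moreover have "closed \<dots>"
    by (intro closed_Int closed_Times closed_L2[OF \<Omega>] closed_INT ballI closed_hyperplane)
  ultimately show ?thesis by simp
qed

lemma weak_gradient_unique:
  assumes \<Omega>: "open \<Omega>" and w: "(v, w) \<in> weak_gradient_graph \<Omega>" "(v, w') \<in> weak_gradient_graph \<Omega>"
  shows "w = w'"
proof -
  have "w - w' = 0"
  proof (rule L2_vec_eq_0_if_orthogonal_to_test_functions[OF \<Omega>])
    show "w - w' \<in> L2 \<Omega>"
      using w by (auto simp: weak_gradient_graph_def intro: subspace_diff[OF subspace_L2])
    show "(w - w') \<bullet> abs_l2 (\<lambda>x. \<phi> x *\<^sub>R axis j 1) = 0" if "\<phi> \<in> test_functions \<Omega>" for \<phi> j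
      using w that unfolding weak_gradient_graph_def weak_gradient_def
      by (simp add: inner_diff_left)
  qed
  then show ?thesis by simp
qed

lemma grad_eqI:
  assumes "open \<Omega>" and w: "(v, w) \<in> weak_gradient_graph \<Omega>"
  shows "grad \<Omega> v = w"
  unfolding grad_def
proof (rule the_equality)
  show "w \<in> L2 \<Omega> \<and> weak_gradient \<Omega> v w" using w by (simp add: weak_gradient_graph_def)
  show "w' = w" if "w' \<in> L2 \<Omega> \<and> weak_gradient \<Omega> v w'" for w'
    using weak_gradient_unique[OF assms(1) _ w, of w'] that w by (auto simp: weak_gradient_graph_def)
qed

definition test_graph ::
  "(real^'n) set \<Rightarrow> ((real^'n, real) l2 \<times> (real^'n, real^'n) l2) set" where
  "test_graph \<Omega> = (\<lambda>\<phi>. (abs_l2 \<phi>, abs_l2 (gradient \<phi>))) ` test_functions \<Omega>"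

lemma subspace_test_graph:
  fixes \<Omega> :: "(real^'n) set"
  shows "subspace (test_graph \<Omega>)"
proof (rule subspaceI)
  have "0 = (abs_l2 (\<lambda>x::real^'n. 0::real), abs_l2 (gradient (\<lambda>x::real^'n. 0)))"
    by (simp add: zero_l2_def zero_prod_def gradient_const[abs_def])
  moreover have "(\<lambda>x. 0) \<in> test_functions \<Omega>"
    by (rule test_functionI[of _ "{}"]) (auto intro: continuously_differentiable_const)
  ultimately show "0 \<in> test_graph \<Omega>" unfolding test_graph_def by (rule image_eqI)
next
  fix x y assume "x \<in> test_graph \<Omega>" "y \<in> test_graph \<Omega>"
  then obtain \<phi> \<psi> where \<phi>: "\<phi> \<in> test_functions \<Omega>" "x = (abs_l2 \<phi>, abs_l2 (gradient \<phi>))"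
    and \<psi>: "\<psi> \<in> test_functions \<Omega>" "y = (abs_l2 \<psi>, abs_l2 (gradient \<psi>))"
    by (auto simp: test_graph_def)
  have "gradient (\<lambda>x. \<phi> x + \<psi> x) = (\<lambda>x. gradient \<phi> x + gradient \<psi> x)"
    by (rule ext) (intro gradient_add test_functionD(2)[OF \<phi>(1)] test_functionD(2)[OF \<psi>(1)])
  then have "x + y = (abs_l2 (\<lambda>x. \<phi> x + \<psi> x), abs_l2 (gradient (\<lambda>x. \<phi> x + \<psi> x)))"
    using \<phi> \<psi> by (simp add: plus_l2.abs_eq test_function_square_integrable
        test_function_gradient_square_integrable)
  then show "x + y \<in> test_graph \<Omega>"
    unfolding test_graph_def using test_function_add[OF \<phi>(1) \<psi>(1)] by (rule image_eqI)
next
  fix x and c :: real assume "x \<in> test_graph \<Omega>"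
  then obtain \<phi> where \<phi>: "\<phi> \<in> test_functions \<Omega>" "x = (abs_l2 \<phi>, abs_l2 (gradient \<phi>))"
    by (auto simp: test_graph_def)
  have "gradient (\<lambda>x. c * \<phi> x) = (\<lambda>x. c *\<^sub>R gradient \<phi> x)"
    using gradient_mult[OF _ test_functionD(2)[OF \<phi>(1)], of "\<lambda>x. c"]
    by (auto simp: gradient_const)
  then have "c *\<^sub>R x = (abs_l2 (\<lambda>x. c * \<phi> x), abs_l2 (gradient (\<lambda>x. c * \<phi> x)))"
    using \<phi> by (simp add: scaleR_l2.abs_eq test_function_square_integrable
        test_function_gradient_square_integrable)
  then show "c *\<^sub>R x \<in> test_graph \<Omega>"
    unfolding test_graph_def
    using test_function_mult[OF \<phi>(1) continuously_differentiable_const[of _ c]] by (rule image_eqI)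
qed

text \<open>
  The classical gradient of a test function is its weak gradient, by integration by parts; therefore
  the closure that defines \<^term>\<open>H10 \<Omega>\<close> contains the test functions themselves.
\<close>

lemma test_graph_subset: "test_graph \<Omega> \<subseteq> weak_gradient_graph \<Omega>"
proof
  fix z assume "z \<in> test_graph \<Omega>"
  then obtain \<phi> where \<phi>: "\<phi> \<in> test_functions \<Omega>" "z = (abs_l2 \<phi>, abs_l2 (gradient \<phi>))"
    by (auto simp: test_graph_def)
  note si = test_function_square_integrable[OF \<phi>(1)]
    test_function_gradient_square_integrable[OF \<phi>(1)]
  have out: "\<phi> x = 0" "gradient \<phi> x = 0" if "x \<notin> \<Omega>" for x
  proof -
    have "x \<notin> closure {x. \<phi> x \<noteq> 0}" using that test_functionD(5)[OF \<phi>(1)] by blast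
    then show "\<phi> x = 0" "gradient \<phi> x = 0"
      using test_function_eq_0[OF \<phi>(1)] gradient_test_function_eq_0[OF \<phi>(1)] by blast+
  qed
  have "weak_gradient \<Omega> (abs_l2 \<phi>) (abs_l2 (gradient \<phi>))"
    unfolding weak_gradient_def
  proof (intro ballI allI)
    fix \<psi> j assume \<psi>: "\<psi> \<in> test_functions \<Omega>"
    have cont: "continuous_on UNIV (\<lambda>x. \<phi> x * gradient \<psi> x $ j)"
        "continuous_on UNIV (\<lambda>x. gradient \<phi> x $ j * \<psi> x)"
      by (intro continuous_on_mult test_functionD(3)[OF \<phi>(1)] test_functionD(3)[OF \<psi>]
          test_functionD(3)[OF test_function_gradient[OF \<phi>(1)]]
          test_functionD(3)[OF test_function_gradient[OF \<psi>]])+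
    have "abs_l2 \<phi> \<bullet> abs_l2 (\<lambda>x. gradient \<psi> x $ j) = (LINT x|lborel. \<phi> x * gradient \<psi> x $ j)"
      using si(1) test_function_square_integrable[OF test_function_gradient[OF \<psi>]]
      by (simp add: inner_abs_l2 integral_lebesgue_eq_lborel[OF cont(1)])
    also have "\<dots> = - (LINT x|lborel. gradient \<phi> x $ j * \<psi> x)"
      by (rule integration_by_parts_test_functions[OF \<phi>(1) \<psi>])
    also have "\<dots> = - (abs_l2 (gradient \<phi>) \<bullet> abs_l2 (\<lambda>x. \<psi> x *\<^sub>R axis j 1))"
      using si(2) test_function_axis_square_integrable[OF \<psi>]
      by (simp add: inner_abs_l2 inner_axis integral_lebesgue_eq_lborel[OF cont(2)] mult.commute[of "\<psi> _"])
    finally show "abs_l2 \<phi> \<bullet> abs_l2 (\<lambda>x. gradient \<psi> x $ j)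
        = - (abs_l2 (gradient \<phi>) \<bullet> abs_l2 (\<lambda>x. \<psi> x *\<^sub>R axis j 1))" .
  qed
  then show "z \<in> weak_gradient_graph \<Omega>"
    using si out unfolding \<phi>(2) weak_gradient_graph_def
    by (simp add: L2_def vanishes_off.abs_eq)
qed

text \<open>
  The graph of the weak gradient is closed, so limits of test functions with their gradients are
  automatically functions in \<open>H1\<close> with their weak gradients: membership in \<^term>\<open>H10 \<Omega>\<close> and the value of
  the gradient can both be read off the closure.
\<close>

lemma H10_iff:
  assumes \<Omega>: "open \<Omega>"
  shows "v \<in> H10 \<Omega> \<longleftrightarrow> (\<exists>w. (v, w) \<in> closure (test_graph \<Omega>))"
    and "(v, w) \<in> closure (test_graph \<Omega>) \<Longrightarrow> grad \<Omega> v = w"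
    and "v \<in> H10 \<Omega> \<Longrightarrow> (v, grad \<Omega> v) \<in> closure (test_graph \<Omega>)"
proof -
  have cl: "closure (test_graph \<Omega>) \<subseteq> weak_gradient_graph \<Omega>"
    by (rule closure_minimal[OF test_graph_subset closed_weak_gradient_graph[OF \<Omega>]])
  show grad: "grad \<Omega> v = w" if "(v, w) \<in> closure (test_graph \<Omega>)" for w
    using that cl by (intro grad_eqI[OF \<Omega>]) auto
  show H: "(v, grad \<Omega> v) \<in> closure (test_graph \<Omega>)" if "v \<in> H10 \<Omega>"
    using that by (simp add: H10_def test_graph_def)
  show "v \<in> H10 \<Omega> \<longleftrightarrow> (\<exists>w. (v, w) \<in> closure (test_graph \<Omega>))"
  proof
    assume "\<exists>w. (v, w) \<in> closure (test_graph \<Omega>)"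
    then obtain w where w: "(v, w) \<in> closure (test_graph \<Omega>)" by blast
    then have "v \<in> H1 \<Omega>" using cl by (auto simp: H1_def weak_gradient_graph_def)
    then show "v \<in> H10 \<Omega>" using w grad[OF w] by (simp add: H10_def test_graph_def)
  qed (use H in blast)
qed

lemma H10_closure_subspace: "subspace (closure (test_graph \<Omega>))"
proof (rule subspaceI)
  note S = subspace_test_graph[of \<Omega>]
  show "0 \<in> closure (test_graph \<Omega>)" using subspace_0[OF S] closure_subset by blast
  fix x assume "x \<in> closure (test_graph \<Omega>)"
  then obtain X where X: "\<And>n. X n \<in> test_graph \<Omega>" "X \<longlonglongrightarrow> x"
    by (auto simp: closure_sequential)
  show "c *\<^sub>R x \<in> closure (test_graph \<Omega>)" for c
    unfolding closure_sequential
    using X by (intro exI[of _ "\<lambda>n. c *\<^sub>R X n"]) (auto intro: tendsto_intros subspace_scale[OF S])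
  fix y assume "y \<in> closure (test_graph \<Omega>)"
  then obtain Y where Y: "\<And>n. Y n \<in> test_graph \<Omega>" "Y \<longlonglongrightarrow> y"
    by (auto simp: closure_sequential)
  show "x + y \<in> closure (test_graph \<Omega>)"
    unfolding closure_sequential
    using X Y by (intro exI[of _ "\<lambda>n. X n + Y n"]) (auto intro: tendsto_intros subspace_add[OF S])
qed

lemma
  assumes \<Omega>: "open \<Omega>"
  shows subspace_H10: "subspace (H10 \<Omega>)"
    and grad_add: "u \<in> H10 \<Omega> \<Longrightarrow> v \<in> H10 \<Omega> \<Longrightarrow> grad \<Omega> (u + v) = grad \<Omega> u + grad \<Omega> v"
    and grad_scaleR: "u \<in> H10 \<Omega> \<Longrightarrow> grad \<Omega> (c *\<^sub>R u) = c *\<^sub>R grad \<Omega> u"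
proof -
  note H = H10_iff[OF \<Omega>]
  have add: "(u + v, grad \<Omega> u + grad \<Omega> v) \<in> closure (test_graph \<Omega>)"
    if "u \<in> H10 \<Omega>" "v \<in> H10 \<Omega>" for u v
    using subspace_add[OF H10_closure_subspace H(3)[OF that(1)] H(3)[OF that(2)]] by simp
  have scale: "(c *\<^sub>R u, c *\<^sub>R grad \<Omega> u) \<in> closure (test_graph \<Omega>)" if "u \<in> H10 \<Omega>" for u c
    using subspace_scale[OF H10_closure_subspace H(3)[OF that], of c] by simp
  have zero: "(0, 0) \<in> closure (test_graph \<Omega>)"
    using subspace_0[OF H10_closure_subspace, of \<Omega>] by (simp add: zero_prod_def)
  show "subspace (H10 \<Omega>)"
  proof (rule subspaceI)
    show "0 \<in> H10 \<Omega>" using zero H(1) by blast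
    show "u + v \<in> H10 \<Omega>" if "u \<in> H10 \<Omega>" "v \<in> H10 \<Omega>" for u v using add[OF that] H(1) by blast
    show "c *\<^sub>R u \<in> H10 \<Omega>" if "u \<in> H10 \<Omega>" for u c using scale[OF that] H(1) by blast
  qed
  show "u \<in> H10 \<Omega> \<Longrightarrow> v \<in> H10 \<Omega> \<Longrightarrow> grad \<Omega> (u + v) = grad \<Omega> u + grad \<Omega> v"
    using add by (rule H(2))
  show "u \<in> H10 \<Omega> \<Longrightarrow> grad \<Omega> (c *\<^sub>R u) = c *\<^sub>R grad \<Omega> u"
    using scale by (rule H(2))
qed

lemma grad_in_L2: "open \<Omega> \<Longrightarrow> v \<in> H10 \<Omega> \<Longrightarrow> grad \<Omega> v \<in> L2 \<Omega>"
  using closure_minimal[OF test_graph_subset closed_weak_gradient_graph, of \<Omega>] H10_iff(3)[of \<Omega> v]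
  unfolding weak_gradient_graph_def by blast

lemma test_function_in_H10: "open \<Omega> \<Longrightarrow> \<phi> \<in> test_functions \<Omega> \<Longrightarrow> abs_l2 \<phi> \<in> H10 \<Omega>"
  using H10_iff(1)[of \<Omega> "abs_l2 \<phi>"] closure_subset[of "test_graph \<Omega>"]
  unfolding test_graph_def by blast

text \<open>
  This is what makes the representing function \<^term>\<open>div_plus\<close> of a functional unique.
\<close>

lemma L2_eq_0_if_orthogonal_to_H10:
  assumes "open \<Omega>" "h \<in> L2 \<Omega>" "\<And>v. v \<in> H10 \<Omega> \<Longrightarrow> h \<bullet> v = 0"
  shows "h = 0"
  by (rule L2_eq_0_if_orthogonal_to_test_functions[OF assms(1,2)])
    (rule assms(3)[OF test_function_in_H10[OF assms(1)]])

section \<open>The Hilbert space structure of U\<close>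

lemma uminus_in_L2_iff: "- h \<in> L2 \<Omega> \<longleftrightarrow> h \<in> L2 \<Omega>"
  using subspace_neg[OF subspace_L2, of h \<Omega>] subspace_neg[OF subspace_L2, of "- h" \<Omega>] by auto

text \<open>
  A metric on \<^term>\<open>U \<Omega>\<close> in the sense of \<^locale>\<open>Metric_space\<close> has to be symmetric on all triples, also on those
  where the definite descriptions behind \<^term>\<open>grad\<close> and \<^term>\<open>div_plus\<close> do not denote. If nothing
  satisfies \<open>P\<close>, then both descriptions are \<open>THE w. False\<close>, and their norms agree for that reason.
\<close>

lemma norm_The_uminus:
  fixes P Q :: "'a::real_normed_vector \<Rightarrow> bool"
  assumes PQ: "\<And>w. Q w \<longleftrightarrow> P (- w)" and unique: "\<And>w w'. P w \<Longrightarrow> P w' \<Longrightarrow> w = w'"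
  shows "norm (THE w. Q w) = norm (THE w. P w)"
proof (cases "\<exists>w. P w")
  case True
  then obtain w where w: "P w" by blast
  have "(THE w. P w) = w" using w unique by (intro the_equality) auto
  moreover have "(THE w. Q w) = - w"
    using w unique by (intro the_equality) (auto simp: PQ dest!: unique[OF w])
  ultimately show ?thesis by simp
next
  case False
  then have "P = (\<lambda>w. False)" "Q = (\<lambda>w. False)" using PQ by auto
  then show ?thesis by simp
qed

lemma scaleR_fun_apply: "(c *\<^sub>R l) v = c *\<^sub>R l v"
  by (simp add: scaleR_fun_def)

locale friedrichs_domain =
  fixes \<Omega> :: "(real^'n) set" and C :: real
  assumes open_domain: "open \<Omega>" and friedrichs: "friedrichs_constant \<Omega> C"
begin

lemma domain_measurable: "\<Omega> \<in> sets lebesgue"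
  using open_domain by (simp add: borel_open)

lemma C_pos: "0 < C"
  using friedrichs by (simp add: friedrichs_constant_def)

lemma friedrichs_inequality: "v \<in> H10 \<Omega> \<Longrightarrow> norm v \<le> C * norm (grad \<Omega> v)"
  using friedrichs by (simp add: friedrichs_constant_def)

lemmas H10_subspace = subspace_H10[OF open_domain]
lemmas H10_add = subspace_add[OF H10_subspace]
lemmas H10_diff = subspace_diff[OF H10_subspace]
lemmas H10_scaleR = subspace_scale[OF H10_subspace]
lemmas H10_0 = subspace_0[OF H10_subspace]
lemmas grad_plus = grad_add[OF open_domain]
lemmas grad_scale = grad_scaleR[OF open_domain]

lemma grad_diff: "u \<in> H10 \<Omega> \<Longrightarrow> v \<in> H10 \<Omega> \<Longrightarrow> grad \<Omega> (u - v) = grad \<Omega> u - grad \<Omega> v"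
  using grad_plus[of u "(- 1) *\<^sub>R v"] grad_scale[of v "- 1"] H10_scaleR[of v "- 1"] by simp

lemma inj_on_grad: "inj_on (grad \<Omega>) (H10 \<Omega>)"
proof (rule inj_onI)
  fix u v assume uv: "u \<in> H10 \<Omega>" "v \<in> H10 \<Omega>" "grad \<Omega> u = grad \<Omega> v"
  then have "norm (u - v) \<le> C * 0"
    using friedrichs_inequality[OF H10_diff[OF uv(1,2)]] by (simp add: grad_diff)
  then show "u = v" by simp
qed

text \<open>
  By Friedrichs' inequality, if the gradients converge, then so do the functions, and the closed graph
  identifies the limit. With \<open>S\<close> the whole space this is completeness of the space of gradients; with
  \<open>S = {v. v \<ge> g}\<close> it is closedness of the constraint of the obstacle problem.
\<close>

lemma closed_grad_image:
  assumes S: "closed S"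
  shows "closed (grad \<Omega> ` (H10 \<Omega> \<inter> S))"
  unfolding closed_sequential_limits
proof (intro allI impI, elim conjE)
  fix P p assume P: "\<forall>n. P n \<in> grad \<Omega> ` (H10 \<Omega> \<inter> S)" "P \<longlonglongrightarrow> p"
  have "\<exists>V. \<forall>n. V n \<in> H10 \<Omega> \<inter> S \<and> P n = grad \<Omega> (V n)"
    by (rule choice) (use P(1) in blast)
  then obtain V where V: "\<And>n. V n \<in> H10 \<Omega>" "\<And>n. V n \<in> S" "\<And>n. P n = grad \<Omega> (V n)" by blast
  have "Cauchy V"
  proof (rule metric_CauchyI)
    fix e :: real assume "0 < e"
    then have "0 < e / C" using C_pos by simp
    then obtain N where N: "\<And>m n. m \<ge> N \<Longrightarrow> n \<ge> N \<Longrightarrow> dist (P m) (P n) < e / C"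
      using LIMSEQ_imp_Cauchy[OF P(2)] unfolding Cauchy_def by blast
    have "dist (V m) (V n) < e" if "m \<ge> N" "n \<ge> N" for m n
    proof -
      have "dist (V m) (V n) \<le> C * dist (P m) (P n)"
        using friedrichs_inequality[OF H10_diff[OF V(1) V(1)], of m n] V(1)
        by (simp add: dist_norm grad_diff V(3))
      also have "\<dots> < C * (e / C)" using N[OF that] C_pos by (intro mult_strict_left_mono)
      finally show ?thesis using C_pos by simp
    qed
    then show "\<exists>N. \<forall>m\<ge>N. \<forall>n\<ge>N. dist (V m) (V n) < e" by blast
  qed
  then obtain v where v: "V \<longlonglongrightarrow> v" using Cauchy_convergent convergent_def by blast
  have lim: "(\<lambda>n. (V n, P n)) \<longlonglongrightarrow> (v, p)" using v P(2) by (rule tendsto_Pair)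
  have "(V n, P n) \<in> closure (test_graph \<Omega>)" for n
    unfolding V(3) by (rule H10_iff(3)[OF open_domain V(1)])
  then have vp: "(v, p) \<in> closure (test_graph \<Omega>)"
    by (rule closed_sequentially[OF closed_closure _ lim])
  have "v \<in> H10 \<Omega>" using H10_iff(1)[OF open_domain] vp by blast
  moreover have "v \<in> S" by (rule closed_sequentially[OF S V(2) v])
  moreover have "grad \<Omega> v = p" by (rule H10_iff(2)[OF open_domain vp])
  ultimately show "p \<in> grad \<Omega> ` (H10 \<Omega> \<inter> S)" by blast
qed

lemma complete_grad_image: "complete (grad \<Omega> ` H10 \<Omega>)"
  using closed_grad_image[OF closed_UNIV] by (simp add: complete_eq_closed)

lemma L2_functional_inject:
  assumes h: "h \<in> L2 \<Omega>" "h' \<in> L2 \<Omega>" and eq: "L2_functional \<Omega> h = L2_functional \<Omega> h'"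
  shows "h = h'"
proof -
  have "h - h' = 0"
  proof (rule L2_eq_0_if_orthogonal_to_H10[OF open_domain])
    show "h - h' \<in> L2 \<Omega>" using h by (rule subspace_diff[OF subspace_L2])
    show "(h - h') \<bullet> v = 0" if "v \<in> H10 \<Omega>" for v
      using fun_cong[OF eq, of v] that by (simp add: L2_functional_def inner_diff_left)
  qed
  then show ?thesis by simp
qed

lemma div_plus_eqI:
  assumes "h \<in> L2 \<Omega>" "L2_functional \<Omega> h = divergence \<Omega> \<sigma> + l"
  shows "div_plus \<Omega> \<sigma> l = h"
  unfolding div_plus_def
  by (rule the_equality) (use assms L2_functional_inject in auto)

lemma functional_in_Hm1: "L2_functional \<Omega> h - divergence \<Omega> \<sigma> \<in> Hm1 \<Omega>"
proof -
  let ?l = "L2_functional \<Omega> h - divergence \<Omega> \<sigma>"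
  have l: "?l v = h \<bullet> v + \<sigma> \<bullet> grad \<Omega> v" if "v \<in> H10 \<Omega>" for v
    using that by (simp add: L2_functional_def divergence_def)
  have "\<bar>?l v\<bar> \<le> (norm h + norm \<sigma>) * H1_norm \<Omega> v" if v: "v \<in> H10 \<Omega>" for v
  proof -
    have "\<bar>h \<bullet> v\<bar> \<le> norm h * H1_norm \<Omega> v"
      unfolding H1_norm_def
      by (rule order_trans[OF Cauchy_Schwarz_ineq2 mult_left_mono]) (auto simp: norm_Pair)
    moreover have "\<bar>\<sigma> \<bullet> grad \<Omega> v\<bar> \<le> norm \<sigma> * H1_norm \<Omega> v"
      unfolding H1_norm_def
      by (rule order_trans[OF Cauchy_Schwarz_ineq2 mult_left_mono]) (auto simp: norm_Pair)
    ultimately show ?thesis unfolding l[OF v] distrib_right by linarith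
  qed
  moreover have "?l (u + v) = ?l u + ?l v" if "u \<in> H10 \<Omega>" "v \<in> H10 \<Omega>" for u v
    unfolding l[OF that(1)] l[OF that(2)] l[OF H10_add[OF that]]
    by (simp add: grad_plus[OF that] inner_add_right)
  moreover have "?l (c *\<^sub>R u) = c * ?l u" if "u \<in> H10 \<Omega>" for c u
    unfolding l[OF that] l[OF H10_scaleR[OF that]]
    by (simp add: grad_scale[OF that] distrib_left)
  ultimately have "bounded_functional_on (H10 \<Omega>) (H1_norm \<Omega>) ?l"
    unfolding bounded_functional_on_def by blast
  moreover have "?l v = 0" if "v \<notin> H10 \<Omega>" for v
    using that by (simp add: L2_functional_def divergence_def)
  ultimately show ?thesis unfolding Hm1_def by blast
qed

lemma Hm1_add: "l \<in> Hm1 \<Omega> \<Longrightarrow> u \<in> H10 \<Omega> \<Longrightarrow> v \<in> H10 \<Omega> \<Longrightarrow> l (u + v) = l u + l v"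
  unfolding Hm1_def using bounded_functional_on_add by blast

lemma Hm1_scaleR: "l \<in> Hm1 \<Omega> \<Longrightarrow> u \<in> H10 \<Omega> \<Longrightarrow> l (c *\<^sub>R u) = c * l u"
  unfolding Hm1_def using bounded_functional_on_scaleR by blast

lemma Hm1_diff: "l \<in> Hm1 \<Omega> \<Longrightarrow> u \<in> H10 \<Omega> \<Longrightarrow> v \<in> H10 \<Omega> \<Longrightarrow> l (u - v) = l u - l v"
  unfolding Hm1_def using bounded_functional_on_diff[OF _ H10_subspace] by blast

text \<open>
  The representation of the functional by \<open>h\<close> and \<open>\<sigma>\<close> already bounds it on \<^term>\<open>H10 \<Omega>\<close>.
  This is why \<^term>\<open>U \<Omega>\<close> is complete in a norm that does not mention the norm of the dual space.
\<close>

lemma U_iff: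
  "(u, \<sigma>, l) \<in> U \<Omega> \<longleftrightarrow>
     u \<in> H10 \<Omega> \<and> \<sigma> \<in> L2 \<Omega> \<and> (\<exists>h\<in>L2 \<Omega>. l = L2_functional \<Omega> h - divergence \<Omega> \<sigma>)"
proof -
  have "divergence \<Omega> \<sigma> + l = L2_functional \<Omega> h \<longleftrightarrow> l = L2_functional \<Omega> h - divergence \<Omega> \<sigma>" for h
    by (auto simp: fun_eq_iff algebra_simps)
  then show ?thesis using functional_in_Hm1 by (auto simp: U_def image_iff)
qed

lemma
  assumes "h \<in> L2 \<Omega>"
  shows div_plus_functional: "div_plus \<Omega> \<sigma> (L2_functional \<Omega> h - divergence \<Omega> \<sigma>) = h"
  by (rule div_plus_eqI[OF assms]) simp

lemma UD:
  assumes "(u, \<sigma>, l) \<in> U \<Omega>"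
  shows "u \<in> H10 \<Omega>" "\<sigma> \<in> L2 \<Omega>" "l \<in> Hm1 \<Omega>" "div_plus \<Omega> \<sigma> l \<in> L2 \<Omega>"
    and "l = L2_functional \<Omega> (div_plus \<Omega> \<sigma> l) - divergence \<Omega> \<sigma>"
  using assms functional_in_Hm1 by (auto simp: U_iff div_plus_functional)

lemma functional_eq:
  assumes "(u, \<sigma>, l) \<in> U \<Omega>"
  shows "l v = (if v \<in> H10 \<Omega> then div_plus \<Omega> \<sigma> l \<bullet> v + \<sigma> \<bullet> grad \<Omega> v else 0)"
  by (subst UD(5)[OF assms]) (simp add: L2_functional_def divergence_def)

lemma div_plus_add:
  assumes "(u, \<sigma>, l) \<in> U \<Omega>" "(v, \<tau>, m) \<in> U \<Omega>"
  shows "div_plus \<Omega> (\<sigma> + \<tau>) (l + m) = div_plus \<Omega> \<sigma> l + div_plus \<Omega> \<tau> m"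
proof (rule div_plus_eqI)
  show "div_plus \<Omega> \<sigma> l + div_plus \<Omega> \<tau> m \<in> L2 \<Omega>"
    using assms[THEN UD(4)] by (rule subspace_add[OF subspace_L2])
  show "L2_functional \<Omega> (div_plus \<Omega> \<sigma> l + div_plus \<Omega> \<tau> m) = divergence \<Omega> (\<sigma> + \<tau>) + (l + m)"
    by (simp add: fun_eq_iff L2_functional_def divergence_def inner_add_left
        functional_eq[OF assms(1)] functional_eq[OF assms(2)])
qed

lemma div_plus_scaleR:
  assumes "(u, \<sigma>, l) \<in> U \<Omega>"
  shows "div_plus \<Omega> (c *\<^sub>R \<sigma>) (c *\<^sub>R l) = c *\<^sub>R div_plus \<Omega> \<sigma> l"
proof (rule div_plus_eqI)
  show "c *\<^sub>R div_plus \<Omega> \<sigma> l \<in> L2 \<Omega>"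
    using assms[THEN UD(4)] by (rule subspace_scale[OF subspace_L2])
  show "L2_functional \<Omega> (c *\<^sub>R div_plus \<Omega> \<sigma> l) = divergence \<Omega> (c *\<^sub>R \<sigma>) + c *\<^sub>R l"
    by (simp add: fun_eq_iff L2_functional_def divergence_def scaleR_fun_def distrib_left
        functional_eq[OF assms])
qed

lemma subspace_U: "subspace (U \<Omega>)"
proof (rule subspaceI)
  have "(0 :: (real^'n, real) l2 \<Rightarrow> real) = L2_functional \<Omega> 0 - divergence \<Omega> 0"
    by (auto simp: fun_eq_iff L2_functional_def divergence_def)
  then show "0 \<in> U \<Omega>"
    unfolding zero_prod_def U_iff
    by (intro conjI bexI[of _ 0] H10_0 subspace_0[OF subspace_L2])
next
  fix x y assume "x \<in> U \<Omega>" "y \<in> U \<Omega>"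
  then obtain u \<sigma> l v \<tau> m where x: "x = (u, \<sigma>, l)" "(u, \<sigma>, l) \<in> U \<Omega>"
    and y: "y = (v, \<tau>, m)" "(v, \<tau>, m) \<in> U \<Omega>" by (cases x, cases y) blast
  have "l + m = L2_functional \<Omega> (div_plus \<Omega> \<sigma> l + div_plus \<Omega> \<tau> m) - divergence \<Omega> (\<sigma> + \<tau>)"
    by (simp add: fun_eq_iff L2_functional_def divergence_def inner_add_left
        functional_eq[OF x(2)] functional_eq[OF y(2)])
  then show "x + y \<in> U \<Omega>"
    unfolding x(1) y(1) add_Pair U_iff
    by (intro conjI bexI[of _ "div_plus \<Omega> \<sigma> l + div_plus \<Omega> \<tau> m"] H10_add
        subspace_add[OF subspace_L2] UD[OF x(2)] UD[OF y(2)])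
next
  fix x and c :: real assume "x \<in> U \<Omega>"
  then obtain u \<sigma> l where x: "x = (u, \<sigma>, l)" "(u, \<sigma>, l) \<in> U \<Omega>" by (cases x) blast
  have "c *\<^sub>R l = L2_functional \<Omega> (c *\<^sub>R div_plus \<Omega> \<sigma> l) - divergence \<Omega> (c *\<^sub>R \<sigma>)"
    by (simp add: fun_eq_iff L2_functional_def divergence_def scaleR_fun_def distrib_left
        functional_eq[OF x(2)])
  then show "c *\<^sub>R x \<in> U \<Omega>"
    unfolding x(1) scaleR_Pair U_iff
    by (intro conjI bexI[of _ "c *\<^sub>R div_plus \<Omega> \<sigma> l"] H10_scaleR
        subspace_scale[OF subspace_L2] UD[OF x(2)])
qed

definition coords :: "'n triple \<Rightarrow> (real^'n, real^'n) l2 \<times> (real^'n, real^'n) l2 \<times> (real^'n, real) l2"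
  where "coords = (\<lambda>(u, \<sigma>, l). (grad \<Omega> u, \<sigma>, div_plus \<Omega> \<sigma> l))"

lemma norm_coords: "norm (coords x) = U_norm \<Omega> x"
  by (cases x rule: prod_cases3) (simp add: coords_def U_norm_def norm_Pair add.assoc)

lemma coords_add: "x \<in> U \<Omega> \<Longrightarrow> y \<in> U \<Omega> \<Longrightarrow> coords (x + y) = coords x + coords y"
  by (cases x rule: prod_cases3, cases y rule: prod_cases3)
    (simp add: coords_def grad_plus UD(1) div_plus_add)

lemma coords_scaleR: "x \<in> U \<Omega> \<Longrightarrow> coords (c *\<^sub>R x) = c *\<^sub>R coords x"
  by (cases x rule: prod_cases3) (simp add: coords_def grad_scale UD(1) div_plus_scaleR)

lemma inj_on_coords: "inj_on coords (U \<Omega>)"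
proof (rule inj_onI)
  fix x y assume xy: "x \<in> U \<Omega>" "y \<in> U \<Omega>" "coords x = coords y"
  obtain u \<sigma> l where x: "x = (u, \<sigma>, l)" by (rule prod_cases3)
  obtain v \<tau> m where y: "y = (v, \<tau>, m)" by (rule prod_cases3)
  have eq: "grad \<Omega> u = grad \<Omega> v" "\<sigma> = \<tau>" "div_plus \<Omega> \<sigma> l = div_plus \<Omega> \<tau> m"
    using xy(3) by (auto simp: x y coords_def)
  have "u = v"
    using inj_onD[OF inj_on_grad eq(1)] UD(1) xy(1,2) by (simp add: x y)
  moreover have "l = m"
    using UD(5)[of u \<sigma> l] UD(5)[of v \<tau> m] xy(1,2) eq(2,3) unfolding x y by metis
  ultimately show "x = y" using eq(2) by (simp add: x y)
qed

lemma coords_image: "coords ` U \<Omega> = grad \<Omega> ` H10 \<Omega> \<times> L2 \<Omega> \<times> L2 \<Omega>"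
proof (intro equalityI subsetI)
  fix z assume "z \<in> coords ` U \<Omega>"
  then obtain u \<sigma> l where "(u, \<sigma>, l) \<in> U \<Omega>" "z = coords (u, \<sigma>, l)" by auto
  then show "z \<in> grad \<Omega> ` H10 \<Omega> \<times> L2 \<Omega> \<times> L2 \<Omega>" using UD by (auto simp: coords_def)
next
  fix z :: "(real^'n, real^'n) l2 \<times> (real^'n, real^'n) l2 \<times> (real^'n, real) l2"
  assume "z \<in> grad \<Omega> ` H10 \<Omega> \<times> L2 \<Omega> \<times> L2 \<Omega>"
  then obtain u \<sigma> h where z: "z = (grad \<Omega> u, \<sigma>, h)" "u \<in> H10 \<Omega>" "\<sigma> \<in> L2 \<Omega>" "h \<in> L2 \<Omega>" by auto
  let ?l = "L2_functional \<Omega> h - divergence \<Omega> \<sigma>"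
  have "(u, \<sigma>, ?l) \<in> U \<Omega>" using z unfolding U_iff by blast
  moreover have "z = coords (u, \<sigma>, ?l)" using z by (simp add: coords_def div_plus_functional)
  ultimately show "z \<in> coords ` U \<Omega>" by blast
qed

lemma closed_coords_image: "closed (coords ` U \<Omega>)"
  unfolding coords_image
  using closed_grad_image[OF closed_UNIV] by (intro closed_Times closed_L2 domain_measurable) simp

lemma norm_coords_le:
  assumes "x = (u, \<sigma>, l)"
  shows "norm (grad \<Omega> u) \<le> norm (coords x)" "norm \<sigma> \<le> norm (coords x)"
    "norm (div_plus \<Omega> \<sigma> l) \<le> norm (coords x)"
  unfolding assms coords_def by (auto simp: norm_Pair intro!: real_le_rsqrt)

lemma U_norm_uminus: "U_norm \<Omega> (- x) = U_norm \<Omega> x"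
proof -
  obtain u \<sigma> l where x: "x = (u, \<sigma>, l)" by (rule prod_cases3)
  have "norm (grad \<Omega> (- u)) = norm (grad \<Omega> u)"
    unfolding grad_def
  proof (rule norm_The_uminus)
    have "weak_gradient \<Omega> (- u) w \<longleftrightarrow> weak_gradient \<Omega> u (- w)" for w
      by (simp add: weak_gradient_def)
    then show "w \<in> L2 \<Omega> \<and> weak_gradient \<Omega> (- u) w \<longleftrightarrow> - w \<in> L2 \<Omega> \<and> weak_gradient \<Omega> u (- w)" for w
      by (simp only: uminus_in_L2_iff)
    show "w = w'" if "w \<in> L2 \<Omega> \<and> weak_gradient \<Omega> u w" "w' \<in> L2 \<Omega> \<and> weak_gradient \<Omega> u w'" for w w'
    proof (cases "u \<in> L2 \<Omega>")
      case True
      then show ?thesis using that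
        by (intro weak_gradient_unique[OF open_domain, of u]) (auto simp: weak_gradient_graph_def)
    next
      case False
      have "(0, w - w') \<in> weak_gradient_graph \<Omega>" "(0, 0) \<in> weak_gradient_graph \<Omega>"
        using that
        by (auto simp: weak_gradient_graph_def weak_gradient_def inner_diff_left
            intro: subspace_0[OF subspace_L2] subspace_diff[OF subspace_L2])
      then show ?thesis using weak_gradient_unique[OF open_domain] by fastforce
    qed
  qed
  moreover have "norm (div_plus \<Omega> (- \<sigma>) (- l)) = norm (div_plus \<Omega> \<sigma> l)"
    unfolding div_plus_def
  proof (rule norm_The_uminus)
    have "L2_functional \<Omega> (- h) = - L2_functional \<Omega> h" "divergence \<Omega> (- \<sigma>) = - divergence \<Omega> \<sigma>" for h
      by (simp_all add: L2_functional_def divergence_def fun_eq_iff)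
    moreover have "a = - b + - c \<longleftrightarrow> - a = b + c" for a b c :: "(real^'n, real) l2 \<Rightarrow> real"
      by (subst minus_equation_iff) auto
    ultimately show "h \<in> L2 \<Omega> \<and> L2_functional \<Omega> h = divergence \<Omega> (- \<sigma>) + - l
        \<longleftrightarrow> - h \<in> L2 \<Omega> \<and> L2_functional \<Omega> (- h) = divergence \<Omega> \<sigma> + l" for h
      by (simp only: uminus_in_L2_iff)
    show "h = h'" if "h \<in> L2 \<Omega> \<and> L2_functional \<Omega> h = divergence \<Omega> \<sigma> + l"
      "h' \<in> L2 \<Omega> \<and> L2_functional \<Omega> h' = divergence \<Omega> \<sigma> + l" for h h'
      using that by (intro L2_functional_inject) auto
  qed
  ultimately show ?thesis by (simp add: x U_norm_def)
qed

lemma coords_diff: "x \<in> U \<Omega> \<Longrightarrow> y \<in> U \<Omega> \<Longrightarrow> coords (x - y) = coords x - coords y"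
  using coords_add[of x "(- 1) *\<^sub>R y"] coords_scaleR[of y "- 1"]
    subspace_scale[OF subspace_U, of y "- 1"] by simp

lemma metric_U: "Metric_space (U \<Omega>) (\<lambda>x y. U_norm \<Omega> (x - y))"
proof
  fix x y z
  show "0 \<le> U_norm \<Omega> (x - y)" using norm_ge_zero[of "coords (x - y)"] by (simp add: norm_coords)
  show "U_norm \<Omega> (x - y) = U_norm \<Omega> (y - x)" using U_norm_uminus[of "x - y"] by simp
  assume xy: "x \<in> U \<Omega>" "y \<in> U \<Omega>"
  then show "U_norm \<Omega> (x - y) = 0 \<longleftrightarrow> x = y"
    by (simp add: norm_coords[symmetric] coords_diff inj_on_eq_iff[OF inj_on_coords])
  assume z: "z \<in> U \<Omega>"
  show "U_norm \<Omega> (x - z) \<le> U_norm \<Omega> (x - y) + U_norm \<Omega> (y - z)"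
    using xy z norm_triangle_ineq[of "coords x - coords y" "coords y - coords z"]
    by (simp add: norm_coords[symmetric] coords_diff)
qed

lemma closed_coords_image_closedin: "closedin (U_topology \<Omega>) K \<Longrightarrow> closed (coords ` K)"
  unfolding U_topology_def
  by (rule closed_image_if_closedin_isometric[OF metric_U _ closed_coords_image])
    (simp_all add: norm_coords[symmetric] coords_diff)

section \<open>The obstacle problem and the first-order system\<close>

lemma obstacle_VI_solvable:
  assumes S: "closed S" "convex S" "g \<in> H10 \<Omega>" "g \<in> S"
  shows "\<exists>!u. solves_VI (\<lambda>u v. grad \<Omega> u \<bullet> grad \<Omega> v) (\<lambda>v. f \<bullet> v) (H10 \<Omega> \<inter> S) u"
proof (rule Lions_Stampacchia_isometric[OF H10_subspace grad_plus grad_scale inj_on_grad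
      complete_grad_image, where M = 1 and \<alpha> = 1])
  have bf: "bounded_functional_on (H10 \<Omega>) (\<lambda>x. norm (grad \<Omega> x)) (\<lambda>v. w \<bullet> grad \<Omega> v)" for w
    unfolding bounded_functional_on_def
  proof (intro conjI ballI allI exI)
    show "\<bar>w \<bullet> grad \<Omega> v\<bar> \<le> norm w * norm (grad \<Omega> v)" for v by (rule Cauchy_Schwarz_ineq2)
  qed (simp_all add: grad_plus grad_scale inner_add_right)
  then show "bounded_functional_on (H10 \<Omega>) (\<lambda>x. norm (grad \<Omega> x)) (\<lambda>v. grad \<Omega> x \<bullet> grad \<Omega> v)" for x .
  show "bounded_functional_on (H10 \<Omega>) (\<lambda>x. norm (grad \<Omega> x)) (\<lambda>x. grad \<Omega> x \<bullet> grad \<Omega> y)" for y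
    using bf[of "grad \<Omega> y"] by (simp add: inner_commute)
  show "bounded_functional_on (H10 \<Omega>) (\<lambda>x. norm (grad \<Omega> x)) (\<lambda>v. f \<bullet> v)"
    unfolding bounded_functional_on_def
  proof (intro conjI ballI allI exI)
    fix v assume "v \<in> H10 \<Omega>"
    then have "norm f * norm v \<le> norm f * (C * norm (grad \<Omega> v))"
      by (intro mult_left_mono friedrichs_inequality) auto
    then show "\<bar>f \<bullet> v\<bar> \<le> (norm f * C) * norm (grad \<Omega> v)"
      using Cauchy_Schwarz_ineq2[of f v] by (simp add: mult.assoc)
  qed (simp_all add: inner_add_right)
  show "\<bar>grad \<Omega> x \<bullet> grad \<Omega> y\<bar> \<le> 1 * norm (grad \<Omega> x) * norm (grad \<Omega> y)" for x y
    using Cauchy_Schwarz_ineq2[of "grad \<Omega> x" "grad \<Omega> y"] by simp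
  show "1 * (norm (grad \<Omega> x))\<^sup>2 \<le> grad \<Omega> x \<bullet> grad \<Omega> x" for x
    by (simp add: power2_norm_eq_inner)
  show "convex (H10 \<Omega> \<inter> S)" using subspace_imp_convex[OF H10_subspace] S(2) by (rule convex_Int)
  show "closed (grad \<Omega> ` (H10 \<Omega> \<inter> S))" by (rule closed_grad_image[OF S(1)])
  show "H10 \<Omega> \<inter> S \<noteq> {}" using S by blast
qed auto

text \<open>
  Let \<open>u\<close> solve the classical obstacle problem and \<open>\<lambda> = - div (grad u) - f\<close>. The variational
  inequality reads \<open>\<langle>\<lambda>, v - u\<rangle> \<ge> 0\<close>. Testing with \<open>v = u + w\<close> for \<open>w \<ge> 0\<close> gives \<open>\<lambda> \<ge> 0\<close>, and testing with
  \<open>v = g\<close> gives \<open>\<langle>\<lambda>, u - g\<rangle> \<le> 0\<close>, whence complementarity.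
\<close>

lemma FO_solvable:
  assumes f: "f \<in> L2 \<Omega>" and g: "g \<in> H10 \<Omega>"
  shows "\<exists>x. solves_FO \<Omega> f g x"
proof -
  let ?S = "{v. nonneg_on \<Omega> (v - g)}"
  have "?S = (\<lambda>w. g + w) ` {w. nonneg_on \<Omega> w}" by (auto intro!: image_eqI[of _ _ "_ - g"])
  then have "closed ?S" using closed_nonneg_on[OF domain_measurable] by (simp add: closed_translation)
  moreover have "convex ?S"
  proof (rule convexI)
    fix v w :: "(real^'n, real) l2" and s t :: real
    assume "v \<in> ?S" "w \<in> ?S" and st: "0 \<le> s" "0 \<le> t" "s + t = 1"
    then have "nonneg_on \<Omega> (s *\<^sub>R (v - g) + t *\<^sub>R (w - g))"
      by (intro nonneg_on_add nonneg_on_scaleR) auto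
    moreover have "s *\<^sub>R (v - g) + t *\<^sub>R (w - g) = s *\<^sub>R v + t *\<^sub>R w - (s + t) *\<^sub>R g"
      by (simp add: algebra_simps)
    ultimately show "s *\<^sub>R v + t *\<^sub>R w \<in> ?S" using st by simp
  qed
  moreover have "g \<in> ?S" by (simp add: nonneg_on_0)
  ultimately obtain u where
    "solves_VI (\<lambda>u v. grad \<Omega> u \<bullet> grad \<Omega> v) (\<lambda>v. f \<bullet> v) (H10 \<Omega> \<inter> ?S) u"
    using obstacle_VI_solvable[of ?S g f] g by blast
  then have u: "u \<in> H10 \<Omega>" "nonneg_on \<Omega> (u - g)"
    and VI: "\<And>v. v \<in> H10 \<Omega> \<Longrightarrow> nonneg_on \<Omega> (v - g) \<Longrightarrow> f \<bullet> (v - u) \<le> grad \<Omega> u \<bullet> grad \<Omega> (v - u)"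
    by (auto simp: solves_VI_def)
  define l where "l = L2_functional \<Omega> (- f) - divergence \<Omega> (grad \<Omega> u)"
  have mf: "- f \<in> L2 \<Omega>" using f by (simp add: uminus_in_L2_iff)
  have xU: "(u, grad \<Omega> u, l) \<in> U \<Omega>"
    unfolding U_iff l_def using u(1) grad_in_L2[OF open_domain u(1)] mf by blast
  have l: "l v = grad \<Omega> u \<bullet> grad \<Omega> v - f \<bullet> v" if "v \<in> H10 \<Omega>" for v
    using that by (simp add: l_def L2_functional_def divergence_def)
  have nonneg: "nonneg_functional \<Omega> l"
    unfolding nonneg_functional_def
  proof (intro ballI impI)
    fix w assume w: "w \<in> H10 \<Omega>" "nonneg_on \<Omega> w"
    have "nonneg_on \<Omega> (u + w - g)" using nonneg_on_add[OF u(2) w(2)] by (simp add: algebra_simps)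
    then show "0 \<le> l w" using VI[OF H10_add[OF u(1) w(1)]] l[OF w(1)] by simp
  qed
  have "0 \<le> l (g - u)" using VI[OF g] l[OF H10_diff[OF g u(1)]] by (simp add: nonneg_on_0)
  moreover have "l (g - u) = - l (u - g)"
    using Hm1_diff[OF UD(3)[OF xU]] u(1) g by simp
  moreover have "0 \<le> l (u - g)" using nonneg u(2) H10_diff[OF u(1) g] by (simp add: nonneg_functional_def)
  ultimately have "l (u - g) = 0" by simp
  moreover have "- divergence \<Omega> (grad \<Omega> u) - l = L2_functional \<Omega> f"
    by (simp add: l_def fun_eq_iff L2_functional_def)
  ultimately have "solves_FO \<Omega> f g (u, grad \<Omega> u, l)"
    using xU u nonneg by (simp add: solves_FO_def)
  then show ?thesis by blast
qed

section \<open>The family of bilinear forms\<close>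

text \<open>
  The weight \<open>\<theta>\<close> interpolates between the three forms: \<open>1/2\<close> gives the symmetric one, \<open>1\<close> and \<open>0\<close> the
  two others. The right-hand sides follow the same pattern.
\<close>

definition form :: "real \<Rightarrow> real \<Rightarrow> 'n triple \<Rightarrow> 'n triple \<Rightarrow> real" where
  "form \<beta> \<theta> = (\<lambda>(u, \<sigma>, l) (v, \<tau>, m).
     \<beta> * (div_plus \<Omega> \<sigma> l \<bullet> div_plus \<Omega> \<tau> m) + (grad \<Omega> u - \<sigma>) \<bullet> (grad \<Omega> v - \<tau>)
     + (\<theta> * l v + (1 - \<theta>) * m u))"

definition rhs :: "real \<Rightarrow> real \<Rightarrow> (real^'n, real) l2 \<Rightarrow> (real^'n, real) l2 \<Rightarrow> 'n triple \<Rightarrow> real" where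
  "rhs \<beta> \<theta> f g = (\<lambda>(v, \<tau>, m). - \<beta> * (f \<bullet> div_plus \<Omega> \<tau> m) + (1 - \<theta>) * m g)"

lemma forms_eq:
  "a_form \<Omega> \<beta> = form \<beta> (1/2)" "b_form \<Omega> \<beta> = form \<beta> 1" "c_form \<Omega> \<beta> = form \<beta> 0"
  by (simp_all add: fun_eq_iff a_form_def b_form_def c_form_def form_def)

lemma rhs_eq:
  "F_rhs \<Omega> \<beta> f g = rhs \<beta> (1/2) f g" "G_rhs \<Omega> \<beta> f = rhs \<beta> 1 f g" "H_rhs \<Omega> \<beta> f g = rhs \<beta> 0 f g"
  by (simp_all add: fun_eq_iff F_rhs_def G_rhs_def H_rhs_def rhs_def)

lemma form_add_left:
  "x \<in> U \<Omega> \<Longrightarrow> x' \<in> U \<Omega> \<Longrightarrow> y \<in> U \<Omega> \<Longrightarrow> form \<beta> \<theta> (x + x') y = form \<beta> \<theta> x y + form \<beta> \<theta> x' y"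
  by (cases x; cases x'; cases y)
    (simp add: form_def grad_plus UD(1) div_plus_add Hm1_add[OF UD(3)] inner_add_left
      inner_diff_left distrib_left)

lemma form_scaleR_left:
  "x \<in> U \<Omega> \<Longrightarrow> y \<in> U \<Omega> \<Longrightarrow> form \<beta> \<theta> (c *\<^sub>R x) y = c * form \<beta> \<theta> x y"
  by (cases x; cases y)
    (simp add: form_def grad_scale UD(1) div_plus_scaleR Hm1_scaleR[OF UD(3)] scaleR_fun_apply
      inner_diff_left algebra_simps)

lemma form_commute: "form \<beta> \<theta> x y = form \<beta> (1 - \<theta>) y x"
  by (cases x; cases y) (simp add: form_def inner_commute)

lemma functional_bound:
  assumes x: "x \<in> U \<Omega>" "x = (u, \<sigma>, l)" and v: "v \<in> H10 \<Omega>"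
  shows "\<bar>l v\<bar> \<le> (C + 1) * (norm (coords x) * norm (grad \<Omega> v))"
proof -
  let ?h = "div_plus \<Omega> \<sigma> l"
  have "\<bar>?h \<bullet> v\<bar> \<le> norm ?h * norm v" by (rule Cauchy_Schwarz_ineq2)
  also have "\<dots> \<le> norm (coords x) * (C * norm (grad \<Omega> v))"
    using norm_coords_le(3)[OF x(2)] friedrichs_inequality[OF v] by (intro mult_mono) auto
  finally have 1: "\<bar>?h \<bullet> v\<bar> \<le> C * (norm (coords x) * norm (grad \<Omega> v))" by (simp add: mult.left_commute)
  have "\<bar>\<sigma> \<bullet> grad \<Omega> v\<bar> \<le> norm \<sigma> * norm (grad \<Omega> v)" by (rule Cauchy_Schwarz_ineq2)
  also have "\<dots> \<le> norm (coords x) * norm (grad \<Omega> v)"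
    using norm_coords_le(2)[OF x(2)] by (intro mult_right_mono) auto
  finally have "\<bar>?h \<bullet> v + \<sigma> \<bullet> grad \<Omega> v\<bar> \<le> (C + 1) * (norm (coords x) * norm (grad \<Omega> v))"
    using 1 unfolding distrib_right by linarith
  then show ?thesis using functional_eq[of u \<sigma> l v] x v by simp
qed

lemma form_bound:
  assumes \<beta>: "0 \<le> \<beta>" and \<theta>: "0 \<le> \<theta>" "\<theta> \<le> 1" and xy: "x \<in> U \<Omega>" "y \<in> U \<Omega>"
  shows "\<bar>form \<beta> \<theta> x y\<bar> \<le> (\<beta> + 5 + C) * norm (coords x) * norm (coords y)"
proof -
  obtain u \<sigma> l where x: "x = (u, \<sigma>, l)" by (rule prod_cases3)
  obtain v \<tau> m where y: "y = (v, \<tau>, m)" by (rule prod_cases3)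
  have uv: "u \<in> H10 \<Omega>" "v \<in> H10 \<Omega>" using xy UD(1) unfolding x y by blast+
  define N where "N = norm (coords x) * norm (coords y)"
  have "norm (grad \<Omega> u - \<sigma>) \<le> 2 * norm (coords x)" "norm (grad \<Omega> v - \<tau>) \<le> 2 * norm (coords y)"
    using norm_triangle_ineq4[of "grad \<Omega> u" \<sigma>] norm_triangle_ineq4[of "grad \<Omega> v" \<tau>]
      norm_coords_le(1,2)[OF x] norm_coords_le(1,2)[OF y] by linarith+
  then have "norm (grad \<Omega> u - \<sigma>) * norm (grad \<Omega> v - \<tau>)
      \<le> (2 * norm (coords x)) * (2 * norm (coords y))"
    by (intro mult_mono) auto
  then have 1: "\<bar>(grad \<Omega> u - \<sigma>) \<bullet> (grad \<Omega> v - \<tau>)\<bar> \<le> 4 * N"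
    using Cauchy_Schwarz_ineq2[of "grad \<Omega> u - \<sigma>" "grad \<Omega> v - \<tau>"] by (simp add: N_def)
  have "norm (div_plus \<Omega> \<sigma> l) * norm (div_plus \<Omega> \<tau> m) \<le> N"
    unfolding N_def using norm_coords_le(3)[OF x] norm_coords_le(3)[OF y] by (intro mult_mono) auto
  then have "\<bar>div_plus \<Omega> \<sigma> l \<bullet> div_plus \<Omega> \<tau> m\<bar> \<le> N"
    using Cauchy_Schwarz_ineq2[of "div_plus \<Omega> \<sigma> l" "div_plus \<Omega> \<tau> m"] by linarith
  then have 2: "\<bar>\<beta> * (div_plus \<Omega> \<sigma> l \<bullet> div_plus \<Omega> \<tau> m)\<bar> \<le> \<beta> * N"
    using \<beta> by (simp add: abs_mult mult_left_mono)
  have "\<bar>l v\<bar> \<le> (C + 1) * (norm (coords x) * norm (grad \<Omega> v))"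
    by (rule functional_bound[OF xy(1) x uv(2)])
  also have "\<dots> \<le> (C + 1) * N"
    unfolding N_def using C_pos norm_coords_le(1)[OF y] by (intro mult_left_mono) auto
  finally have l: "\<theta> * \<bar>l v\<bar> \<le> \<theta> * ((C + 1) * N)" using \<theta> by (intro mult_left_mono)
  have "\<bar>m u\<bar> \<le> (C + 1) * (norm (coords y) * norm (grad \<Omega> u))"
    by (rule functional_bound[OF xy(2) y uv(1)])
  also have "\<dots> \<le> (C + 1) * N"
    unfolding N_def mult.commute[of "norm (coords x)"]
    using C_pos norm_coords_le(1)[OF x] by (intro mult_left_mono) auto
  finally have m: "(1 - \<theta>) * \<bar>m u\<bar> \<le> (1 - \<theta>) * ((C + 1) * N)" using \<theta> by (intro mult_left_mono) auto
  have "\<bar>\<theta> * l v + (1 - \<theta>) * m u\<bar> \<le> \<theta> * \<bar>l v\<bar> + (1 - \<theta>) * \<bar>m u\<bar>"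
    using abs_triangle_ineq[of "\<theta> * l v" "(1 - \<theta>) * m u"] \<theta> by (simp add: abs_mult)
  also have "\<dots> \<le> (C + 1) * N" using l m by (simp add: algebra_simps)
  finally have 3: "\<bar>\<theta> * l v + (1 - \<theta>) * m u\<bar> \<le> (C + 1) * N" .
  have "\<bar>form \<beta> \<theta> x y\<bar> \<le> \<beta> * N + 4 * N + (C + 1) * N"
    using 1 2 3 unfolding x y form_def prod.case by linarith
  then show ?thesis by (simp add: N_def algebra_simps)
qed

lemma form_bounded_functional:
  assumes \<beta>: "0 \<le> \<beta>" and \<theta>: "0 \<le> \<theta>" "\<theta> \<le> 1"
  shows "y \<in> U \<Omega> \<Longrightarrow> bounded_functional_on (U \<Omega>) (\<lambda>x. norm (coords x)) (\<lambda>x. form \<beta> \<theta> x y)"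
    and "x \<in> U \<Omega> \<Longrightarrow> bounded_functional_on (U \<Omega>) (\<lambda>x. norm (coords x)) (form \<beta> \<theta> x)"
proof -
  have *: "bounded_functional_on (U \<Omega>) (\<lambda>x. norm (coords x)) (\<lambda>x. form \<beta> \<theta> x y)"
    if y: "y \<in> U \<Omega>" and \<theta>: "0 \<le> \<theta>" "\<theta> \<le> 1" for y \<theta>
    unfolding bounded_functional_on_def
  proof (intro conjI ballI allI exI)
    show "\<bar>form \<beta> \<theta> x y\<bar> \<le> ((\<beta> + 5 + C) * norm (coords y)) * norm (coords x)" if "x \<in> U \<Omega>" for x
      using form_bound[OF \<beta> \<theta> that y] by (simp add: mult_ac)
  qed (simp_all add: form_add_left form_scaleR_left y)
  show "bounded_functional_on (U \<Omega>) (\<lambda>x. norm (coords x)) (\<lambda>x. form \<beta> \<theta> x y)" if "y \<in> U \<Omega>"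
    using *[OF that \<theta>] .
  have "form \<beta> \<theta> x = (\<lambda>y. form \<beta> (1 - \<theta>) y x)"
    by (rule ext) (rule form_commute)
  then show "bounded_functional_on (U \<Omega>) (\<lambda>x. norm (coords x)) (form \<beta> \<theta> x)" if "x \<in> U \<Omega>"
    using *[OF that, of "1 - \<theta>"] \<theta> by simp
qed

text \<open>
  Since \<open>\<langle>\<lambda>, u\<rangle> = (h, u) + (\<sigma>, grad u)\<close>, the duality term supplies half of what is needed to turn
  \<open>\<parallel>grad u - \<sigma>\<parallel>\<^sup>2\<close> into a positive definite expression, and the rest is dominated by \<open>\<beta> \<parallel>h\<parallel>\<^sup>2\<close>.
\<close>

lemma form_coercive:
  assumes \<beta>: "1 + C\<^sup>2 \<le> \<beta>" and x: "x \<in> U \<Omega>"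
  shows "1/4 * (norm (coords x))\<^sup>2 \<le> form \<beta> \<theta> x x"
proof -
  obtain u \<sigma> l where xe: "x = (u, \<sigma>, l)" by (rule prod_cases3)
  define p h where "p = grad \<Omega> u" and "h = div_plus \<Omega> \<sigma> l"
  have u: "u \<in> H10 \<Omega>" using x UD(1) unfolding xe by blast
  have lu: "l u = h \<bullet> u + \<sigma> \<bullet> p" using functional_eq[of u \<sigma> l u] x u by (simp add: xe p_def h_def)
  have form: "form \<beta> \<theta> x x = \<beta> * (norm h)\<^sup>2 + ((norm p)\<^sup>2 - \<sigma> \<bullet> p + (norm \<sigma>)\<^sup>2) + h \<bullet> u"
    unfolding xe form_def prod.case lu p_def[symmetric] h_def[symmetric] power2_norm_eq_inner
    by (simp add: inner_diff_left inner_diff_right inner_commute algebra_simps)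
  have N: "(norm (coords x))\<^sup>2 = (norm p)\<^sup>2 + (norm \<sigma>)\<^sup>2 + (norm h)\<^sup>2"
    by (simp add: xe coords_def p_def h_def norm_Pair)
  have "\<sigma> \<bullet> p \<le> norm \<sigma> * norm p" by (rule norm_cauchy_schwarz)
  then have 1: "\<sigma> \<bullet> p \<le> ((norm p)\<^sup>2 + (norm \<sigma>)\<^sup>2) / 2"
    using sum_squares_bound[of "norm \<sigma>" "norm p"] by simp
  have "\<bar>h \<bullet> u\<bar> \<le> norm h * norm u" by (rule Cauchy_Schwarz_ineq2)
  also have "\<dots> \<le> norm h * (C * norm p)"
    unfolding p_def by (intro mult_left_mono friedrichs_inequality u) auto
  finally have 2: "- (C * norm h * norm p) \<le> h \<bullet> u" by (simp add: algebra_simps)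
  \<comment> \<open>Young's inequality, with the weight that leaves a quarter of the gradient term.\<close>
  have 3: "C * norm h * norm p \<le> C\<^sup>2 * (norm h)\<^sup>2 + (norm p)\<^sup>2 / 4"
    using zero_le_power2[of "C * norm h - norm p / 2"]
    by (simp add: power2_eq_square algebra_simps)
  have "(1 + C\<^sup>2) * (norm h)\<^sup>2 \<le> \<beta> * (norm h)\<^sup>2" using \<beta> by (rule mult_right_mono) simp
  then have 4: "(norm h)\<^sup>2 + C\<^sup>2 * (norm h)\<^sup>2 \<le> \<beta> * (norm h)\<^sup>2" by (simp add: distrib_right)
  have arith: "H + c \<le> b \<Longrightarrow> s \<le> (P + S) / 2 \<Longrightarrow> - q \<le> y \<Longrightarrow> q \<le> c + P / 4 \<Longrightarrow>
      0 \<le> P \<Longrightarrow> 0 \<le> S \<Longrightarrow> 0 \<le> H \<Longrightarrow> 1/4 * (P + S + H) \<le> b + (P - s + S) + y"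
    for H c b s P S q y :: real
    by argo
  show ?thesis
    unfolding form N using 4 1 2 3 by (rule arith) simp_all
qed

lemma form_definite:
  assumes "1 + C\<^sup>2 \<le> \<beta>" and x: "x \<in> U \<Omega>" and "form \<beta> \<theta> x x \<le> 0"
  shows "x = 0"
proof -
  have "(norm (coords x))\<^sup>2 \<le> 0" using form_coercive[OF assms(1,2), of \<theta>] assms(3) by linarith
  then have "coords x = coords 0"
    using coords_scaleR[OF x, of 0] by simp
  then show ?thesis using inj_on_coords x subspace_0[OF subspace_U] by (simp add: inj_on_eq_iff)
qed

theorem VI_solvable:
  assumes \<beta>: "1 + C\<^sup>2 \<le> \<beta>" and \<theta>: "0 \<le> \<theta>" "\<theta> \<le> 1"
    and F: "bounded_functional_on (U \<Omega>) (U_norm \<Omega>) F"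
    and K: "K \<subseteq> U \<Omega>" "K \<noteq> {}" "convex K" "closedin (U_topology \<Omega>) K"
  shows "\<exists>!u. solves_VI (form \<beta> \<theta>) F K u"
proof (rule Lions_Stampacchia_isometric[OF subspace_U coords_add coords_scaleR inj_on_coords _
      K(1-3) closed_coords_image_closedin[OF K(4)], where M = "\<beta> + 5 + C" and \<alpha> = "1/4"])
  have \<beta>0: "0 \<le> \<beta>" using \<beta> zero_le_power2[of C] by linarith
  show "complete (coords ` U \<Omega>)" using closed_coords_image by (simp add: complete_eq_closed)
  show "\<And>y. y \<in> U \<Omega> \<Longrightarrow> bounded_functional_on (U \<Omega>) (\<lambda>x. norm (coords x)) (\<lambda>x. form \<beta> \<theta> x y)"
    "\<And>x. x \<in> U \<Omega> \<Longrightarrow> bounded_functional_on (U \<Omega>) (\<lambda>x. norm (coords x)) (form \<beta> \<theta> x)"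
    by (rule form_bounded_functional[OF \<beta>0 \<theta>], assumption)+
  show "bounded_functional_on (U \<Omega>) (\<lambda>x. norm (coords x)) F" using F by (simp add: norm_coords)
  show "\<bar>form \<beta> \<theta> x y\<bar> \<le> (\<beta> + 5 + C) * norm (coords x) * norm (coords y)"
    if "x \<in> U \<Omega>" "y \<in> U \<Omega>" for x y by (rule form_bound[OF \<beta>0 \<theta> that])
  show "1/4 * (norm (coords x))\<^sup>2 \<le> form \<beta> \<theta> x x" if "x \<in> U \<Omega>" for x
    by (rule form_coercive[OF \<beta> that])
qed auto

lemma rhs_bounded_functional:
  assumes g: "g \<in> H10 \<Omega>"
  shows "bounded_functional_on (U \<Omega>) (\<lambda>x. norm (coords x)) (rhs \<beta> \<theta> f g)"
  unfolding bounded_functional_on_def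
proof (intro conjI ballI allI exI)
  fix x y assume xy: "x \<in> U \<Omega>" "y \<in> U \<Omega>"
  then show "rhs \<beta> \<theta> f g (x + y) = rhs \<beta> \<theta> f g x + rhs \<beta> \<theta> f g y"
    by (cases x; cases y) (simp add: rhs_def div_plus_add inner_add_right distrib_left)
next
  fix x and c :: real assume "x \<in> U \<Omega>"
  then show "rhs \<beta> \<theta> f g (c *\<^sub>R x) = c * rhs \<beta> \<theta> f g x"
    by (cases x) (simp add: rhs_def div_plus_scaleR scaleR_fun_apply algebra_simps)
next
  fix x assume xU: "x \<in> U \<Omega>"
  obtain v \<tau> m where x: "x = (v, \<tau>, m)" by (rule prod_cases3)
  let ?h = "div_plus \<Omega> \<tau> m"
  have "\<bar>f \<bullet> ?h\<bar> \<le> norm f * norm (coords x)"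
    using Cauchy_Schwarz_ineq2[of f ?h] mult_left_mono[OF norm_coords_le(3)[OF x], of "norm f"] by simp
  then have "\<bar>\<beta>\<bar> * \<bar>f \<bullet> ?h\<bar> \<le> \<bar>\<beta>\<bar> * (norm f * norm (coords x))" by (intro mult_left_mono) auto
  moreover have "\<bar>1 - \<theta>\<bar> * \<bar>m g\<bar> \<le> \<bar>1 - \<theta>\<bar> * ((C + 1) * (norm (coords x) * norm (grad \<Omega> g)))"
    using functional_bound[OF xU x g] by (intro mult_left_mono) auto
  moreover have "\<bar>rhs \<beta> \<theta> f g x\<bar> \<le> \<bar>\<beta>\<bar> * \<bar>f \<bullet> ?h\<bar> + \<bar>1 - \<theta>\<bar> * \<bar>m g\<bar>"
    unfolding x rhs_def prod.case
    using abs_triangle_ineq[of "- \<beta> * (f \<bullet> ?h)" "(1 - \<theta>) * m g"] by (simp add: abs_mult)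
  ultimately show "\<bar>rhs \<beta> \<theta> f g x\<bar>
      \<le> (\<bar>\<beta>\<bar> * norm f + \<bar>1 - \<theta>\<bar> * ((C + 1) * norm (grad \<Omega> g))) * norm (coords x)"
    by (simp add: algebra_simps)
qed

section \<open>Equivalence with the first-order system\<close>

text \<open>
  For a solution of the system the two least-squares terms cancel against the right-hand side or vanish,
  and only duality terms are left. Complementarity allows \<open>u\<close> to be exchanged for \<open>g\<close> in \<open>\<langle>\<lambda>, u\<rangle>\<close>.
\<close>

lemma FO_residual:
  assumes f: "f \<in> L2 \<Omega>" and g: "g \<in> H10 \<Omega>" and FO: "solves_FO \<Omega> f g (u, \<sigma>, l)"
    and y: "(v, \<tau>, m) \<in> U \<Omega>"
  shows "form \<beta> \<theta> (u, \<sigma>, l) ((v, \<tau>, m) - (u, \<sigma>, l)) - rhs \<beta> \<theta> f g ((v, \<tau>, m) - (u, \<sigma>, l))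
    = \<theta> * l (v - g) + (1 - \<theta>) * m (u - g)"
proof -
  have xU: "(u, \<sigma>, l) \<in> U \<Omega>" and eq: "- divergence \<Omega> \<sigma> - l = L2_functional \<Omega> f"
    and \<sigma>: "\<sigma> = grad \<Omega> u" and compl: "l (u - g) = 0"
    using FO by (auto simp: solves_FO_def)
  have H: "u \<in> H10 \<Omega>" "v \<in> H10 \<Omega>" "l \<in> Hm1 \<Omega>" "m \<in> Hm1 \<Omega>" using UD xU y by blast+
  have h: "div_plus \<Omega> \<sigma> l = - f"
  proof (rule div_plus_eqI)
    show "- f \<in> L2 \<Omega>" using f by (simp add: uminus_in_L2_iff)
    have "L2_functional \<Omega> (- f) = - L2_functional \<Omega> f"
      by (auto simp: fun_eq_iff L2_functional_def)
    then show "L2_functional \<Omega> (- f) = divergence \<Omega> \<sigma> + l" using eq[symmetric] by simp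
  qed
  have "l u = l g" using compl Hm1_diff[OF H(3,1) g] by simp
  then show ?thesis
    by (simp add: form_def rhs_def \<sigma> h[unfolded \<sigma>] Hm1_diff[OF H(3) H(2) H(1)] Hm1_diff[OF H(3) H(2) g]
        Hm1_diff[OF H(4) H(1) g] algebra_simps)
qed

text \<open>
  Existence comes from the first-order system and uniqueness from definiteness of the form. The
  conditions on \<open>K\<close> say that those constraints are imposed whose duality term in \<open>FO_residual\<close>
  is present for the weight \<open>\<theta>\<close>.
\<close>

theorem VI_iff_FO:
  assumes \<beta>: "1 + C\<^sup>2 \<le> \<beta>" and \<theta>: "0 \<le> \<theta>" "\<theta> \<le> 1"
    and f: "f \<in> L2 \<Omega>" and g: "g \<in> H10 \<Omega>"
    and K: "K_s \<Omega> g \<subseteq> K" "K \<subseteq> U \<Omega>"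
    and K0: "0 < \<theta> \<Longrightarrow> K \<subseteq> K_0 \<Omega> g" and K1: "\<theta> < 1 \<Longrightarrow> K \<subseteq> K_1 \<Omega>"
  shows "solves_VI (form \<beta> \<theta>) (rhs \<beta> \<theta> f g) K x \<longleftrightarrow> solves_FO \<Omega> f g x"
    and "\<exists>!x. solves_VI (form \<beta> \<theta>) (rhs \<beta> \<theta> f g) K x"
proof -
  have \<beta>0: "0 \<le> \<beta>" using \<beta> zero_le_power2[of C] by linarith
  have FO_VI: "solves_VI (form \<beta> \<theta>) (rhs \<beta> \<theta> f g) K x" if FO: "solves_FO \<Omega> f g x" for x
  proof -
    obtain u \<sigma> l where x: "x = (u, \<sigma>, l)" by (rule prod_cases3)
    have u: "u \<in> H10 \<Omega>" "nonneg_on \<Omega> (u - g)" and l: "nonneg_functional \<Omega> l" and xU: "x \<in> U \<Omega>"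
      using FO UD(1) by (auto simp: solves_FO_def x)
    have "x \<in> K_s \<Omega> g" using u l xU by (simp add: K_s_def x)
    then have "x \<in> K" using K(1) by blast
    moreover have "rhs \<beta> \<theta> f g (y - x) \<le> form \<beta> \<theta> x (y - x)" if yK: "y \<in> K" for y
    proof -
      obtain v \<tau> m where y: "y = (v, \<tau>, m)" by (rule prod_cases3)
      have yU: "(v, \<tau>, m) \<in> U \<Omega>" using yK K(2) y by blast
      have "0 \<le> \<theta> * l (v - g)"
      proof (cases "0 < \<theta>")
        case True
        then have "nonneg_on \<Omega> (v - g)" using K0 yK by (auto simp: K_0_def y)
        then have "0 \<le> l (v - g)" using l H10_diff[OF UD(1)[OF yU] g] by (simp add: nonneg_functional_def)
        then show ?thesis using \<theta> by simp
      qed (use \<theta> in simp)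
      moreover have "0 \<le> (1 - \<theta>) * m (u - g)"
      proof (cases "\<theta> < 1")
        case True
        then have "nonneg_functional \<Omega> m" using K1 yK by (auto simp: K_1_def y)
        then have "0 \<le> m (u - g)" using u H10_diff[OF u(1) g] by (simp add: nonneg_functional_def)
        then show ?thesis using \<theta> by simp
      qed (use \<theta> in simp)
      ultimately show ?thesis
        using FO_residual[OF f g FO[unfolded x] yU, of \<beta> \<theta>] by (simp add: x y)
    qed
    ultimately show ?thesis by (simp add: solves_VI_def)
  qed
  have unique: "x = y"
    if "solves_VI (form \<beta> \<theta>) (rhs \<beta> \<theta> f g) K x" "solves_VI (form \<beta> \<theta>) (rhs \<beta> \<theta> f g) K y" for x y
    using subspace_U K(2) form_bounded_functional[OF \<beta>0 \<theta>] rhs_bounded_functional[OF g]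
      form_definite[OF \<beta>] that
    by (rule VI_solution_unique)
  obtain z where z: "solves_FO \<Omega> f g z" using FO_solvable[OF f g] by blast
  show "solves_VI (form \<beta> \<theta>) (rhs \<beta> \<theta> f g) K x \<longleftrightarrow> solves_FO \<Omega> f g x"
    using unique[OF _ FO_VI[OF z]] FO_VI z by blast
  show "\<exists>!x. solves_VI (form \<beta> \<theta>) (rhs \<beta> \<theta> f g) K x"
    using FO_VI[OF z] unique by blast
qed

end

theorem theorem5:
  fixes \<Omega> :: "(real^'n) set" and \<beta> C_F :: real
  assumes "CARD('n) \<in> {2, 3}"
    and "bounded \<Omega>" and "lipschitz_domain \<Omega>" and "polyhedral \<Omega>"
    and "friedrichs_constant \<Omega> C_F"
    and "\<beta> \<ge> 1 + C_F\<^sup>2"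
  shows
    "(\<forall>A F K. A \<in> {a_form \<Omega> \<beta>, b_form \<Omega> \<beta>, c_form \<Omega> \<beta>} \<longrightarrow>
        bounded_functional_on (U \<Omega>) (U_norm \<Omega>) F \<longrightarrow>
        K \<subseteq> U \<Omega> \<longrightarrow> K \<noteq> {} \<longrightarrow> convex K \<longrightarrow> closedin (U_topology \<Omega>) K \<longrightarrow>
        (\<exists>!u. solves_VI A F K u)) \<and>
     (\<forall>f\<in>L2 \<Omega>. \<forall>g\<in>H10 \<Omega>.
        (\<exists>!u. solves_VI (a_form \<Omega> \<beta>) (F_rhs \<Omega> \<beta> f g) (K_s \<Omega> g) u) \<and>
        (\<exists>!u. solves_VI (b_form \<Omega> \<beta>) (G_rhs \<Omega> \<beta> f) (K_0 \<Omega> g) u) \<and>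
        (\<exists>!u. solves_VI (c_form \<Omega> \<beta>) (H_rhs \<Omega> \<beta> f g) (K_1 \<Omega>) u) \<and>
        (\<forall>u. solves_VI (a_form \<Omega> \<beta>) (F_rhs \<Omega> \<beta> f g) (K_s \<Omega> g) u \<longleftrightarrow> solves_FO \<Omega> f g u) \<and>
        (\<forall>u. solves_VI (b_form \<Omega> \<beta>) (G_rhs \<Omega> \<beta> f) (K_0 \<Omega> g) u \<longleftrightarrow> solves_FO \<Omega> f g u) \<and>
        (\<forall>u. solves_VI (c_form \<Omega> \<beta>) (H_rhs \<Omega> \<beta> f g) (K_1 \<Omega>) u \<longleftrightarrow> solves_FO \<Omega> f g u))"
proof -
  interpret friedrichs_domain \<Omega> C_F
    using assms(3,5) by unfold_locales (auto simp: lipschitz_domain_def)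
  note \<beta> = assms(6)
  have K: "K_s \<Omega> g \<subseteq> K_0 \<Omega> g" "K_s \<Omega> g \<subseteq> K_1 \<Omega>" "K_0 \<Omega> g \<subseteq> U \<Omega>" "K_1 \<Omega> \<subseteq> U \<Omega>"
    "K_s \<Omega> g \<subseteq> U \<Omega>" for g
    by (auto simp: K_s_def K_0_def K_1_def)
  show ?thesis
    unfolding forms_eq
  proof (intro conjI allI impI ballI)
    fix A F K
    assume A: "A \<in> {form \<beta> (1/2), form \<beta> 1, form \<beta> 0}"
      and F: "bounded_functional_on (U \<Omega>) (U_norm \<Omega>) F"
      and K: "K \<subseteq> U \<Omega>" "K \<noteq> {}" "convex K" "closedin (U_topology \<Omega>) K"
    note VI = VI_solvable[OF \<beta> _ _ F K]
    from A consider "A = form \<beta> (1/2)" | "A = form \<beta> 1" | "A = form \<beta> 0" by blast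
    then show "\<exists>!u. solves_VI A F K u"
      by cases (use VI[of "1/2"] VI[of 1] VI[of 0] in simp_all)
  next
    fix f g :: "(real^'n, real) l2" assume f: "f \<in> L2 \<Omega>" and g: "g \<in> H10 \<Omega>"
    show "\<exists>!u. solves_VI (form \<beta> (1/2)) (F_rhs \<Omega> \<beta> f g) (K_s \<Omega> g) u"
      unfolding rhs_eq[where g = g] by (rule VI_iff_FO(2)[OF \<beta> _ _ f g]) (use K in simp_all)
    show "\<exists>!u. solves_VI (form \<beta> 1) (G_rhs \<Omega> \<beta> f) (K_0 \<Omega> g) u"
      unfolding rhs_eq[where g = g] by (rule VI_iff_FO(2)[OF \<beta> _ _ f g]) (use K in simp_all)
    show "\<exists>!u. solves_VI (form \<beta> 0) (H_rhs \<Omega> \<beta> f g) (K_1 \<Omega>) u"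
      unfolding rhs_eq[where g = g] by (rule VI_iff_FO(2)[OF \<beta> _ _ f g]) (use K in simp_all)
    fix u
    show "solves_VI (form \<beta> (1/2)) (F_rhs \<Omega> \<beta> f g) (K_s \<Omega> g) u \<longleftrightarrow> solves_FO \<Omega> f g u"
      unfolding rhs_eq[where g = g] by (rule VI_iff_FO(1)[OF \<beta> _ _ f g]) (use K in simp_all)
    show "solves_VI (form \<beta> 1) (G_rhs \<Omega> \<beta> f) (K_0 \<Omega> g) u \<longleftrightarrow> solves_FO \<Omega> f g u"
      unfolding rhs_eq[where g = g] by (rule VI_iff_FO(1)[OF \<beta> _ _ f g]) (use K in simp_all)
    show "solves_VI (form \<beta> 0) (H_rhs \<Omega> \<beta> f g) (K_1 \<Omega>) u \<longleftrightarrow> solves_FO \<Omega> f g u"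
      unfolding rhs_eq[where g = g] by (rule VI_iff_FO(1)[OF \<beta> _ _ f g]) (use K in simp_all)
  qed
qed

end
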